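(* Let $\Omega\subset\mathbb{R}^2$ be compact with Lipschitz boundary $\Gamma$ and connected complement $\Omega_e=\mathbb{R}^2\setminus\Omega$. There exist positive constants $C_0,C_2,C_3$, depending only on $\Omega$, such that $$\|S_k\|\le C_0(1-\log k)\quad\text{for }0<k\le1,$$ and $$\|A_{k,\eta}\|\le1+C_3+C_2k^{1/2}+C_0|\eta|(1-\log k)\quad\text{for }0<k\le1\text{ and }\eta\in\mathbb{R}\setminus\{0\}.$$
   Context: For $k>0$ let $\Phi(x,y):=\frac{\mathrm{i}}{4}H_0^{(1)}(k|x-y|)$, $x,y\in\mathbb{R}^2$, $x\ne y$, where $H_0^{(1)}$ is the Hankel function of the first kind of order zero. For $\varphi\in L^2(\Gamma)$ and $x\in\Gamma$ define $$S_k\varphi(x):=2\int_\Gamma\Phi(x,y)\varphi(y)\,ds(y),\qquad D_k\varphi(x):=2\int_\Gamma\frac{\partial\Phi(x,y)}{\partial\nu(y)}\varphi(y)\,ds(y),$$ where $\nu$ is the unit normal directed into $\Omega_e$ and, on a Lipschitz boundary, the integral for $D_k$ is understood in the usual principal value sense. $A_{k,\eta}:=I+D_k-\mathrm{i}\eta S_k$ on $L^2(\Gamma)$, and $\|\cdot\|$ is the operator norm on $L^2(\Gamma)$. *)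

theory Defs
  imports "HOL-Analysis.Analysis"
begin

section \<open>Lipschitz boundaries and the outward normal\<close>

text \<open>
  In the orthonormal frame \<open>a, b\<close>, the set \<open>\<Omega>\<close> coincides inside \<open>W\<close> with the closed hypograph of
  the Lipschitz function \<open>f\<close>.  All sets \<open>\<Omega>\<close> below are closed, hence the non-strict inequality.
\<close>

definition lipschitz_chart ::
  "(real^2) set \<Rightarrow> (real^2) set \<Rightarrow> real^2 \<Rightarrow> real^2 \<Rightarrow> (real \<Rightarrow> real) \<Rightarrow> bool"
where
  "lipschitz_chart \<Omega> W a b f \<longleftrightarrow>
     open W \<and> norm a = 1 \<and> norm b = 1 \<and> a \<bullet> b = 0 \<and>
     (\<exists>L. L-lipschitz_on UNIV f) \<and>
     \<Omega> \<inter> W = {x \<in> W. x \<bullet> b \<le> f (x \<bullet> a)}"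

definition lipschitz_boundary :: "(real^2) set \<Rightarrow> bool"
where
  "lipschitz_boundary \<Omega> \<longleftrightarrow>
     (\<forall>x \<in> frontier \<Omega>. \<exists>W a b f. x \<in> W \<and> lipschitz_chart \<Omega> W a b f)"

text \<open>
  The unit normal pointing out of \<open>\<Omega>\<close>.  By Rademacher's theorem a chart function is
  differentiable almost everywhere; where it is, the vector is independent of the chart.
  At the remaining boundary points (a set of arc length zero) the value is unspecified.
\<close>

definition outward_normal :: "(real^2) set \<Rightarrow> real^2 \<Rightarrow> real^2"
where
  "outward_normal \<Omega> y =
     (THE n. \<exists>W a b f d. lipschitz_chart \<Omega> W a b f \<and> y \<in> W \<and>
        (f has_real_derivative d) (at (y \<bullet> a)) \<and>
        n = (1 / sqrt (1 + d\<^sup>2)) *\<^sub>R (b - d *\<^sub>R a))"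

section \<open>Arc length\<close>

text \<open>
  The arc length measure is the one-dimensional Hausdorff measure.  Covering by sets of
  diameter at most \<open>\<delta>\<close> needs no normalising constant in dimension one.  Boundedness is
  required because \<^const>\<open>diameter\<close> is only meaningful for bounded sets.
\<close>

definition hausdorff1_outer :: "(real^2) set \<Rightarrow> ennreal"
where
  "hausdorff1_outer A =
     (SUP \<delta> \<in> {0<..}.
        INF U \<in> {U :: nat \<Rightarrow> (real^2) set.
                  A \<subseteq> (\<Union>i. U i) \<and> (\<forall>i. bounded (U i) \<and> diameter (U i) \<le> \<delta>)}.
          \<Sum>i. ennreal (diameter (U i)))"

definition hausdorff1 :: "(real^2) measure"
where
  "hausdorff1 = measure_of UNIV (sets borel) hausdorff1_outer"

text \<open>The completion makes functions that are only defined almost everywhere measurable.\<close>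

definition arclength_on :: "(real^2) set \<Rightarrow> (real^2) measure"
where
  "arclength_on \<Gamma> = completion (restrict_space hausdorff1 \<Gamma>)"

section \<open>The space \<open>L\<^sup>2\<close> and its operator norm\<close>

definition L2_space :: "'a measure \<Rightarrow> ('a \<Rightarrow> complex) set"
where
  "L2_space M = {\<phi> \<in> borel_measurable M. integrable M (\<lambda>x. (cmod (\<phi> x))\<^sup>2)}"

definition L2_norm :: "'a measure \<Rightarrow> ('a \<Rightarrow> complex) \<Rightarrow> real"
where
  "L2_norm M \<phi> = sqrt (LINT x|M. (cmod (\<phi> x))\<^sup>2)"

text \<open>The value is \<open>\<infinity>\<close> if \<open>T\<close> is unbounded, or does not map the unit ball of \<open>L\<^sup>2\<close> into \<open>L\<^sup>2\<close>.\<close>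

definition L2_op_norm :: "'a measure \<Rightarrow> (('a \<Rightarrow> complex) \<Rightarrow> 'a \<Rightarrow> complex) \<Rightarrow> ennreal"
where
  "L2_op_norm M T =
     (SUP \<phi> \<in> {\<phi> \<in> L2_space M. L2_norm M \<phi> \<le> 1}.
        if T \<phi> \<in> L2_space M then ennreal (L2_norm M (T \<phi>)) else \<infinity>)"

section \<open>The Hankel function and the layer potentials\<close>

text \<open>
  Bessel functions of order zero for real arguments \<open>z > 0\<close>, by their classical ascending series;
  \<^term>\<open>harm m\<close> is the \<open>m\<close>-th harmonic number.
\<close>

definition bessel_J0 :: "real \<Rightarrow> real"
where
  "bessel_J0 z = (\<Sum>m. (-1) ^ m * (z / 2) ^ (2 * m) / (fact m)\<^sup>2)"

definition bessel_Y0 :: "real \<Rightarrow> real"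
where
  "bessel_Y0 z =
     2 / pi * ((ln (z / 2) + euler_mascheroni) * bessel_J0 z
       - (\<Sum>m. (-1) ^ m * harm m * (z / 2) ^ (2 * m) / (fact m)\<^sup>2))"

definition hankel1_0 :: "real \<Rightarrow> complex"
where
  "hankel1_0 z = Complex (bessel_J0 z) (bessel_Y0 z)"

definition fund_sol :: "real \<Rightarrow> real^2 \<Rightarrow> real^2 \<Rightarrow> complex"
where
  "fund_sol k x y = \<i> / 4 * hankel1_0 (k * dist x y)"

definition fund_sol_normal_deriv :: "(real^2) set \<Rightarrow> real \<Rightarrow> real^2 \<Rightarrow> real^2 \<Rightarrow> complex"
where
  "fund_sol_normal_deriv \<Omega> k x y =
     vector_derivative (\<lambda>t. fund_sol k x (y + t *\<^sub>R outward_normal \<Omega> y)) (at 0)"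

definition single_layer ::
  "(real^2) set \<Rightarrow> real \<Rightarrow> (real^2 \<Rightarrow> complex) \<Rightarrow> real^2 \<Rightarrow> complex"
where
  "single_layer \<Omega> k \<phi> x =
     2 * (LINT y|arclength_on (frontier \<Omega>). fund_sol k x y * \<phi> y)"

definition double_layer ::
  "(real^2) set \<Rightarrow> real \<Rightarrow> (real^2 \<Rightarrow> complex) \<Rightarrow> real^2 \<Rightarrow> complex"
where
  "double_layer \<Omega> k \<phi> x =
     2 * Lim (at_right 0) (\<lambda>\<epsilon>.
       LINT y:{y. \<epsilon> < dist x y}|arclength_on (frontier \<Omega>). fund_sol_normal_deriv \<Omega> k x y * \<phi> y)"

definition combined_layer ::
  "(real^2) set \<Rightarrow> real \<Rightarrow> real \<Rightarrow> (real^2 \<Rightarrow> complex) \<Rightarrow> real^2 \<Rightarrow> complex"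
where
  "combined_layer \<Omega> k \<eta> \<phi> x =
     \<phi> x + double_layer \<Omega> k \<phi> x - \<i> * of_real \<eta> * single_layer \<Omega> k \<phi> x"

end

theory Submission
  imports Defs
begin

text \<open>
  Only the singular part of the double layer kernel is delicate. Writing the plane as the complex
  numbers, it is the real part of a bounded function of \<open>y\<close> (the normal) times the Cauchy kernel, so
  everything reduces to a bound for the truncated Cauchy integral on a Lipschitz graph that is uniform
  in the truncation. Discretising at the scale of the truncation leaves a matrix \<open>1 / (z\<^sub>j - z\<^sub>i)\<close>, with
  \<open>z\<^sub>j = j + \<i> A\<^sub>j\<close> and \<open>A\<close> Lipschitz, up to an error that is summable in rows and columns. This matrix
  is bounded by the method of Coifman, Jones and Semmes: it is close to the second differences
  of \<open>w log w - w\<close>, and in a Haar system adapted to the measure \<open>dz\<close> these decay away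
  from the diagonal, because a Haar function against an interval is a difference of two
  difference quotients of \<open>w log w - w\<close>. The adapted Haar coefficients are square summable by
  a Bellman function argument.

  Two features of the definitions simplify the rest. Only upper bounds for the arc length are needed.
  The principal value may fail to exist at some points, but there it is a fixed number,
  so that Fatou's lemma on the set of convergence suffices; likewise the normal only has
  to be bounded and measurable.
\<close>

section \<open>The primitive of the logarithm in a half plane\<close>

text \<open>A Cauchy kernel has no closed sum over a pair of intervals, whereas a mixed second
  difference telescopes over every rectangle; this is why the matrix is traded for
  \<open>ker\<close>. After summation only values of a primitive at interval endpoints remain, and
  all estimates are elementary inequalities for \<open>Ln\<close> in a half plane. Of two Haar
  functions only the finer one supplies cancellation: the coarser one enters through intervals, and
  the interaction decays with the distance of their endpoints from the finer one, in units of the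
  finer scale. With R the ratio of the lengths, the weight (1 + |u|)^(-5/4) costs a factor R^(1/4),
  normalisation in l^2 gains R^(-1/2), and the remaining R^(-1/4) is summable over the scales; any
  exponent strictly between 1 and 3/2 would serve.

  Every constant for the matrix depends on the Lipschitz bound alone. Rescaling a graph preserves
  that bound, so the truncation level can be taken as the mesh and uniformity in the truncation is
  automatic. Uniformity in k holds because the wave number cancels from the singular part of the
  double layer kernel.\<close>

lemma convex_halfplane_Re_ge: "convex {z::complex. r \<le> Re z}"
  using convex_halfspace_Re_ge[of r] by simp

lemma not_nonpos_if_Re_pos: "Re z > 0 \<Longrightarrow> z \<notin> \<real>\<^sub>\<le>\<^sub>0"
  by (auto simp: complex_nonpos_Reals_iff)

lemma norm_ge_Re: "r \<le> Re z \<Longrightarrow> r \<le> norm z"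
  using complex_Re_le_cmod[of z] by linarith

lemma Ln_diff_le:
  assumes "r > 0" "r \<le> Re a" "r \<le> Re b"
  shows "norm (Ln a - Ln b) \<le> norm (a - b) / r"
proof -
  have "norm (Ln a - Ln b) \<le> (1/r) * norm (a - b)"
  proof (rule field_differentiable_bound[OF convex_halfplane_Re_ge[of r]])
    fix z :: complex assume z: "z \<in> {z. r \<le> Re z}"
    show "(Ln has_field_derivative 1/z) (at z within {z. r \<le> Re z})"
      using z assms not_nonpos_if_Re_pos[of z] has_field_derivative_Ln[of z]
      by (auto intro!: has_field_derivative_at_within simp: field_simps)
    show "norm (1/z) \<le> 1/r"
      using z assms norm_ge_Re[of r z] by (auto simp: norm_divide intro!: frac_le)
  qed (use assms in auto)
  then show ?thesis by simp
qed

text \<open>The factor w is frozen: x \<mapsto> w Ln x - x has the derivative (w - x) / x, which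
  vanishes at w and is at most |w - v| / r on the segment. Hence the bound is quadratic.\<close>

lemma Ln_first_order:
  assumes "r > 0" "r \<le> Re w" "r \<le> Re v"
  shows "norm (w * (Ln w - Ln v) - (w - v)) \<le> (norm (w - v))\<^sup>2 / r"
proof -
  let ?S = "closed_segment w v" and ?g = "\<lambda>x. w * Ln x - x"
  have sub: "?S \<subseteq> {z. r \<le> Re z}"
    by (rule closed_segment_subset) (use assms convex_halfplane_Re_ge in auto)
  have "norm (?g w - ?g v) \<le> (norm (w - v) / r) * norm (w - v)"
  proof (rule field_differentiable_bound[of ?S])
    fix z assume z: "z \<in> ?S"
    then have rz: "r \<le> Re z" using sub by auto
    then have zp: "z \<notin> \<real>\<^sub>\<le>\<^sub>0" "z \<noteq> 0" using not_nonpos_if_Re_pos[of z] assms by auto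
    show "(?g has_field_derivative ((w - z) / z)) (at z within ?S)"
      using zp by (auto intro!: derivative_eq_intros simp: field_simps)
    have "norm (w - z) \<le> norm (w - v)"
      using segment_bound1[OF z] by (simp add: norm_minus_commute)
    then show "norm ((w - z) / z) \<le> norm (w - v) / r"
      using norm_ge_Re[OF rz] assms by (auto simp: norm_divide intro!: frac_le)
  qed auto
  then show ?thesis by (simp add: algebra_simps power2_eq_square)
qed

text \<open>The mean value inequality for Ln x - x / v, whose derivative (v - x) / (x v) vanishes at
  v and is of first order on the segment.\<close>

lemma Ln_second_order:
  assumes "r > 0" "r \<le> Re w" "r \<le> Re v"
  shows "norm (Ln w - Ln v - (w - v) / v) \<le> (norm (w - v) / r)\<^sup>2"
proof -
  let ?S = "closed_segment v w" and ?g = "\<lambda>x. Ln x - x / v"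
  have sub: "?S \<subseteq> {z. r \<le> Re z}"
    by (rule closed_segment_subset) (use assms convex_halfplane_Re_ge in auto)
  have v: "v \<noteq> 0" "r \<le> norm v" using assms norm_ge_Re[of r v] by auto
  have "norm (?g w - ?g v) \<le> (norm (w - v) / (r * r)) * norm (w - v)"
  proof (rule field_differentiable_bound[of ?S])
    fix z assume z: "z \<in> ?S"
    then have rz: "r \<le> Re z" using sub by auto
    then have zp: "z \<notin> \<real>\<^sub>\<le>\<^sub>0" "z \<noteq> 0" using not_nonpos_if_Re_pos[of z] assms by auto
    show "(?g has_field_derivative ((v - z) / (z * v))) (at z within ?S)"
    proof -
      have "(?g has_field_derivative (1 / z - 1 / v)) (at z within ?S)"
        using zp v by (auto intro!: derivative_eq_intros simp: inverse_eq_divide)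
      moreover have "1 / z - 1 / v = (v - z) / (z * v)"
        using zp v by (simp add: diff_frac_eq)
      ultimately show ?thesis by simp
    qed
    have "norm (v - z) \<le> norm (w - v)"
      using segment_bound1[OF z] by (simp add: norm_minus_commute)
    then show "norm ((v - z) / (z * v)) \<le> norm (w - v) / (r * r)"
      using norm_ge_Re[OF rz] assms v by (auto simp: norm_divide norm_mult intro!: frac_le mult_mono)
  qed auto
  moreover have "?g w - ?g v = Ln w - Ln v - (w - v) / v"
    by (simp add: diff_divide_distrib)
  moreover have "(norm (w - v) / (r * r)) * norm (w - v) = (norm (w - v) / r)\<^sup>2"
    by (simp add: power2_eq_square)
  ultimately show ?thesis by metis
qed

text \<open>The second branch makes the function odd off the imaginary axis. This choice corresponds to the
  principal value of the Cauchy integral, and makes the matrix \<open>ker\<close> below antisymmetric.\<close>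

definition log_prim :: "complex \<Rightarrow> complex" where
  "log_prim w = w * Ln (if Re w < 0 then - w else w) - w"

lemma log_prim_0 [simp]: "log_prim 0 = 0"
  by (simp add: log_prim_def)

lemma log_prim_pos: "Re w > 0 \<Longrightarrow> log_prim w = w * Ln w - w"
  by (simp add: log_prim_def)

lemma log_prim_uminus:
  assumes "w = 0 \<or> Re w \<noteq> 0"
  shows "log_prim (- w) = - log_prim w"
  using assms by (auto simp: log_prim_def)

section \<open>Difference quotients of the primitive\<close>

definition log_slope :: "complex \<Rightarrow> complex \<Rightarrow> complex" where
  "log_slope u v = (log_prim u - log_prim v) / (u - v)"

lemma log_slope_uminus:
  assumes "u = 0 \<or> Re u \<noteq> 0" "v = 0 \<or> Re v \<noteq> 0"
  shows "log_slope (- u) (- v) = log_slope u v"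
proof -
  have "(- log_prim u - - log_prim v) / (- u - - v) = (log_prim u - log_prim v) / (u - v)"
    by (metis minus_diff_minus minus_divide_divide)
  then show ?thesis unfolding log_slope_def using assms by (simp add: log_prim_uminus)
qed

lemma log_slope_commute: "log_slope u v = log_slope v u"
  unfolding log_slope_def by (metis minus_diff_eq minus_divide_divide)

lemma log_slope_left:
  assumes "Re u > 0" "Re v > 0" "u \<noteq> v"
  shows "log_slope u v = Ln v + (u * (Ln u - Ln v) - (u - v)) / (u - v)"
  using assms by (simp add: log_slope_def log_prim_pos field_simps)

text \<open>Both slopes are compared with \<open>Ln w2\<close>, which cancels: by
  \<open>log_slope_left\<close> each differs from it by a first order remainder. The gain l / (d +
  l) is the ratio of the spacing to the distance from the origin. The third point may be the origin
  itself, which happens when an interval endpoint coincides with the point of evaluation.\<close>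

lemma log_slope_diff_near:
  fixes w1 w2 w3 :: complex
  assumes d: "0 \<le> d" and l: "0 < l" and L: "1 \<le> L"
    and re: "Re w3 = d" "Re w2 = d + l" "Re w1 = d + 2 * l"
    and nrm: "norm (w1 - w2) \<le> L * l" "norm (w2 - w3) \<le> L * l" "norm w3 \<le> L * d"
  shows "norm (log_slope w1 w2 - log_slope w2 w3) \<le> 5 * L * (l / (d + l))"
proof -
  have n12: "norm (w1 - w2) > 0" "norm (w2 - w3) > 0"
    using re l by auto
  have pos: "Re w1 > 0" "Re w2 > 0" and ne: "w1 \<noteq> w2" "w3 \<noteq> w2" using re l d by auto
  let ?A = "(w1 * (Ln w1 - Ln w2) - (w1 - w2)) / (w1 - w2)"
  have "norm (w1 * (Ln w1 - Ln w2) - (w1 - w2)) \<le> (norm (w1 - w2))\<^sup>2 / (d + l)"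
    by (rule Ln_first_order) (use re l d in auto)
  then have "norm ?A \<le> ((norm (w1 - w2))\<^sup>2 / (d + l)) / norm (w1 - w2)"
    unfolding norm_divide by (rule divide_right_mono) simp
  also have "\<dots> = norm (w1 - w2) / (d + l)"
    using n12 by (simp add: power2_eq_square)
  also have "\<dots> \<le> L * l / (d + l)" using nrm d l by (intro divide_right_mono) auto
  finally have A: "norm ?A \<le> L * (l / (d + l))" by simp
  have B: "norm (log_slope w3 w2 - Ln w2) \<le> 4 * L * (l / (d + l))"
  proof (cases "d = 0")
    case True
    then have "w3 = 0" using nrm by simp
    then have "log_slope w3 w2 - Ln w2 = -1"
      using ne pos by (simp add: log_slope_def log_prim_pos field_simps)
    then show ?thesis using True l L by simp
  next
    case False
    then have d': "d > 0" using d by simp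
    let ?B = "(w3 * (Ln w3 - Ln w2) - (w3 - w2)) / (w3 - w2)"
    have eq: "log_slope w3 w2 - Ln w2 = ?B"
      using log_slope_left[of w3 w2] pos ne re d' by simp
    have n3: "norm (w3 - w2) > 0" using ne by simp
    show ?thesis
    proof (cases "l \<le> d")
      case True
      have "norm (w3 * (Ln w3 - Ln w2) - (w3 - w2)) \<le> (norm (w3 - w2))\<^sup>2 / d"
        by (rule Ln_first_order) (use re l d' in auto)
      then have "norm ?B \<le> ((norm (w3 - w2))\<^sup>2 / d) / norm (w3 - w2)"
        unfolding norm_divide by (rule divide_right_mono) simp
      also have "\<dots> = norm (w3 - w2) / d"
        using n3 by (simp add: power2_eq_square)
      also have "\<dots> \<le> L * l / d"
        using nrm d' by (intro divide_right_mono) (auto simp: norm_minus_commute)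
      also have "\<dots> \<le> 4 * L * (l / (d + l))"
      proof -
        have "L * l * (d + l) \<le> L * l * (4 * d)"
          using True d' l L by (intro mult_left_mono) auto
        then show ?thesis using d' l by (simp add: divide_simps algebra_simps)
      qed
      finally show ?thesis unfolding eq .
    next
      case False
      \<comment> \<open>For d < l the remainder estimate is too weak, since it divides by d. Here
        \<open>norm w3 \<le> L * d\<close> absorbs that division, and a bound without decay is
        enough because l / (d + l) is at least 1 / 2.\<close>
      have "norm (Ln w3 - Ln w2) \<le> norm (w3 - w2) / d"
        by (rule Ln_diff_le) (use re l d' in auto)
      then have "norm (w3 * (Ln w3 - Ln w2)) \<le> (L * d) * (norm (w3 - w2) / d)"
        unfolding norm_mult using nrm d' L by (intro mult_mono) auto
      then have 1: "norm (w3 * (Ln w3 - Ln w2)) \<le> L * norm (w3 - w2)" using d' by simp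
      have "norm ?B \<le> (L * norm (w3 - w2) + norm (w3 - w2)) / norm (w3 - w2)"
        unfolding norm_divide
        by (intro divide_right_mono order_trans[OF norm_triangle_ineq4]) (use 1 in auto)
      also have "\<dots> = L + 1" using n3 by (simp add: field_simps)
      also have "\<dots> \<le> 2 * L" using L by simp
      also have "\<dots> \<le> 4 * L * (l / (d + l))"
      proof -
        have "2 * L * (d + l) \<le> 2 * L * (2 * l)"
          using False L by (intro mult_left_mono) auto
        then show ?thesis using d' l by (simp add: divide_simps algebra_simps)
      qed
      finally show ?thesis unfolding eq .
    qed
  qed
  have "log_slope w1 w2 - log_slope w2 w3 = ?A - (log_slope w3 w2 - Ln w2)"
    using log_slope_left[OF pos ne(1)] log_slope_commute[of w2 w3] by simp
  then have "norm (log_slope w1 w2 - log_slope w2 w3) \<le> norm ?A + norm (log_slope w3 w2 - Ln w2)"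
    by (metis norm_triangle_ineq4)
  also have "\<dots> \<le> 5 * L * (l / (d + l))" using A B by simp
  finally show ?thesis .
qed

text \<open>The point of evaluation is the midpoint. Thanks to the second branch of
  \<open>log_prim\<close> the two slopes are Ln w1 - 1 and Ln (- w3) - 1; each depends on the scale
  l, but their difference is bounded independently of it.\<close>

lemma log_slope_diff_mid:
  fixes w1 w3 :: complex
  assumes l: "0 < l" and re: "Re w1 = l" "Re w3 = - l"
    and nrm: "norm w1 \<le> L * l" "norm w3 \<le> L * l"
  shows "norm (log_slope w1 0 - log_slope 0 w3) \<le> 2 * L"
proof -
  have "log_slope w1 0 - log_slope 0 w3 = Ln w1 - Ln (- w3)"
  proof -
    have "w1 \<noteq> 0" "w3 \<noteq> 0" using l re by auto
    then have "log_slope w1 0 = Ln w1 - 1" "log_slope 0 w3 = Ln (- w3) - 1"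
      using l re by (auto simp: log_slope_def log_prim_def diff_divide_distrib)
    then show ?thesis by simp
  qed
  then have "norm (log_slope w1 0 - log_slope 0 w3) \<le> norm (w1 - (- w3)) / l"
    using Ln_diff_le[of l w1 "- w3"] l re by simp
  also have "\<dots> \<le> (L * l + L * l) / l"
    using nrm l by (intro divide_right_mono) (auto intro: order_trans[OF norm_triangle_ineq])
  also have "\<dots> = 2 * L" using l by simp
  finally show ?thesis .
qed

text \<open>Differentiating in the common translation x leaves two difference quotients of Ln. Both
  are within L l / d^2 of 1 / (w2 + x), so the leading terms cancel, and the mean value inequality
  on the segment from 0 to h supplies the factor \<open>norm h\<close>.\<close>

lemma log_slope_diff_far:
  fixes w1 w2 w3 h :: complex
  assumes d: "0 < d" and l: "0 < l" and L: "1 \<le> L"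
    and re: "d \<le> Re w3" "d \<le> Re w2" "d \<le> Re w1" "0 \<le> Re h"
    and ne: "w1 \<noteq> w2" "w2 \<noteq> w3"
    and nrm: "norm (w1 - w2) \<le> L * l" "norm (w2 - w3) \<le> L * l"
  shows "norm ((log_slope (w1 + h) (w2 + h) - log_slope (w2 + h) (w3 + h))
             - (log_slope w1 w2 - log_slope w2 w3)) \<le> 2 * L * l / d\<^sup>2 * norm h"
proof -
  let ?S = "closed_segment 0 h"
  let ?E = "\<lambda>x. ((w1 + x) * Ln (w1 + x) - (w2 + x) * Ln (w2 + x)) / (w1 - w2)
               - ((w2 + x) * Ln (w2 + x) - (w3 + x) * Ln (w3 + x)) / (w2 - w3)"
  let ?E' = "\<lambda>x. (Ln (w1 + x) - Ln (w2 + x)) / (w1 - w2)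
               - (Ln (w2 + x) - Ln (w3 + x)) / (w2 - w3)"
  have sub: "?S \<subseteq> {z. 0 \<le> Re z}"
    by (rule closed_segment_subset) (use re convex_halfplane_Re_ge[of 0] in auto)
  have slope: "log_slope (w1 + x) (w2 + x) - log_slope (w2 + x) (w3 + x) = ?E x"
    if "0 \<le> Re x" for x
  proof -
    have *: "log_slope (u + x) (v + x) = ((u + x) * Ln (u + x) - (v + x) * Ln (v + x)) / (u - v) - 1"
      if "d \<le> Re u" "d \<le> Re v" "u \<noteq> v" for u v
      using that d \<open>0 \<le> Re x\<close> by (simp add: log_slope_def log_prim_pos field_simps)
    show ?thesis using *[of w1 w2] *[of w2 w3] re ne by simp
  qed
  have "norm (?E h - ?E 0) \<le> (2 * L * l / d\<^sup>2) * norm (h - 0)"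
  proof (rule field_differentiable_bound[of ?S])
    fix x assume x: "x \<in> ?S"
    then have rx: "0 \<le> Re x" using sub by auto
    have rr: "d \<le> Re (w1 + x)" "d \<le> Re (w2 + x)" "d \<le> Re (w3 + x)" using re rx by auto
    then have np: "w1 + x \<notin> \<real>\<^sub>\<le>\<^sub>0" "w2 + x \<notin> \<real>\<^sub>\<le>\<^sub>0" "w3 + x \<notin> \<real>\<^sub>\<le>\<^sub>0"
      and nz: "w1 + x \<noteq> 0" "w2 + x \<noteq> 0" "w3 + x \<noteq> 0"
      using d not_nonpos_if_Re_pos[of "w1 + x"] not_nonpos_if_Re_pos[of "w2 + x"]
        not_nonpos_if_Re_pos[of "w3 + x"] by fastforce+
    have D: "((\<lambda>x. (w + x) * Ln (w + x)) has_field_derivative (Ln (w + x) + 1)) (at x within ?S)"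
      if "w + x \<notin> \<real>\<^sub>\<le>\<^sub>0" "w + x \<noteq> 0" for w
      using that by (auto intro!: derivative_eq_intros)
    have "(?E has_field_derivative
        ((Ln (w1 + x) + 1) - (Ln (w2 + x) + 1)) / (w1 - w2)
      - ((Ln (w2 + x) + 1) - (Ln (w3 + x) + 1)) / (w2 - w3)) (at x within ?S)"
      by (intro DERIV_diff DERIV_cdivide D np nz)
    then show "(?E has_field_derivative ?E' x) (at x within ?S)" by simp
    have n1: "norm (w1 - w2) > 0" "norm (w2 - w3) > 0" using ne by auto
    have a: "norm ((Ln (w1 + x) - Ln (w2 + x)) / (w1 - w2) - 1 / (w2 + x)) \<le> L * l / d\<^sup>2"
    proof -
      have "norm (Ln (w1 + x) - Ln (w2 + x) - (w1 - w2) / (w2 + x)) \<le> (norm (w1 - w2) / d)\<^sup>2"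
        using Ln_second_order[of d "w1 + x" "w2 + x"] d rr by simp
      moreover have "(Ln (w1 + x) - Ln (w2 + x)) / (w1 - w2) - 1 / (w2 + x)
          = (Ln (w1 + x) - Ln (w2 + x) - (w1 - w2) / (w2 + x)) / (w1 - w2)"
        using ne nz by (simp add: diff_divide_distrib[of "Ln (w1 + x) - Ln (w2 + x)"])
      ultimately have "norm ((Ln (w1 + x) - Ln (w2 + x)) / (w1 - w2) - 1 / (w2 + x))
          \<le> (norm (w1 - w2) / d)\<^sup>2 / norm (w1 - w2)"
        by (simp add: norm_divide divide_right_mono)
      also have "\<dots> = norm (w1 - w2) / d\<^sup>2" using n1 by (simp add: power2_eq_square)
      also have "\<dots> \<le> L * l / d\<^sup>2" using nrm by (intro divide_right_mono) auto
      finally show ?thesis .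
    qed
    have b: "norm ((Ln (w2 + x) - Ln (w3 + x)) / (w2 - w3) - 1 / (w2 + x)) \<le> L * l / d\<^sup>2"
    proof -
      have "norm (Ln (w3 + x) - Ln (w2 + x) - (w3 - w2) / (w2 + x)) \<le> (norm (w3 - w2) / d)\<^sup>2"
        using Ln_second_order[of d "w3 + x" "w2 + x"] d rr by simp
      moreover have "(Ln (w2 + x) - Ln (w3 + x)) / (w2 - w3) - 1 / (w2 + x)
          = (Ln (w3 + x) - Ln (w2 + x) - (w3 - w2) / (w2 + x)) / (w3 - w2)"
        using ne nz by (simp add: divide_simps) (simp add: algebra_simps)
      ultimately have "norm ((Ln (w2 + x) - Ln (w3 + x)) / (w2 - w3) - 1 / (w2 + x))
          \<le> (norm (w3 - w2) / d)\<^sup>2 / norm (w3 - w2)"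
        by (simp add: norm_divide divide_right_mono)
      also have "\<dots> = norm (w2 - w3) / d\<^sup>2" using n1 by (simp add: power2_eq_square norm_minus_commute)
      also have "\<dots> \<le> L * l / d\<^sup>2" using nrm by (intro divide_right_mono) auto
      finally show ?thesis .
    qed
    have "?E' x = ((Ln (w1 + x) - Ln (w2 + x)) / (w1 - w2) - 1 / (w2 + x))
       - ((Ln (w2 + x) - Ln (w3 + x)) / (w2 - w3) - 1 / (w2 + x))" by simp
    then have "norm (?E' x) \<le> L * l / d\<^sup>2 + L * l / d\<^sup>2"
      by (simp only:) (intro order_trans[OF norm_triangle_ineq4] add_mono a b)
    then show "norm (?E' x) \<le> 2 * L * l / d\<^sup>2" by (simp add: field_simps)
  qed auto
  then show ?thesis using slope[of h] slope[of 0] re by simp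
qed

section \<open>The Cauchy matrix of a Lipschitz sequence\<close>

lemma Schur_sum:
  fixes a :: "'s \<Rightarrow> real" and b :: "'t \<Rightarrow> real"
  assumes fin: "finite S" "finite T"
    and w: "\<And>s t. s \<in> S \<Longrightarrow> t \<in> T \<Longrightarrow> 0 \<le> w s t"
    and row: "\<And>s. s \<in> S \<Longrightarrow> (\<Sum>t\<in>T. w s t) \<le> X"
    and col: "\<And>t. t \<in> T \<Longrightarrow> (\<Sum>s\<in>S. w s t) \<le> X"
    and X: "0 \<le> X"
  shows "(\<Sum>s\<in>S. \<Sum>t\<in>T. a s * b t * w s t) \<le> X * sqrt (\<Sum>s\<in>S. (a s)\<^sup>2) * sqrt (\<Sum>t\<in>T. (b t)\<^sup>2)"
proof -
  let ?x = "\<lambda>(s, t). a s * sqrt (w s t)" and ?y = "\<lambda>(s, t). b t * sqrt (w s t)"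
  let ?I = "S \<times> T"
  have sq: "sqrt (w s t) * sqrt (w s t) = w s t" if "s \<in> S" "t \<in> T" for s t
    using w[OF that] by simp
  have 1: "(\<Sum>s\<in>S. \<Sum>t\<in>T. a s * b t * w s t) = (\<Sum>i\<in>?I. ?x i * ?y i)"
    unfolding sum.cartesian_product
    by (intro sum.cong refl) (use sq in \<open>auto simp: algebra_simps\<close>)
  have "(\<Sum>i\<in>?I. (?x i)\<^sup>2) = (\<Sum>s\<in>S. \<Sum>t\<in>T. (a s)\<^sup>2 * w s t)"
    unfolding sum.cartesian_product
    by (intro sum.cong refl) (use w in \<open>auto simp: power_mult_distrib\<close>)
  also have "\<dots> \<le> (\<Sum>s\<in>S. (a s)\<^sup>2 * X)"
    unfolding sum_distrib_left[symmetric] by (intro sum_mono mult_left_mono row) auto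
  finally have x: "(\<Sum>i\<in>?I. (?x i)\<^sup>2) \<le> X * (\<Sum>s\<in>S. (a s)\<^sup>2)"
    by (simp add: sum_distrib_left mult.commute)
  have "(\<Sum>i\<in>?I. (?y i)\<^sup>2) = (\<Sum>s\<in>S. \<Sum>t\<in>T. (b t)\<^sup>2 * w s t)"
    unfolding sum.cartesian_product
    by (intro sum.cong refl) (use w in \<open>auto simp: power_mult_distrib\<close>)
  also have "\<dots> = (\<Sum>t\<in>T. \<Sum>s\<in>S. (b t)\<^sup>2 * w s t)" by (rule sum.swap)
  also have "\<dots> \<le> (\<Sum>t\<in>T. (b t)\<^sup>2 * X)"
    unfolding sum_distrib_left[symmetric] by (intro sum_mono mult_left_mono col) auto
  finally have y: "(\<Sum>i\<in>?I. (?y i)\<^sup>2) \<le> X * (\<Sum>t\<in>T. (b t)\<^sup>2)"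
    by (simp add: sum_distrib_left mult.commute)
  have "(\<Sum>i\<in>?I. ?x i * ?y i) \<le> sqrt ((\<Sum>i\<in>?I. ?x i * ?y i)\<^sup>2)" by simp
  also have "\<dots> \<le> sqrt ((\<Sum>i\<in>?I. (?x i)\<^sup>2) * (\<Sum>i\<in>?I. (?y i)\<^sup>2))"
    by (intro real_sqrt_le_mono Cauchy_Schwarz_ineq_sum)
  also have "\<dots> \<le> sqrt ((X * (\<Sum>s\<in>S. (a s)\<^sup>2)) * (X * (\<Sum>t\<in>T. (b t)\<^sup>2)))"
    by (intro real_sqrt_le_mono mult_mono x y) (auto intro!: sum_nonneg mult_nonneg_nonneg X)
  also have "\<dots> = X * sqrt (\<Sum>s\<in>S. (a s)\<^sup>2) * sqrt (\<Sum>t\<in>T. (b t)\<^sup>2)"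
    using X by (simp add: real_sqrt_mult)
  finally show ?thesis using 1 by simp
qed

definition decay :: "int \<Rightarrow> real" where
  "decay u = (1 + real_of_int \<bar>u\<bar>) powr (- 5 / 4)"

text \<open>The factor 2 covers the two half lines of the integers, with 0 counted twice.\<close>

definition decay_sum :: real where
  "decay_sum = 2 * (\<Sum>k. decay (int k))"

lemma decay_nonneg: "0 \<le> decay u"
  by (simp add: decay_def)

lemma summable_decay: "summable (\<lambda>k. decay (int k))"
proof -
  have "summable (\<lambda>k. real (Suc k) powr (- 5 / 4))"
    using summable_Suc_iff[of "\<lambda>k. real k powr (- 5 / 4)"] by (simp add: summable_real_powr_iff)
  then show ?thesis by (simp add: decay_def)
qed

lemma sum_decay_le:
  assumes "finite S" "inj_on u S"
  shows "(\<Sum>s\<in>S. decay (u s)) \<le> decay_sum"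
proof -
  let ?T = "u ` S"
  let ?P = "{x\<in>?T. 0 \<le> x}" and ?N = "{x\<in>?T. x < 0}"
  have fin: "finite ?P" "finite ?N" using assms by auto
  have "(\<Sum>s\<in>S. decay (u s)) = (\<Sum>x\<in>?T. decay x)"
    using assms by (simp add: sum.reindex)
  also have "\<dots> = (\<Sum>x\<in>?P. decay x) + (\<Sum>x\<in>?N. decay x)"
    by (subst sum.union_disjoint[symmetric]) (use fin in \<open>auto intro!: sum.cong\<close>)
  also have "(\<Sum>x\<in>?P. decay x) = (\<Sum>k\<in>nat ` ?P. decay (int k))"
    by (subst sum.reindex) (auto simp: inj_on_def)
  also have "\<dots> \<le> (\<Sum>k. decay (int k))"
    by (rule sum_le_suminf[OF summable_decay]) (use fin in \<open>auto simp: decay_nonneg\<close>)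
  also have "(\<Sum>x\<in>?N. decay x) = (\<Sum>k\<in>(\<lambda>x. nat (- x)) ` ?N. decay (int k))"
    by (subst sum.reindex) (auto simp: inj_on_def decay_def)
  also have "\<dots> \<le> (\<Sum>k. decay (int k))"
    by (rule sum_le_suminf[OF summable_decay]) (use fin in \<open>auto simp: decay_nonneg\<close>)
  finally show ?thesis by (simp add: decay_sum_def)
qed

lemma decay_sum_ge_1: "1 \<le> decay_sum"
  using sum_decay_le[of "{0::int}" "\<lambda>x. x"] by (simp add: decay_def)

text \<open>In this range the missing power (1 + |u|)^(1/4) is at most (16 R)^(1/4) = 2 R^(1/4). The
  number 16 is generous and chosen for its fourth root.\<close>

lemma inverse_le_decay:
  assumes "1 + real_of_int \<bar>u\<bar> \<le> 16 * R" "R \<ge> 1"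
  shows "1 / (1 + real_of_int \<bar>u\<bar>) \<le> 2 * R powr (1/4) * decay u"
proof -
  let ?v = "1 + real_of_int \<bar>u\<bar>"
  have v: "?v > 0" by simp
  have "?v powr (1/4) \<le> (16 * R) powr (1/4)"
    using assms by (intro powr_mono2) auto
  also have "\<dots> = 2 * R powr (1/4)"
  proof -
    have "(16::real) powr (1/4) = 2"
      using powr_powr[of "2::real" 4 "1/4"] by simp
    then show ?thesis using assms by (simp add: powr_mult)
  qed
  finally have "?v powr (1/4) * ?v powr (- 5 / 4) \<le> 2 * R powr (1/4) * ?v powr (- 5 / 4)"
    by (intro mult_right_mono) auto
  moreover have "?v powr (1/4) * ?v powr (- 5 / 4) = 1 / ?v"
    using v unfolding powr_add[symmetric] by (simp add: powr_minus_divide)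
  ultimately show ?thesis by (simp add: decay_def)
qed

text \<open>Of the factor R, the part R^(3/4) is at most (1 + |u|)^(3/4) and turns the power -2 into
  -5/4; the part R^(1/4) stays in front.\<close>

lemma inverse_square_le_decay:
  assumes "R \<le> 1 + real_of_int \<bar>u\<bar>" "R \<ge> 1"
  shows "R / (1 + real_of_int \<bar>u\<bar>)\<^sup>2 \<le> R powr (1/4) * decay u"
proof -
  let ?v = "1 + real_of_int \<bar>u\<bar>"
  have v: "?v > 0" by simp
  have e: "R = R powr (1/4) * R powr (3/4)"
    using assms by (simp add: powr_add[symmetric])
  have "R / ?v\<^sup>2 = R powr (1/4) * (R powr (3/4) * ?v powr (-2))"
    using v e by (simp add: powr_minus_divide)
  also have "\<dots> \<le> R powr (1/4) * (?v powr (3/4) * ?v powr (-2))"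
    using assms by (intro mult_left_mono mult_right_mono powr_mono2) auto
  also have "\<dots> = R powr (1/4) * decay u"
    using v by (simp add: powr_add[symmetric] decay_def)
  finally show ?thesis .
qed

section \<open>Second differences of the primitive along a Lipschitz sequence\<close>

locale lipschitz_lattice =
  fixes A :: "nat \<Rightarrow> real" and M :: real
  assumes M_nonneg: "0 \<le> M" and A_step: "\<And>j. \<bar>A (Suc j) - A j\<bar> \<le> M"
begin

definition z :: "nat \<Rightarrow> complex" where "z j = Complex (real j) (A j)"

definition b :: "nat \<Rightarrow> complex" where "b j = z (Suc j) - z j"

definition L :: real where "L = 1 + M"

lemma L_ge_1: "1 \<le> L" using M_nonneg by (simp add: L_def)

lemma Re_z [simp]: "Re (z j) = real j" and Im_z [simp]: "Im (z j) = A j"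
  by (simp_all add: z_def)

lemma A_lip: "\<bar>A i - A j\<bar> \<le> M * \<bar>real i - real j\<bar>"
proof -
  have *: "\<bar>A (j + k) - A j\<bar> \<le> M * real k" for j k
  proof (induction k)
    case (Suc k)
    show ?case using Suc A_step[of "j + k"] by (simp add: algebra_simps)
  qed simp
  show ?thesis
  proof (cases "i \<le> j")
    case True
    then show ?thesis using *[of i "j - i"] by (simp add: of_nat_diff)
  next
    case False
    then show ?thesis using *[of j "i - j"] by (simp add: of_nat_diff)
  qed
qed

lemma norm_z_diff_le: "norm (z i - z j) \<le> L * \<bar>real i - real j\<bar>"
  using cmod_le[of "z i - z j"] A_lip[of i j] by (simp add: L_def algebra_simps)

lemma norm_z_diff_ge: "\<bar>real i - real j\<bar> \<le> norm (z i - z j)"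
  using abs_Re_le_cmod[of "z i - z j"] by simp

lemma z_diff_nz: "i \<noteq> j \<Longrightarrow> z i \<noteq> z j"
  by (metis Re_z of_nat_eq_iff)

lemma z_diff_or: "z i - z j = 0 \<or> Re (z i - z j) \<noteq> 0"
  by (cases "i = j") auto

definition prim :: "nat \<Rightarrow> nat \<Rightarrow> complex" where
  "prim e x = log_prim (z e - z x)"

lemma prim_commute: "prim e x = - prim x e"
  unfolding prim_def using log_prim_uminus[OF z_diff_or[of x e]] by simp

text \<open>The mixed second difference of the primitive in its two endpoints. As w log w - w has
  second derivative 1 / w, this is the model of a double integral of the Cauchy kernel over two
  edges, and is close to b i b j / (z j - z i).\<close>

definition ker :: "nat \<Rightarrow> nat \<Rightarrow> complex" where
  "ker i j = (prim (Suc j) i - prim (Suc j) (Suc i)) - (prim j i - prim j (Suc i))"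

lemma ker_commute: "ker i j = - ker j i"
  unfolding ker_def using prim_commute[of "Suc j"] prim_commute[of j] by simp

lemma sum_ker:
  assumes "p \<le> p'" "q \<le> q'"
  shows "(\<Sum>i=p..<p'. \<Sum>j=q..<q'. ker i j) = (prim q' p - prim q' p') - (prim q p - prim q p')"
proof -
  have "(\<Sum>j=q..<q'. ker i j) = (prim q' i - prim q' (Suc i)) - (prim q i - prim q (Suc i))" for i
    unfolding ker_def
    using sum_Suc_diff'[OF assms(2), of "\<lambda>j. prim j i - prim j (Suc i)"] by simp
  then have "(\<Sum>i=p..<p'. \<Sum>j=q..<q'. ker i j) =
      (\<Sum>i=p..<p'. (prim q (Suc i) - prim q' (Suc i)) - (prim q i - prim q' i))"
    by (intro sum.cong refl) simp
  also have "\<dots> = (prim q p' - prim q' p') - (prim q p - prim q' p)"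
    using sum_Suc_diff'[OF assms(1), of "\<lambda>i. prim q i - prim q' i"] by simp
  finally show ?thesis by simp
qed

text \<open>Up to a factor, \<open>E p l q' - E p l q\<close> is the pairing under \<^const>\<open>ker\<close> of the interval \<open>[q, q')\<close> with a
  function that is constant on the two halves of \<open>[p, p + 2 l)\<close> and has mean zero with respect to \<open>dz\<close>.\<close>

definition E :: "nat \<Rightarrow> nat \<Rightarrow> nat \<Rightarrow> complex" where
  "E p l e = log_slope (z e - z p) (z e - z (p + l)) - log_slope (z e - z (p + l)) (z e - z (p + 2 * l))"

text \<open>A difference of \<open>prim\<close> is a slope times an increment of z. By the
  cancellation hypothesis the weighted increments over the two halves are opposite, so a common
  factor can be taken out and a difference of slopes remains at each end of [q, q').\<close>

lemma sum_ker_cancel: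
  assumes l: "0 < l" and q: "q \<le> q'"
    and cancel: "\<alpha> * (z (p + l) - z p) + \<beta> * (z (p + 2 * l) - z (p + l)) = 0"
  shows "\<alpha> * (\<Sum>i=p..<p+l. \<Sum>j=q..<q'. ker i j) + \<beta> * (\<Sum>i=p+l..<p+2*l. \<Sum>j=q..<q'. ker i j)
    = \<alpha> * (z (p + l) - z p) * (E p l q' - E p l q)"
proof -
  have s: "prim e x - prim e y = log_slope (z e - z x) (z e - z y) * (z y - z x)"
    if "x \<noteq> y" for e x y
    using z_diff_nz[OF that] by (simp add: log_slope_def prim_def)
  let ?S = "\<lambda>e x y. log_slope (z e - z x) (z e - z y)"
  have 1: "(\<Sum>i=p..<p+l. \<Sum>j=q..<q'. ker i j)
      = (?S q' p (p+l) - ?S q p (p+l)) * (z (p + l) - z p)"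
    using l by (subst sum_ker) (auto simp: s q algebra_simps)
  have 2: "(\<Sum>i=p+l..<p+2*l. \<Sum>j=q..<q'. ker i j)
      = (?S q' (p+l) (p+2*l) - ?S q (p+l) (p+2*l)) * (z (p + 2 * l) - z (p + l))"
    using l by (subst sum_ker) (auto simp: s q algebra_simps)
  have c: "\<beta> * (z (p + 2 * l) - z (p + l)) = - (\<alpha> * (z (p + l) - z p))"
    using cancel by (simp add: add_eq_0_iff)
  have "\<alpha> * (\<Sum>i=p..<p+l. \<Sum>j=q..<q'. ker i j) + \<beta> * (\<Sum>i=p+l..<p+2*l. \<Sum>j=q..<q'. ker i j)
    = (\<alpha> * (z (p + l) - z p)) * (?S q' p (p+l) - ?S q p (p+l))
      + (\<beta> * (z (p + 2 * l) - z (p + l))) * (?S q' (p+l) (p+2*l) - ?S q (p+l) (p+2*l))"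
    unfolding 1 2 by (simp only: mult_ac)
  also have "\<dots> = \<alpha> * (z (p + l) - z p) * (E p l q' - E p l q)"
  proof -
    have "g * (a1 - a2) + - g * (b1 - b2) = g * ((a1 - b1) - (a2 - b2))" for g a1 a2 b1 b2 :: complex
      by (simp add: algebra_simps)
    then show ?thesis unfolding c E_def by blast
  qed
  finally show ?thesis .
qed

text \<open>The admissible e lie outside the open interval or at its midpoint. Endpoints of dyadic
  intervals of length at least l occur nowhere else, since they are multiples of l. The three cases
  are the three positions of the origin relative to the shifted points, left and right being
  exchanged by the oddness of \<open>log_prim\<close>.\<close>

lemma E_near:
  assumes l: "0 < l" and e: "e \<le> p \<or> e = p + l \<or> p + 2 * l \<le> e"
  shows "norm (E p l e) \<le> 10 * L * (real l / (real l + \<bar>real e - real (p + l)\<bar>))"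
  using e
proof (elim disjE)
  assume e: "e = p + l"
  have "norm (E p l e) \<le> 2 * L"
    unfolding E_def using log_slope_diff_mid[of "real l" "z e - z p" "z e - z (p + 2 * l)" L]
      norm_z_diff_le[of e p] norm_z_diff_le[of e "p + 2 * l"] l e by simp
  then show ?thesis using e l L_ge_1 by simp
next
  assume e: "p + 2 * l \<le> e"
  define d where "d = real e - real (p + 2 * l)"
  have d: "0 \<le> d" using e by (simp add: d_def)
  have "norm (E p l e) \<le> 5 * L * (real l / (d + real l))"
    unfolding E_def
    by (rule log_slope_diff_near)
      (use l d L_ge_1 norm_z_diff_le[of "p + l" p] norm_z_diff_le[of "p + 2 * l" "p + l"]
        norm_z_diff_le[of e "p + 2 * l"] in \<open>auto simp: d_def\<close>)
  also have "\<dots> \<le> 5 * L * (2 * (real l / (real l + \<bar>real e - real (p + l)\<bar>)))"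
  proof (rule mult_left_mono)
    have "\<bar>real e - real (p + l)\<bar> = d + real l" using d by (simp add: d_def)
    then show "real l / (d + real l) \<le> 2 * (real l / (real l + \<bar>real e - real (p + l)\<bar>))"
      using d l by (simp add: divide_simps)
  qed (use L_ge_1 in auto)
  finally show ?thesis by simp
next
  assume e: "e \<le> p"
  define d where "d = real p - real e"
  have d: "0 \<le> d" using e by (simp add: d_def)
  have neg: "log_slope (z e - z x) (z e - z y) = log_slope (z y - z e) (z x - z e)" for x y
    using log_slope_uminus[OF z_diff_or[of x e] z_diff_or[of y e]] log_slope_commute by simp
  have E: "E p l e = - (log_slope (z (p + 2 * l) - z e) (z (p + l) - z e)
      - log_slope (z (p + l) - z e) (z p - z e))"
    unfolding E_def neg[of p] neg[of "p + l"] by simp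
  have "norm (E p l e) \<le> 5 * L * (real l / (d + real l))"
    unfolding E norm_minus_cancel
    by (rule log_slope_diff_near)
      (use l d L_ge_1 norm_z_diff_le[of "p + l" p] norm_z_diff_le[of "p + 2 * l" "p + l"]
        norm_z_diff_le[of p e] in \<open>auto simp: d_def\<close>)
  also have "\<dots> \<le> 5 * L * (2 * (real l / (real l + \<bar>real e - real (p + l)\<bar>)))"
  proof (rule mult_left_mono)
    have "\<bar>real e - real (p + l)\<bar> = d + real l" using d by (simp add: d_def)
    then show "real l / (d + real l) \<le> 2 * (real l / (real l + \<bar>real e - real (p + l)\<bar>))"
      using d l by (simp add: divide_simps)
  qed (use L_ge_1 in auto)
  finally show ?thesis by simp
qed

text \<open>The increment of z over [q, q') plays the role of the translation h in
  \<open>log_slope_diff_far\<close>; to the left of the fine interval the oddness of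
  \<open>log_prim\<close> is applied first, so that all real parts are positive.\<close>

lemma E_far:
  assumes l: "0 < l" and d: "0 < d" and q: "q \<le> q'"
    and far: "real (p + 2 * l) + d \<le> real q \<or> real q' + d \<le> real p"
  shows "norm (E p l q' - E p l q) \<le> 2 * L\<^sup>2 * real l / d\<^sup>2 * (real q' - real q)"
proof -
  have main: "norm (E p l q' - E p l q) \<le> 2 * L * real l / d\<^sup>2 * norm (z q' - z q)"
    using far
  proof
    assume f: "real (p + 2 * l) + d \<le> real q"
    have "norm ((log_slope ((z q - z p) + (z q' - z q)) ((z q - z (p + l)) + (z q' - z q))
        - log_slope ((z q - z (p + l)) + (z q' - z q)) ((z q - z (p + 2 * l)) + (z q' - z q)))
      - (log_slope (z q - z p) (z q - z (p + l)) - log_slope (z q - z (p + l)) (z q - z (p + 2 * l))))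
      \<le> 2 * L * real l / d\<^sup>2 * norm (z q' - z q)"
      by (rule log_slope_diff_far)
       (use l d q L_ge_1 f norm_z_diff_le[of "p + l" p] norm_z_diff_le[of "p + 2 * l" "p + l"]
         in \<open>auto simp: z_diff_nz\<close>)
    then show ?thesis by (simp add: E_def)
  next
    assume f: "real q' + d \<le> real p"
    have neg: "log_slope (z e - z x) (z e - z y) = log_slope (z y - z e) (z x - z e)" for e x y
      using log_slope_uminus[OF z_diff_or[of x e] z_diff_or[of y e]] log_slope_commute by simp
    have E: "E p l e = - (log_slope (z (p + 2 * l) - z e) (z (p + l) - z e)
        - log_slope (z (p + l) - z e) (z p - z e))" for e
      unfolding E_def neg[of e p] neg[of e "p + l"] by simp
    have "norm ((log_slope ((z (p + 2 * l) - z q') + (z q' - z q)) ((z (p + l) - z q') + (z q' - z q))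
        - log_slope ((z (p + l) - z q') + (z q' - z q)) ((z p - z q') + (z q' - z q)))
      - (log_slope (z (p + 2 * l) - z q') (z (p + l) - z q') - log_slope (z (p + l) - z q') (z p - z q')))
      \<le> 2 * L * real l / d\<^sup>2 * norm (z q' - z q)"
      by (rule log_slope_diff_far)
       (use l d q L_ge_1 f norm_z_diff_le[of "p + l" p] norm_z_diff_le[of "p + 2 * l" "p + l"]
         in \<open>auto simp: z_diff_nz\<close>)
    then show ?thesis unfolding E by (simp add: algebra_simps)
  qed
  also have "\<dots> \<le> 2 * L * real l / d\<^sup>2 * (L * (real q' - real q))"
    using norm_z_diff_le[of q' q] L_ge_1 q by (intro mult_left_mono) auto
  finally show ?thesis by (simp add: power2_eq_square algebra_simps)
qed

text \<open>Here u is the signed distance, in units of l, from the left end of the coarse interval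
  to the midpoint of the fine one, and u - R that from the right end. For |u| \<le> 3 R the two
  values of E are estimated separately by \<open>E_near\<close>. Beyond that, the difference is
  small because E varies slowly away from the fine interval, and the gap between the intervals is
  comparable to |u| l.\<close>

lemma E_diff_decay:
  fixes s t l R :: nat
  assumes l: "0 < l" and R: "0 < R"
  defines "u \<equiv> 2 * int s + 1 - int t * int R"
  shows "norm (E (2 * s * l) l (Suc t * R * l) - E (2 * s * l) l (t * R * l))
    \<le> 32 * L\<^sup>2 * real R powr (1/4) * (decay u + decay (u - int R))"
proof -
  let ?p = "2 * s * l"
  have L1: "L \<le> L\<^sup>2" using L_ge_1 by (simp add: power2_eq_square)
  have near: "norm (E ?p l (k * l)) \<le> 10 * L * (1 / (1 + real_of_int \<bar>2 * int s + 1 - int k\<bar>))" for k :: nat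
  proof -
    have "k \<le> 2 * s \<or> k = 2 * s + 1 \<or> 2 * s + 2 \<le> k" by linarith
    then have "k * l \<le> ?p \<or> k * l = ?p + l \<or> ?p + 2 * l \<le> k * l"
    proof (elim disjE)
      assume "2 * s + 2 \<le> k"
      then have "(2 * s + 2) * l \<le> k * l" by (rule mult_le_mono1)
      then show ?thesis by (simp add: algebra_simps)
    qed (auto simp: algebra_simps)
    then have "norm (E ?p l (k * l)) \<le> 10 * L * (real l / (real l + \<bar>real (k * l) - real (?p + l)\<bar>))"
      by (rule E_near[OF l])
    also have "\<bar>real (k * l) - real (?p + l)\<bar> = real l * real_of_int \<bar>2 * int s + 1 - int k\<bar>"
    proof -
      have "real (k * l) - real (?p + l) = real l * (real k - (2 * real s + 1))"
        by (simp add: algebra_simps)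
      then have "\<bar>real (k * l) - real (?p + l)\<bar> = real l * \<bar>real k - (2 * real s + 1)\<bar>"
        by (simp only: abs_mult abs_of_nat)
      then show ?thesis by (simp add: abs_minus_commute)
    qed
    also have "real l / (real l + real l * real_of_int \<bar>2 * int s + 1 - int k\<bar>)
       = 1 / (1 + real_of_int \<bar>2 * int s + 1 - int k\<bar>)"
    proof -
      have "real l + real l * x = real l * (1 + x)" for x by (simp add: algebra_simps)
      then show ?thesis using l by simp
    qed
    finally show ?thesis .
  qed
  have R1: "real R \<ge> 1" using R by simp
  show ?thesis
  proof (cases "\<bar>u\<bar> \<le> 3 * int R")
    case True
    have "1 + real_of_int \<bar>u\<bar> \<le> 16 * real R" "1 + real_of_int \<bar>u - int R\<bar> \<le> 16 * real R"
      using True R by linarith+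
    then have d: "1 / (1 + real_of_int \<bar>u\<bar>) \<le> 2 * real R powr (1/4) * decay u"
      "1 / (1 + real_of_int \<bar>u - int R\<bar>) \<le> 2 * real R powr (1/4) * decay (u - int R)"
      using inverse_le_decay[of u "real R"] inverse_le_decay[of "u - int R" "real R"] R1 by blast+
    have "norm (E ?p l (Suc t * R * l)) \<le> 10 * L * (1 / (1 + real_of_int \<bar>u - int R\<bar>))"
      using near[of "Suc t * R"] by (simp add: u_def algebra_simps)
    also have "\<dots> \<le> 10 * L * (2 * real R powr (1/4) * decay (u - int R))"
      using d L_ge_1 by (intro mult_left_mono) auto
    finally have n1: "norm (E ?p l (Suc t * R * l)) \<le> 20 * L * real R powr (1/4) * decay (u - int R)"
      by simp
    have "norm (E ?p l (t * R * l)) \<le> 10 * L * (1 / (1 + real_of_int \<bar>u\<bar>))"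
      using near[of "t * R"] by (simp add: u_def algebra_simps)
    also have "\<dots> \<le> 10 * L * (2 * real R powr (1/4) * decay u)"
      using d L_ge_1 by (intro mult_left_mono) auto
    finally have n2: "norm (E ?p l (t * R * l)) \<le> 20 * L * real R powr (1/4) * decay u"
      by simp
    have "norm (E ?p l (Suc t * R * l) - E ?p l (t * R * l))
      \<le> 20 * L * real R powr (1/4) * decay (u - int R) + 20 * L * real R powr (1/4) * decay u"
      by (intro order_trans[OF norm_triangle_ineq4] add_mono n1 n2)
    also have "\<dots> = (20 * L) * (real R powr (1/4) * (decay u + decay (u - int R)))"
      by (simp add: algebra_simps)
    also have "\<dots> \<le> (32 * L\<^sup>2) * (real R powr (1/4) * (decay u + decay (u - int R)))"
      using L1 L_ge_1 by (intro mult_right_mono) (auto simp: decay_nonneg)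
    finally show ?thesis by (simp add: mult.assoc)
  next
    case False
    \<comment> \<open>A quarter of the distance is a safe lower bound for the gap once |u| > 3 R.
      Squaring the 4 turns the constant 2 of \<open>E_far\<close> into 32.\<close>
    define d where "d = real l * (1 + real_of_int \<bar>u\<bar>) / 4"
    have d: "0 < d" using l by (simp add: d_def)
    have "real (?p + 2 * l) + d \<le> real (t * R * l) \<or> real (Suc t * R * l) + d \<le> real ?p"
    proof (cases "u > 0")
      case True
      then have "3 * int R + 1 \<le> u" using False by simp
      then have "real_of_int (3 * int R + 1) \<le> real_of_int u" by (simp only: of_int_le_iff)
      then have u3: "3 * real R + 1 \<le> real_of_int u" by simp
      have "(1 + real_of_int \<bar>u\<bar>) / 4 \<le> real_of_int u - 1 - real R"
        using u3 True R1 by simp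
      then have "real l * ((1 + real_of_int \<bar>u\<bar>) / 4) \<le> real l * (real_of_int u - 1 - real R)"
        by (intro mult_left_mono) auto
      also have "real l * (real_of_int u - 1 - real R) = real ?p - real (Suc t * R * l)"
        by (simp add: u_def algebra_simps)
      finally show ?thesis by (simp add: d_def)
    next
      case F: False
      then have "u \<le> - (3 * int R + 1)" using False by simp
      then have "real_of_int u \<le> real_of_int (- (3 * int R + 1))" by (simp only: of_int_le_iff)
      then have u3: "3 * real R + 1 \<le> - real_of_int u" by simp
      have "(1 + real_of_int \<bar>u\<bar>) / 4 \<le> - real_of_int u - 1"
        using u3 F R1 by simp
      then have "real l * ((1 + real_of_int \<bar>u\<bar>) / 4) \<le> real l * (- real_of_int u - 1)"
        by (intro mult_left_mono) auto
      also have "real l * (- real_of_int u - 1) = real (t * R * l) - real (?p + 2 * l)"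
        by (simp add: u_def algebra_simps)
      finally show ?thesis by (simp add: d_def)
    qed
    then have "norm (E ?p l (Suc t * R * l) - E ?p l (t * R * l))
        \<le> 2 * L\<^sup>2 * real l / d\<^sup>2 * (real (Suc t * R * l) - real (t * R * l))"
      by (intro E_far[OF l d]) auto
    also have "real (Suc t * R * l) - real (t * R * l) = real R * real l"
      by (simp add: algebra_simps)
    also have "2 * L\<^sup>2 * real l / d\<^sup>2 * (real R * real l) = 32 * L\<^sup>2 * (real R / (1 + real_of_int \<bar>u\<bar>)\<^sup>2)"
      using l by (simp add: d_def power2_eq_square)
    also have "\<dots> \<le> 32 * L\<^sup>2 * (real R powr (1/4) * decay u)"
      using False R1 by (intro mult_left_mono inverse_square_le_decay) auto
    also have "\<dots> \<le> 32 * L\<^sup>2 * (real R powr (1/4) * (decay u + decay (u - int R)))"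
      by (intro mult_left_mono) (auto simp: decay_nonneg)
    finally show ?thesis by simp
  qed
qed

end

section \<open>Sums over dyadic scales and the Bellman function\<close>

lemma sum_pairs:
  fixes h :: "nat \<Rightarrow> 'a::comm_monoid_add"
  shows "(\<Sum>t<2 * k. h t) = (\<Sum>s<k. h (2 * s) + h (2 * s + 1))"
  by (induction k) (auto simp: algebra_simps)

lemma geometric_row:
  fixes q :: real
  assumes q: "0 < q" "q < 1"
  shows "(\<Sum>m'\<le>n. q ^ (max m m' - min m m')) \<le> 2 / (1 - q)"
proof -
  let ?P = "{m'\<in>{..n}. m' \<le> m}" and ?N = "{m'\<in>{..n}. m < m'}"
  have sm: "summable (\<lambda>k. q ^ k)" "(\<Sum>k. q ^ k) = 1 / (1 - q)"
    using q by (auto intro!: summable_geometric suminf_geometric)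
  have "(\<Sum>m'\<le>n. q ^ (max m m' - min m m')) = (\<Sum>m'\<in>?P. q ^ (m - m')) + (\<Sum>m'\<in>?N. q ^ (m' - m))"
  proof -
    have "(\<Sum>m'\<le>n. q ^ (max m m' - min m m')) = (\<Sum>m'\<in>?P\<union>?N. q ^ (max m m' - min m m'))"
      by (intro sum.cong) auto
    also have "\<dots> = (\<Sum>m'\<in>?P. q ^ (max m m' - min m m')) + (\<Sum>m'\<in>?N. q ^ (max m m' - min m m'))"
      by (rule sum.union_disjoint) auto
    also have "\<dots> = (\<Sum>m'\<in>?P. q ^ (m - m')) + (\<Sum>m'\<in>?N. q ^ (m' - m))"
      by (intro arg_cong2[where f = "(+)"] sum.cong) (auto simp: max_def min_def)
    finally show ?thesis .
  qed
  also have "(\<Sum>m'\<in>?P. q ^ (m - m')) = (\<Sum>k\<in>(\<lambda>m'. m - m') ` ?P. q ^ k)"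
    by (subst sum.reindex) (auto simp: inj_on_def)
  also have "\<dots> \<le> (\<Sum>k. q ^ k)"
    by (rule sum_le_suminf[OF sm(1)]) (use q in auto)
  also have "(\<Sum>m'\<in>?N. q ^ (m' - m)) = (\<Sum>k\<in>(\<lambda>m'. m' - m) ` ?N. q ^ k)"
    by (subst sum.reindex) (auto simp: inj_on_def)
  also have "\<dots> \<le> (\<Sum>k. q ^ k)"
    by (rule sum_le_suminf[OF sm(1)]) (use q in auto)
  finally show ?thesis using sm by simp
qed

text \<open>The Bellman function \<open>\<bar>F\<bar>\<^sup>2 (K + \<beta>\<^sup>2)\<close> of the mean of a function and the mean slope: its second
  difference controls the jump of the quotient of the two means with respect to \<open>dx\<close> and \<open>dz\<close>.\<close>

lemma bellman_step:
  fixes F1 F2 :: complex and b1 b2 M :: real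
  assumes b: "\<bar>b1\<bar> \<le> M" "\<bar>b2\<bar> \<le> M"
  defines "F \<equiv> (F1 + F2) / 2" and "\<beta> \<equiv> (b1 + b2) / 2" and "K \<equiv> 8 * M\<^sup>2 + 1" and "L \<equiv> 1 + M"
  shows "(cmod (F1 / Complex 1 b1 - F / Complex 1 \<beta>))\<^sup>2 + (cmod (F2 / Complex 1 b2 - F / Complex 1 \<beta>))\<^sup>2
    \<le> 4 * L\<^sup>2 * ((cmod F1)\<^sup>2 * (K + b1\<^sup>2) + (cmod F2)\<^sup>2 * (K + b2\<^sup>2) - 2 * ((cmod F)\<^sup>2 * (K + \<beta>\<^sup>2)))"
proof -
  define a where "a = (F1 - F2) / 2"
  define c where "c = (b1 - b2) / 2"
  define X where "X = (cmod a)\<^sup>2 + (cmod F)\<^sup>2 * c\<^sup>2 / 2"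
  have M: "0 \<le> M" using b by linarith
  have F12: "F1 = F + a" "F2 = F - a" "b1 = \<beta> + c" "b2 = \<beta> - c"
    by (auto simp: F_def a_def \<beta>_def c_def field_simps)
  have \<beta>: "\<bar>\<beta>\<bar> \<le> M" using b by (simp add: \<beta>_def)
  have n1: "1 \<le> cmod (Complex 1 x)" for x
    using complex_Re_le_cmod[of "Complex 1 x"] by simp
  have nL: "cmod (Complex 1 \<beta>) \<le> L"
    using cmod_le[of "Complex 1 \<beta>"] \<beta> by (simp add: L_def)
  \<comment> \<open>Both denominators have modulus at least 1, so only the numerator matters, and it
    is linear in the jump a' of the mean and the jump c' of the slope. The two halves are the
    choices (a, c) and (-a, -c).\<close>
  have one: "(cmod ((F + a') / Complex 1 (\<beta> + c') - F / Complex 1 \<beta>))\<^sup>2 \<le> 4 * L\<^sup>2 * X"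
    if "(cmod a')\<^sup>2 = (cmod a)\<^sup>2" "c'\<^sup>2 = c\<^sup>2" for a' c'
  proof -
    have nz: "Complex 1 (\<beta> + c') \<noteq> 0" "Complex 1 \<beta> \<noteq> 0" by (auto simp: complex_eq_iff)
    have "(F + a') / Complex 1 (\<beta> + c') - F / Complex 1 \<beta>
       = ((F + a') * Complex 1 \<beta> - F * Complex 1 (\<beta> + c')) / (Complex 1 (\<beta> + c') * Complex 1 \<beta>)"
      using nz by (simp add: diff_frac_eq)
    also have "(F + a') * Complex 1 \<beta> - F * Complex 1 (\<beta> + c') = a' * Complex 1 \<beta> - F * (\<i> * of_real c')"
      by (auto simp: complex_eq_iff algebra_simps)
    finally have e: "(F + a') / Complex 1 (\<beta> + c') - F / Complex 1 \<beta>
       = (a' * Complex 1 \<beta> - F * (\<i> * of_real c')) / (Complex 1 (\<beta> + c') * Complex 1 \<beta>)" .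
    have "cmod ((F + a') / Complex 1 (\<beta> + c') - F / Complex 1 \<beta>)
       \<le> cmod (a' * Complex 1 \<beta> - F * (\<i> * of_real c')) / 1"
      unfolding e norm_divide norm_mult[of "Complex 1 (\<beta> + c')"]
    proof (rule divide_left_mono)
      show "1 \<le> cmod (Complex 1 (\<beta> + c')) * cmod (Complex 1 \<beta>)"
        using mult_mono[OF n1[of "\<beta> + c'"] n1[of \<beta>]] by simp
      then show "0 < (cmod (Complex 1 (\<beta> + c')) * cmod (Complex 1 \<beta>)) * 1" by simp
    qed simp
    also have "\<dots> \<le> cmod (a' * Complex 1 \<beta>) + cmod (F * (\<i> * of_real c'))"
      using norm_triangle_ineq4 by auto
    also have "\<dots> \<le> cmod a' * L + cmod F * \<bar>c'\<bar>"
      using nL by (auto simp: norm_mult intro: mult_left_mono)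
    finally have "(cmod ((F + a') / Complex 1 (\<beta> + c') - F / Complex 1 \<beta>))\<^sup>2 \<le> (cmod a' * L + cmod F * \<bar>c'\<bar>)\<^sup>2"
      by (rule power_mono) simp
    also have "\<dots> \<le> 2 * ((cmod a' * L)\<^sup>2 + (cmod F * \<bar>c'\<bar>)\<^sup>2)"
      using sum_squares_bound[of "cmod a' * L" "cmod F * \<bar>c'\<bar>"] by (simp add: power2_sum)
    also have "\<dots> = 2 * ((cmod a)\<^sup>2 * L\<^sup>2 + (cmod F)\<^sup>2 * c\<^sup>2)"
      using that by (simp add: power_mult_distrib)
    also have "\<dots> \<le> 4 * L\<^sup>2 * X"
    proof -
      have "1 \<le> L\<^sup>2" using M by (simp add: L_def power2_eq_square algebra_simps)
      then have "1 * ((cmod F)\<^sup>2 * c\<^sup>2) \<le> L\<^sup>2 * ((cmod F)\<^sup>2 * c\<^sup>2)"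
        by (intro mult_right_mono) auto
      moreover have "0 \<le> L\<^sup>2 * (cmod a)\<^sup>2" by simp
      moreover have "4 * L\<^sup>2 * X = 4 * (L\<^sup>2 * (cmod a)\<^sup>2) + 2 * (L\<^sup>2 * ((cmod F)\<^sup>2 * c\<^sup>2))"
        unfolding X_def by (simp add: algebra_simps)
      moreover have "2 * ((cmod a)\<^sup>2 * L\<^sup>2 + (cmod F)\<^sup>2 * c\<^sup>2) = 2 * (L\<^sup>2 * (cmod a)\<^sup>2) + 2 * ((cmod F)\<^sup>2 * c\<^sup>2)"
        by (simp add: algebra_simps)
      ultimately show ?thesis by linarith
    qed
    finally show ?thesis .
  qed
  have i1: "(cmod (F1 / Complex 1 b1 - F / Complex 1 \<beta>))\<^sup>2 \<le> 4 * L\<^sup>2 * X"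
    using one[of a c] by (simp add: F12)
  have i2: "(cmod (F2 / Complex 1 b2 - F / Complex 1 \<beta>))\<^sup>2 \<le> 4 * L\<^sup>2 * X"
    using one[of "-a" "-c"] by (simp add: F12)
  define f1 where "f1 = Re F" define f2 where "f2 = Im F"
  define a1 where "a1 = Re a" define a2 where "a2 = Im a"
  have cs: "(f1 * a1 + f2 * a2)\<^sup>2 \<le> (f1\<^sup>2 + f2\<^sup>2) * (a1\<^sup>2 + a2\<^sup>2)"
  proof -
    have "0 \<le> (f1 * a2 - f2 * a1)\<^sup>2" by simp
    then show ?thesis by (simp add: power2_eq_square algebra_simps)
  qed
  have dotle: "\<bar>f1 * a1 + f2 * a2\<bar> \<le> cmod F * cmod a"
  proof -
    have "sqrt ((f1 * a1 + f2 * a2)\<^sup>2) \<le> sqrt ((f1\<^sup>2 + f2\<^sup>2) * (a1\<^sup>2 + a2\<^sup>2))"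
      using cs by (rule real_sqrt_le_mono)
    then show ?thesis by (simp add: real_sqrt_mult cmod_def f1_def f2_def a1_def a2_def)
  qed
  have "\<bar>(f1 * a1 + f2 * a2) * \<beta> * c\<bar> \<le> (cmod F * cmod a) * M * \<bar>c\<bar>"
    unfolding abs_mult using dotle \<beta> M by (intro mult_mono) auto
  then have cross: "- ((cmod F * cmod a) * M * \<bar>c\<bar>) \<le> (f1 * a1 + f2 * a2) * \<beta> * c" by linarith
  have sq: "0 \<le> (cmod F * \<bar>c\<bar> - 4 * M * cmod a)\<^sup>2" by simp
  have sqF: "(cmod F)\<^sup>2 = f1\<^sup>2 + f2\<^sup>2" "(cmod a)\<^sup>2 = a1\<^sup>2 + a2\<^sup>2"
    by (auto simp: cmod_power2 f1_def f2_def a1_def a2_def)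
  have sq1: "(cmod F1)\<^sup>2 = (cmod F)\<^sup>2 + (cmod a)\<^sup>2 + 2 * (f1 * a1 + f2 * a2)"
    "(cmod F2)\<^sup>2 = (cmod F)\<^sup>2 + (cmod a)\<^sup>2 - 2 * (f1 * a1 + f2 * a2)"
    unfolding F12 cmod_power2 by (auto simp: f1_def f2_def a1_def a2_def power2_eq_square algebra_simps)
  \<comment> \<open>The number 8 in K is chosen for this identity: 2 K |a|^2 contributes 16 M^2
    |a|^2, which together with |F|^2 c^2 and the lower bound for the cross term completes the square
    of |F| |c| - 4 M |a|.\<close>
  have "(cmod F1)\<^sup>2 * (K + b1\<^sup>2) + (cmod F2)\<^sup>2 * (K + b2\<^sup>2) - 2 * ((cmod F)\<^sup>2 * (K + \<beta>\<^sup>2)) - 2 * X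
     = (cmod F)\<^sup>2 * c\<^sup>2 + 16 * M\<^sup>2 * (cmod a)\<^sup>2 + 2 * (cmod a)\<^sup>2 * (\<beta>\<^sup>2 + c\<^sup>2) + 8 * ((f1 * a1 + f2 * a2) * \<beta> * c)"
    unfolding sq1 X_def K_def F12(3,4) by (simp add: power2_eq_square algebra_simps)
  also have "\<dots> \<ge> (cmod F)\<^sup>2 * c\<^sup>2 + 16 * M\<^sup>2 * (cmod a)\<^sup>2 + 0 + 8 * (- ((cmod F * cmod a) * M * \<bar>c\<bar>))"
    using cross by (intro add_mono mult_left_mono order_refl) auto
  also have "(cmod F)\<^sup>2 * c\<^sup>2 + 16 * M\<^sup>2 * (cmod a)\<^sup>2 + 0 + 8 * (- ((cmod F * cmod a) * M * \<bar>c\<bar>))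
     = (cmod F * \<bar>c\<bar> - 4 * M * cmod a)\<^sup>2"
    by (simp add: power2_diff power_mult_distrib algebra_simps)
  finally have "2 * X \<le> (cmod F1)\<^sup>2 * (K + b1\<^sup>2) + (cmod F2)\<^sup>2 * (K + b2\<^sup>2) - 2 * ((cmod F)\<^sup>2 * (K + \<beta>\<^sup>2))"
    using sq by linarith
  then have "4 * L\<^sup>2 * (2 * X) \<le> 4 * L\<^sup>2 * ((cmod F1)\<^sup>2 * (K + b1\<^sup>2) + (cmod F2)\<^sup>2 * (K + b2\<^sup>2) - 2 * ((cmod F)\<^sup>2 * (K + \<beta>\<^sup>2)))"
    by (intro mult_left_mono) auto
  then show ?thesis using i1 i2 by linarith
qed

section \<open>The Haar expansion adapted to dz\<close>

context lipschitz_lattice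
begin

lemma norm_b_le: "norm (b j) \<le> L"
  using norm_z_diff_le[of "Suc j" j] by (simp add: b_def)

lemma norm_b_ge: "1 \<le> norm (b j)"
  using norm_z_diff_ge[of "Suc j" j] by (simp add: b_def)

lemma b_nz: "b j \<noteq> 0"
  using norm_b_ge[of j] by auto

definition blk :: "nat \<Rightarrow> nat \<Rightarrow> nat set" where
  "blk m t = {t * 2 ^ m ..< t * 2 ^ m + 2 ^ m}"

definition F :: "(nat \<Rightarrow> complex) \<Rightarrow> nat \<Rightarrow> nat \<Rightarrow> complex" where
  "F f m t = (\<Sum>i\<in>blk m t. f i * b i) / 2 ^ m"

definition slope :: "nat \<Rightarrow> nat \<Rightarrow> real" where
  "slope m t = (A (t * 2 ^ m + 2 ^ m) - A (t * 2 ^ m)) / 2 ^ m"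

text \<open>The mean of f over the block with respect to the complex measure dz: the integral
  against dz and the increment of z are both divided by the length of the block, the latter becoming
  \<open>Complex 1 (slope m t)\<close>.\<close>

definition bavg :: "(nat \<Rightarrow> complex) \<Rightarrow> nat \<Rightarrow> nat \<Rightarrow> complex" where
  "bavg f m t = F f m t / Complex 1 (slope m t)"

text \<open>Martingale differences of the dz-means, constant on blocks of level m. At the top level
  nothing coarser is subtracted, so that the levels 0 to n add up to f.\<close>

definition dcoef :: "nat \<Rightarrow> (nat \<Rightarrow> complex) \<Rightarrow> nat \<Rightarrow> nat \<Rightarrow> complex" where
  "dcoef n f m t = (if m < n then bavg f m t - bavg f (Suc m) (t div 2) else bavg f m t)"

definition gnorm :: "nat \<Rightarrow> (nat \<Rightarrow> complex) \<Rightarrow> nat \<Rightarrow> real" where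
  "gnorm n f m = (\<Sum>t<2 ^ (n - m). 2 ^ m * (cmod (dcoef n f m t))\<^sup>2)"

definition bform :: "nat \<Rightarrow> (nat \<Rightarrow> complex) \<Rightarrow> (nat \<Rightarrow> complex) \<Rightarrow> complex" where
  "bform N f g = (\<Sum>i<N. \<Sum>j<N. f i * g j * ker i j)"

lemma slope_le: "\<bar>slope m t\<bar> \<le> M"
  using A_lip[of "t * 2 ^ m + 2 ^ m" "t * 2 ^ m"] by (simp add: slope_def field_simps)

lemma z_block_diff: "z (t * 2 ^ m + 2 ^ m) - z (t * 2 ^ m) = 2 ^ m * Complex 1 (slope m t)"
  by (simp add: complex_eq_iff slope_def Re_power_real Im_power_real)

lemma blk_Suc: "blk (Suc m) s = blk m (2 * s) \<union> blk m (2 * s + 1)" "blk m (2 * s) \<inter> blk m (2 * s + 1) = {}"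
  by (auto simp: blk_def algebra_simps)

lemma finite_blk [simp]: "finite (blk m t)" by (simp add: blk_def)

lemma F_Suc: "F f (Suc m) s = (F f m (2 * s) + F f m (2 * s + 1)) / 2"
  unfolding F_def blk_Suc(1)
  by (subst sum.union_disjoint) (use blk_Suc(2) in \<open>auto simp: field_simps\<close>)

lemma slope_Suc: "slope (Suc m) s = (slope m (2 * s) + slope m (2 * s + 1)) / 2"
  by (simp add: slope_def field_simps)

lemma bavg_0: "bavg f 0 j = f j"
proof -
  have "Complex 1 (slope 0 j) = b j" using z_block_diff[of j 0] by (simp add: b_def)
  then show ?thesis using b_nz[of j] by (simp add: bavg_def F_def blk_def)
qed

lemma martingale_expansion:
  "f j = (\<Sum>m\<le>n. dcoef n f m (j div 2 ^ m))"
proof -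
  let ?a = "\<lambda>m. bavg f m (j div 2 ^ m)"
  have "(\<Sum>m\<le>n. dcoef n f m (j div 2 ^ m)) = (\<Sum>m<n. dcoef n f m (j div 2 ^ m)) + dcoef n f n (j div 2 ^ n)"
    by (simp only: lessThan_Suc_atMost[symmetric] sum.lessThan_Suc)
  also have "(\<Sum>m<n. dcoef n f m (j div 2 ^ m)) = (\<Sum>m<n. ?a m - ?a (Suc m))"
  proof (intro sum.cong refl)
    fix m assume "m \<in> {..<n}"
    moreover have "j div 2 ^ m div 2 = j div 2 ^ Suc m"
      by (simp only: div_mult2_eq[symmetric] power_Suc2)
    ultimately show "dcoef n f m (j div 2 ^ m) = ?a m - ?a (Suc m)"
      by (simp add: dcoef_def)
  qed
  also have "\<dots> = ?a 0 - ?a n" by (rule sum_lessThan_telescope')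
  finally show ?thesis by (simp add: dcoef_def bavg_0)
qed

text \<open>Up to the factor 2^m this is the cancellation that \<open>sum_ker_cancel\<close> asks
  for. It holds because the dz-mean of a block is the mean of the dz-means of its halves weighted by
  their increments of z.\<close>

lemma dcoef_cancel:
  assumes "m < n"
  shows "dcoef n f m (2 * s) * Complex 1 (slope m (2 * s))
    + dcoef n f m (2 * s + 1) * Complex 1 (slope m (2 * s + 1)) = 0"
proof -
  have nz: "Complex 1 x \<noteq> 0" for x by (auto simp: complex_eq_iff)
  let ?u = "bavg f (Suc m) s"
  have "Complex 1 (slope m (2 * s)) + Complex 1 (slope m (2 * s + 1)) = 2 * Complex 1 (slope (Suc m) s)"
    by (simp add: slope_Suc complex_eq_iff)
  then have "?u * (Complex 1 (slope m (2 * s)) + Complex 1 (slope m (2 * s + 1))) = 2 * F f (Suc m) s"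
    using nz by (simp add: bavg_def)
  also have "\<dots> = F f m (2 * s) + F f m (2 * s + 1)" by (simp add: F_Suc)
  also have "\<dots> = bavg f m (2 * s) * Complex 1 (slope m (2 * s)) + bavg f m (2 * s + 1) * Complex 1 (slope m (2 * s + 1))"
    using nz by (simp add: bavg_def)
  finally show ?thesis using assms by (simp add: dcoef_def algebra_simps)
qed

text \<open>From one scale to the next the Bellman sum S drops by at least gnorm / (4 L^2), so the
  sum over the scales telescopes to S 0, and the top level is bounded by S n directly. At level 0
  one has K + slope^2 \<le> 9 L^2 and |b|^2 \<le> L^2, which explains 36 = 4 * 9 and the sixth
  power.\<close>

lemma square_function_bound:
  "(\<Sum>m\<le>n. gnorm n f m) \<le> 36 * L ^ 6 * (\<Sum>j<2 ^ n. (cmod (f j))\<^sup>2)"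
proof -
  define K where "K = 8 * M\<^sup>2 + 1"
  define S where "S m = (\<Sum>t<2 ^ (n - m). 2 ^ m * ((cmod (F f m t))\<^sup>2 * (K + (slope m t)\<^sup>2)))" for m
  have step: "gnorm n f m \<le> 4 * L\<^sup>2 * (S m - S (Suc m))" if m: "m < n" for m
  proof -
    have e: "(2::nat) ^ (n - m) = 2 * 2 ^ (n - Suc m)"
      using m by (metis Suc_diff_Suc power_Suc)
    let ?G = "\<lambda>m t. (cmod (F f m t))\<^sup>2 * (K + (slope m t)\<^sup>2)"
    have "gnorm n f m = (\<Sum>s<2 ^ (n - Suc m). 2 ^ m * ((cmod (dcoef n f m (2 * s)))\<^sup>2 + (cmod (dcoef n f m (2 * s + 1)))\<^sup>2))"
      unfolding gnorm_def e sum_pairs by (simp add: algebra_simps)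
    also have "\<dots> \<le> (\<Sum>s<2 ^ (n - Suc m). 2 ^ m * (4 * L\<^sup>2 * (?G m (2 * s) + ?G m (2 * s + 1) - 2 * ?G (Suc m) s)))"
    proof (intro sum_mono mult_left_mono)
      fix s
      show "(cmod (dcoef n f m (2 * s)))\<^sup>2 + (cmod (dcoef n f m (2 * s + 1)))\<^sup>2
        \<le> 4 * L\<^sup>2 * (?G m (2 * s) + ?G m (2 * s + 1) - 2 * ?G (Suc m) s)"
        using bellman_step[OF slope_le[of m "2 * s"] slope_le[of m "2 * s + 1"], of "F f m (2 * s)" "F f m (2 * s + 1)"] m
        by (simp add: dcoef_def bavg_def F_Suc slope_Suc K_def L_def)
    qed simp
    also have "\<dots> = 4 * L\<^sup>2 * ((\<Sum>s<2 ^ (n - Suc m). 2 ^ m * (?G m (2 * s) + ?G m (2 * s + 1))) - (\<Sum>s<2 ^ (n - Suc m). 2 ^ Suc m * ?G (Suc m) s))"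
      unfolding sum_subtractf[symmetric] sum_distrib_left
      by (intro sum.cong refl) (simp add: algebra_simps)
    also have "(\<Sum>s<2 ^ (n - Suc m). 2 ^ m * (?G m (2 * s) + ?G m (2 * s + 1))) = S m"
      unfolding S_def e sum_pairs by (simp add: algebra_simps)
    finally show ?thesis by (simp add: S_def)
  qed
  have nz: "1 \<le> cmod (Complex 1 x)" for x
    using complex_Re_le_cmod[of "Complex 1 x"] by simp
  have top: "gnorm n f n \<le> S n"
  proof -
    have "(cmod (bavg f n t))\<^sup>2 \<le> (cmod (F f n t))\<^sup>2 * (K + (slope n t)\<^sup>2)" for t
    proof -
      have "cmod (bavg f n t) \<le> cmod (F f n t) / 1"
        unfolding bavg_def norm_divide using nz[of "slope n t"] by (intro divide_left_mono) (auto dest: less_le_trans[OF zero_less_one])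
      then have "(cmod (bavg f n t))\<^sup>2 \<le> (cmod (F f n t))\<^sup>2" by (intro power_mono) auto
      also have "\<dots> \<le> (cmod (F f n t))\<^sup>2 * (K + (slope n t)\<^sup>2)"
        using mult_left_mono[of 1 "K + (slope n t)\<^sup>2" "(cmod (F f n t))\<^sup>2"] by (simp add: K_def)
      finally show ?thesis .
    qed
    then show ?thesis unfolding gnorm_def S_def dcoef_def by (auto intro!: sum_mono)
  qed
  have Snn: "0 \<le> S m" for m unfolding S_def K_def by (intro sum_nonneg mult_nonneg_nonneg) auto
  have "(\<Sum>m\<le>n. gnorm n f m) = (\<Sum>m<n. gnorm n f m) + gnorm n f n"
    by (simp only: lessThan_Suc_atMost[symmetric] sum.lessThan_Suc)
  also have "\<dots> \<le> (\<Sum>m<n. 4 * L\<^sup>2 * (S m - S (Suc m))) + S n"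
    by (intro add_mono sum_mono step top) auto
  also have "(\<Sum>m<n. 4 * L\<^sup>2 * (S m - S (Suc m))) = 4 * L\<^sup>2 * (S 0 - S n)"
    unfolding sum_distrib_left[symmetric] by (subst sum_lessThan_telescope') simp
  also have "4 * L\<^sup>2 * (S 0 - S n) + S n \<le> 4 * L\<^sup>2 * S 0"
  proof -
    have "1 \<le> L\<^sup>2" using L_ge_1 by simp
    then have "1 * S n \<le> (4 * L\<^sup>2) * S n" using Snn by (intro mult_right_mono) auto
    then show ?thesis by (simp add: algebra_simps)
  qed
  also have "S 0 \<le> (\<Sum>j<2 ^ n. 9 * L ^ 4 * (cmod (f j))\<^sup>2)"
  proof -
    have "(cmod (F f 0 j))\<^sup>2 * (K + (slope 0 j)\<^sup>2) \<le> 9 * L ^ 4 * (cmod (f j))\<^sup>2" for j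
    proof -
    have "(cmod (F f 0 j))\<^sup>2 = (cmod (f j))\<^sup>2 * (cmod (b j))\<^sup>2"
      by (simp add: F_def blk_def norm_mult power_mult_distrib)
    also have "\<dots> \<le> (cmod (f j))\<^sup>2 * L\<^sup>2"
      using norm_b_le[of j] by (intro mult_left_mono power_mono) auto
    finally have 1: "(cmod (F f 0 j))\<^sup>2 \<le> (cmod (f j))\<^sup>2 * L\<^sup>2" .
    have "(slope 0 j)\<^sup>2 \<le> M\<^sup>2" using slope_le[of 0 j] by (metis abs_le_square_iff abs_of_nonneg M_nonneg)
    then have 2: "K + (slope 0 j)\<^sup>2 \<le> 9 * L\<^sup>2"
      using M_nonneg by (simp add: K_def L_def power2_eq_square algebra_simps)
    have "(cmod (F f 0 j))\<^sup>2 * (K + (slope 0 j)\<^sup>2) \<le> ((cmod (f j))\<^sup>2 * L\<^sup>2) * (9 * L\<^sup>2)"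
      by (intro mult_mono 1 2) (auto simp: K_def)
    also have "((cmod (f j))\<^sup>2 * L\<^sup>2) * (9 * L\<^sup>2) = 9 * L ^ 4 * (cmod (f j))\<^sup>2"
      by (simp add: power4_eq_xxxx power2_eq_square mult_ac)
    finally show ?thesis .
    qed
    then show ?thesis unfolding S_def by (auto intro!: sum_mono)
  qed
  then have "4 * L\<^sup>2 * S 0 \<le> 4 * L\<^sup>2 * (\<Sum>j<2 ^ n. 9 * L ^ 4 * (cmod (f j))\<^sup>2)"
    by (intro mult_left_mono) auto
  also have "\<dots> = 36 * L ^ 6 * (\<Sum>j<2 ^ n. (cmod (f j))\<^sup>2)"
    unfolding sum_distrib_left[symmetric] by (simp add: power_numeral_reduce)
  finally show ?thesis .
qed

section \<open>Interaction of two scales\<close>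

lemma scale_bound:
  fixes \<alpha> \<beta> :: "nat \<Rightarrow> complex" and l R S T :: nat
  assumes l: "0 < l" and R: "0 < R"
    and cancel: "\<And>s. s < S \<Longrightarrow> \<alpha> (2 * s) * (z (2 * s * l + l) - z (2 * s * l))
       + \<alpha> (2 * s + 1) * (z (2 * s * l + 2 * l) - z (2 * s * l + l)) = 0"
  shows "norm (\<Sum>t<2 * S. \<Sum>t'<T. \<alpha> t * \<beta> t' * (\<Sum>i=t*l..<t*l+l. \<Sum>j=t'*(R*l)..<t'*(R*l)+R*l. ker i j))
     \<le> 64 * L ^ 3 * decay_sum * real R powr (1/4) * real l * sqrt (\<Sum>s<S. (cmod (\<alpha> (2 * s)))\<^sup>2) * sqrt (\<Sum>t<T. (cmod (\<beta> t))\<^sup>2)"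
proof -
  define a where "a s = cmod (\<alpha> (2 * s))" for s
  define c where "c t = cmod (\<beta> t)" for t
  define u where "u s t = 2 * int s + 1 - int t * int R" for s t :: nat
  let ?W = "32 * L ^ 3 * real R powr (1/4) * real l"
  have W: "0 \<le> ?W" using L_ge_1 by auto
  let ?G = "\<lambda>t t'. (\<Sum>i=t*l..<t*l+l. \<Sum>j=t'*(R*l)..<t'*(R*l)+R*l. ker i j)"
  have pt: "norm (\<alpha> (2 * s) * \<beta> t' * ?G (2 * s) t' + \<alpha> (2 * s + 1) * \<beta> t' * ?G (2 * s + 1) t')
     \<le> ?W * (a s * c t' * decay (u s t') + a s * c t' * decay (u s t' - int R))" if s: "s < S" for s t'
  proof -
    let ?p = "2 * s * l" and ?q = "t' * R * l" and ?q' = "Suc t' * R * l"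
    have G1: "?G (2 * s) t' = (\<Sum>i=?p..<?p+l. \<Sum>j=?q..<?q'. ker i j)"
      by (intro sum.cong) (auto simp: algebra_simps)
    have G2: "?G (2 * s + 1) t' = (\<Sum>i=?p+l..<?p+2*l. \<Sum>j=?q..<?q'. ker i j)"
      by (intro sum.cong) (auto simp: algebra_simps)
    \<comment> \<open>Two fine blocks with a common parent are taken together. By cancellation the
      odd coefficient is expressed through the even one, and a difference of two values of E is
      left, to which \<open>E_diff_decay\<close> applies.\<close>
    have "\<alpha> (2 * s) * ?G (2 * s) t' + \<alpha> (2 * s + 1) * ?G (2 * s + 1) t'
        = \<alpha> (2 * s) * (z (?p + l) - z ?p) * (E ?p l ?q' - E ?p l ?q)"
      unfolding G1 G2 by (rule sum_ker_cancel[OF l _ cancel[OF s]]) simp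
    then have eq: "\<alpha> (2 * s) * \<beta> t' * ?G (2 * s) t' + \<alpha> (2 * s + 1) * \<beta> t' * ?G (2 * s + 1) t'
        = \<beta> t' * (\<alpha> (2 * s) * (z (?p + l) - z ?p) * (E ?p l ?q' - E ?p l ?q))"
    proof -
      have "a1 * b' * g1 + a2 * b' * g2 = b' * (a1 * g1 + a2 * g2)" for a1 a2 b' g1 g2 :: complex
        by (simp add: algebra_simps)
      then show ?thesis using \<open>\<alpha> (2 * s) * ?G (2 * s) t' + _ = _\<close> by (simp only:)
    qed
    have n1: "norm (z (?p + l) - z ?p) \<le> L * real l" using norm_z_diff_le[of "?p + l" ?p] by simp
    have n2: "norm (E ?p l ?q' - E ?p l ?q) \<le> 32 * L\<^sup>2 * real R powr (1/4) * (decay (u s t') + decay (u s t' - int R))"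
      using E_diff_decay[OF l R, of s t'] by (simp add: u_def)
    have "norm (\<beta> t' * (\<alpha> (2 * s) * (z (?p + l) - z ?p) * (E ?p l ?q' - E ?p l ?q)))
       \<le> c t' * (a s * (L * real l) * (32 * L\<^sup>2 * real R powr (1/4) * (decay (u s t') + decay (u s t' - int R))))"
      unfolding norm_mult a_def c_def using L_ge_1
      by (intro mult_left_mono mult_mono n1 n2) auto
    also have "\<dots> = ?W * (a s * c t' * decay (u s t') + a s * c t' * decay (u s t' - int R))"
      by (simp add: power3_eq_cube power2_eq_square algebra_simps)
    finally show ?thesis unfolding eq .
  qed
  let ?N = "sqrt (\<Sum>s<S. (a s)\<^sup>2) * sqrt (\<Sum>t<T. (c t)\<^sup>2)"
  \<comment> \<open>For fixed s the integers u s t are spaced by R, for fixed t by 2. In both cases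
    they are distinct, which is what \<open>sum_decay_le\<close> needs for rows and columns.\<close>
  have sch: "(\<Sum>s<S. \<Sum>t<T. a s * c t * decay (u s t - k)) \<le> decay_sum * sqrt (\<Sum>s<S. (a s)\<^sup>2) * sqrt (\<Sum>t<T. (c t)\<^sup>2)" for k
  proof (rule Schur_sum)
    show "(\<Sum>t<T. decay (u s t - k)) \<le> decay_sum" for s
      using R by (intro sum_decay_le) (auto simp: inj_on_def u_def)
    show "(\<Sum>s<S. decay (u s t - k)) \<le> decay_sum" for t
      by (intro sum_decay_le) (auto simp: inj_on_def u_def)
  qed (use decay_sum_ge_1 in \<open>auto simp: decay_nonneg\<close>)
  have "(\<Sum>t<2 * S. \<Sum>t'<T. \<alpha> t * \<beta> t' * ?G t t')
      = (\<Sum>s<S. \<Sum>t'<T. \<alpha> (2 * s) * \<beta> t' * ?G (2 * s) t' + \<alpha> (2 * s + 1) * \<beta> t' * ?G (2 * s + 1) t')"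
    unfolding sum_pairs by (simp only: sum.distrib)
  then have "norm (\<Sum>t<2 * S. \<Sum>t'<T. \<alpha> t * \<beta> t' * ?G t t')
     \<le> (\<Sum>s<S. \<Sum>t'<T. ?W * (a s * c t' * decay (u s t') + a s * c t' * decay (u s t' - int R)))"
    by (simp only:) (intro sum_norm_le pt, simp)
  also have "\<dots> = ?W * ((\<Sum>s<S. \<Sum>t'<T. a s * c t' * decay (u s t' - 0)) + (\<Sum>s<S. \<Sum>t'<T. a s * c t' * decay (u s t' - int R)))"
    by (simp only: sum_distrib_left[symmetric] sum.distrib diff_zero)
  also have "\<dots> \<le> ?W * (decay_sum * sqrt (\<Sum>s<S. (a s)\<^sup>2) * sqrt (\<Sum>t<T. (c t)\<^sup>2) + decay_sum * sqrt (\<Sum>s<S. (a s)\<^sup>2) * sqrt (\<Sum>t<T. (c t)\<^sup>2))"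
    by (intro mult_left_mono add_mono sch W)
  also have "\<dots> = 64 * L ^ 3 * decay_sum * real R powr (1/4) * real l * sqrt (\<Sum>s<S. (a s)\<^sup>2) * sqrt (\<Sum>t<T. (c t)\<^sup>2)"
    by (simp add: algebra_simps)
  finally show ?thesis by (simp only: a_def c_def)
qed

lemma sum_blocks:
  assumes "m \<le> n"
  shows "(\<Sum>i<2 ^ n. h i) = (\<Sum>t<2 ^ (n - m). \<Sum>i\<in>blk m t. h i)"
proof -
  have "(2::nat) ^ n = 2 ^ (n - m) * 2 ^ m" using assms by (simp add: power_add[symmetric])
  then show ?thesis using sum.nat_group[of h "2 ^ m" "2 ^ (n - m)"] by (simp add: blk_def)
qed

lemma blk_div: "i \<in> blk m t \<Longrightarrow> i div 2 ^ m = t"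
  unfolding blk_def by (intro div_nat_eqI) (auto simp: algebra_simps)

lemma bform_blocks:
  assumes m: "m \<le> n" and m': "m' \<le> n"
  shows "bform (2 ^ n) (\<lambda>i. \<alpha> (i div 2 ^ m)) (\<lambda>j. \<beta> (j div 2 ^ m'))
    = (\<Sum>t<2 ^ (n - m). \<Sum>t'<2 ^ (n - m'). \<alpha> t * \<beta> t' * (\<Sum>i\<in>blk m t. \<Sum>j\<in>blk m' t'. ker i j))"
proof -
  have "bform (2 ^ n) (\<lambda>i. \<alpha> (i div 2 ^ m)) (\<lambda>j. \<beta> (j div 2 ^ m')) =
    (\<Sum>t<2 ^ (n - m). \<Sum>i\<in>blk m t. \<Sum>t'<2 ^ (n - m'). \<Sum>j\<in>blk m' t'. \<alpha> t * \<beta> t' * ker i j)"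
    unfolding bform_def
    by (rule trans[OF sum_blocks[OF m]], rule sum.cong[OF refl], rule sum.cong[OF refl],
        rule trans[OF sum_blocks[OF m']], intro sum.cong refl) (simp add: blk_div)
  also have "\<dots> = (\<Sum>t<2 ^ (n - m). \<Sum>t'<2 ^ (n - m'). \<Sum>i\<in>blk m t. \<Sum>j\<in>blk m' t'. \<alpha> t * \<beta> t' * ker i j)"
    by (intro sum.cong refl sum.swap)
  finally show ?thesis by (simp only: sum_distrib_left)
qed

text \<open>The case l = 2^m and R = 2^(m' - m) of \<open>scale_bound\<close>. The weights 2^m and
  2^m' inside \<open>gnorm\<close> are accommodated by l R^(1/4) = sqrt l * sqrt (R l) * R^(-1/4),
  which is the source of the geometric decay. The even coefficients alone are at most the whole
  norm.\<close>

lemma bform_scales: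
  assumes mn: "m < n" and mm: "m \<le> m'" and m'n: "m' \<le> n"
  shows "norm (bform (2 ^ n) (\<lambda>i. dcoef n f m (i div 2 ^ m)) (\<lambda>j. dcoef n g m' (j div 2 ^ m')))
     \<le> 64 * L ^ 3 * decay_sum * (2 powr (- 1/4)) ^ (m' - m) * sqrt (gnorm n f m) * sqrt (gnorm n g m')"
proof -
  let ?l = "2 ^ m :: nat" and ?R = "2 ^ (m' - m) :: nat" and ?S = "2 ^ (n - Suc m) :: nat" and ?T = "2 ^ (n - m') :: nat"
  let ?\<alpha> = "dcoef n f m" and ?\<beta> = "dcoef n g m'"
  have e: "(2::nat) ^ (n - m) = 2 * ?S"
    using mn by (metis Suc_diff_Suc power_Suc)
  have r: "?R * ?l = 2 ^ m'" using mm by (simp add: power_add[symmetric])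
  have blk': "blk m t = {t * ?l..<t * ?l + ?l}" "blk m' t = {t * (?R * ?l)..<t * (?R * ?l) + ?R * ?l}" for t
    unfolding r by (simp_all add: blk_def)
  have zd: "z (t * ?l + ?l) - z (t * ?l) = 2 ^ m * Complex 1 (slope m t)" for t
    by (rule z_block_diff)
  have cancel: "?\<alpha> (2 * s) * (z (2 * s * ?l + ?l) - z (2 * s * ?l))
       + ?\<alpha> (2 * s + 1) * (z (2 * s * ?l + 2 * ?l) - z (2 * s * ?l + ?l)) = 0" for s
  proof -
    have "z (2 * s * ?l + 2 * ?l) - z (2 * s * ?l + ?l) = 2 ^ m * Complex 1 (slope m (2 * s + 1))"
      using zd[of "2 * s + 1"] by (simp add: algebra_simps)
    then have "?\<alpha> (2 * s) * (z (2 * s * ?l + ?l) - z (2 * s * ?l))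
       + ?\<alpha> (2 * s + 1) * (z (2 * s * ?l + 2 * ?l) - z (2 * s * ?l + ?l))
      = 2 ^ m * (?\<alpha> (2 * s) * Complex 1 (slope m (2 * s)) + ?\<alpha> (2 * s + 1) * Complex 1 (slope m (2 * s + 1)))"
      unfolding zd by (simp only: distrib_left mult_ac)
    then show ?thesis using dcoef_cancel[OF mn, of f s] by simp
  qed
  have "norm (bform (2 ^ n) (\<lambda>i. ?\<alpha> (i div 2 ^ m)) (\<lambda>j. ?\<beta> (j div 2 ^ m')))
    \<le> 64 * L ^ 3 * decay_sum * real ?R powr (1/4) * real ?l * sqrt (\<Sum>s<?S. (cmod (?\<alpha> (2 * s)))\<^sup>2) * sqrt (\<Sum>t<?T. (cmod (?\<beta> t))\<^sup>2)"
    unfolding bform_blocks[OF less_imp_le[OF mn] m'n] e blk'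
    by (rule scale_bound) (use cancel in auto)
  also have "\<dots> = 64 * L ^ 3 * decay_sum * (2 powr (- 1/4)) ^ (m' - m)
     * (sqrt (real ?l * (\<Sum>s<?S. (cmod (?\<alpha> (2 * s)))\<^sup>2)) * sqrt (real (?R * ?l) * (\<Sum>t<?T. (cmod (?\<beta> t))\<^sup>2)))"
  proof -
    have "(2 powr (- 1/4)) ^ (m' - m) * (sqrt (real ?l) * sqrt (real (?R * ?l))) = real ?R powr (1/4) * real ?l"
    proof -
      have "sqrt (real ?l) * sqrt (real (?R * ?l)) = real ?l * real ?R powr (1/2)"
        by (simp add: real_sqrt_mult powr_half_sqrt)
      moreover have "(2 powr (- 1/4)) ^ (m' - m) = real ?R powr (- 1/4)"
        by (simp add: powr_powr powr_realpow[symmetric] mult.commute)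
      moreover have "real ?R powr (- 1/4) * real ?R powr (1/2) = real ?R powr (1/4)"
        unfolding powr_add[symmetric] by simp
      ultimately show ?thesis by (simp only: mult_ac)
    qed
    then have "c * real ?R powr (1/4) * real ?l * sqrt x * sqrt y
      = c * (2 powr (- 1/4)) ^ (m' - m) * (sqrt (real ?l * x) * sqrt (real (?R * ?l) * y))" for c x y
      unfolding real_sqrt_mult[of _ x] real_sqrt_mult[of _ y] by (simp only: mult_ac)
    then show ?thesis .
  qed
  also have "\<dots> \<le> 64 * L ^ 3 * decay_sum * (2 powr (- 1/4)) ^ (m' - m) * (sqrt (gnorm n f m) * sqrt (gnorm n g m'))"
  proof (intro mult_left_mono mult_mono real_sqrt_le_mono)
    show "real ?l * (\<Sum>s<?S. (cmod (?\<alpha> (2 * s)))\<^sup>2) \<le> gnorm n f m"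
      unfolding gnorm_def e sum_pairs sum_distrib_left by (intro sum_mono) simp
    show "real (?R * ?l) * (\<Sum>t<?T. (cmod (?\<beta> t))\<^sup>2) \<le> gnorm n g m'"
      unfolding gnorm_def r sum_distrib_left by simp
  qed (use L_ge_1 decay_sum_ge_1 in \<open>auto intro!: mult_nonneg_nonneg sum_nonneg simp: gnorm_def\<close>)
  finally show ?thesis by (simp only: mult.assoc)
qed

lemma bform_commute: "bform N f g = - bform N g f"
proof -
  have "bform N f g = (\<Sum>i<N. \<Sum>j<N. - (g j * f i * ker j i))"
    unfolding bform_def by (intro sum.cong refl) (subst ker_commute, simp)
  also have "\<dots> = (\<Sum>j<N. \<Sum>i<N. - (g j * f i * ker j i))" by (rule sum.swap)
  finally show ?thesis by (simp add: bform_def sum_negf)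
qed

lemma gnorm_nonneg: "0 \<le> gnorm n f m"
  by (auto simp: gnorm_def intro!: sum_nonneg)

definition scale_const :: real where
  "scale_const = 64 * L ^ 3 * decay_sum"

definition form_const :: real where
  "form_const = scale_const * (2 / (1 - 2 powr (- 1/4))) * (36 * L ^ 6)"

text \<open>Antisymmetry does two jobs. It exchanges the finer and the coarser function, and it
  settles m = m' = n, where no cancellation is available: both functions are constant there, so the
  form is a multiple of its value at (1, 1), which is 0.\<close>

lemma bform_scales_sym:
  assumes m: "m \<le> n" and m': "m' \<le> n"
  shows "norm (bform (2 ^ n) (\<lambda>i. dcoef n f m (i div 2 ^ m)) (\<lambda>j. dcoef n g m' (j div 2 ^ m')))
     \<le> scale_const * (sqrt (gnorm n f m) * sqrt (gnorm n g m') * (2 powr (- 1/4)) ^ (max m m' - min m m'))"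
    (is "norm (bform _ ?f ?g) \<le> ?rhs")
proof -
  consider "m < n" "m \<le> m'" | "m' < n" "m' \<le> m" | "m = n" "m' = n" using m m' by linarith
  then show ?thesis
  proof cases
    case 1
    then show ?thesis using bform_scales[of m n m' f g] m' by (simp add: scale_const_def mult_ac)
  next
    case 2
    then show ?thesis using bform_scales[of m' n m g f] m bform_commute[of "2 ^ n" ?f ?g]
      by (simp add: scale_const_def mult_ac)
  next
    case 3
    have "bform (2 ^ n) ?f ?g = (\<Sum>t<1::nat. \<Sum>t'<1::nat. dcoef n f n t * dcoef n g n t' * (\<Sum>i\<in>blk n t. \<Sum>j\<in>blk n t'. ker i j))"
      using bform_blocks[of n n n "dcoef n f n" "dcoef n g n"] 3 by simp
    also have "\<dots> = dcoef n f n 0 * dcoef n g n 0 * bform (2 ^ n) (\<lambda>_. 1) (\<lambda>_. 1)"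
      by (simp add: bform_def blk_def atLeast0LessThan)
    also have "bform (2 ^ n) (\<lambda>_. 1) (\<lambda>_. 1) = 0"
      using bform_commute[of "2 ^ n" "\<lambda>_. 1" "\<lambda>_. 1"] by simp
    finally have "norm (bform (2 ^ n) ?f ?g) = 0" by simp
    moreover have "0 \<le> ?rhs"
      using L_ge_1 decay_sum_ge_1 by (auto simp: scale_const_def gnorm_nonneg intro!: mult_nonneg_nonneg)
    ultimately show ?thesis by simp
  qed
qed

text \<open>After expanding both arguments, the matrix indexed by pairs of scales decays
  geometrically off the diagonal. Schur's test reduces the bound to the square functions of f and g,
  and \<open>square_function_bound\<close> plays the part of the Parseval identity.\<close>

lemma bform_bound:
  "norm (bform (2 ^ n) f g) \<le> form_const * sqrt (\<Sum>i<2 ^ n. (cmod (f i))\<^sup>2) * sqrt (\<Sum>i<2 ^ n. (cmod (g i))\<^sup>2)"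
proof -
  let ?q = "2 powr (- 1/4) :: real"
  have q: "0 < ?q" "?q < 1" by (auto simp: powr_less_one)
  let ?D = "\<lambda>h m i. dcoef n h m (i div 2 ^ m)"
  have X: "0 \<le> 2 / (1 - ?q)" using q by simp
  have sc: "0 \<le> scale_const" using L_ge_1 decay_sum_ge_1 by (auto simp: scale_const_def)
  have "bform (2 ^ n) f g = (\<Sum>i<2 ^ n. \<Sum>j<2 ^ n. (\<Sum>m\<le>n. ?D f m i) * (\<Sum>m'\<le>n. ?D g m' j) * ker i j)"
    unfolding bform_def by (simp only: martingale_expansion[of _ _ n, symmetric])
  also have "\<dots> = (\<Sum>i<2 ^ n. \<Sum>j<2 ^ n. \<Sum>m\<le>n. \<Sum>m'\<le>n. ?D f m i * ?D g m' j * ker i j)"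
    by (simp only: sum_distrib_left sum_distrib_right)
      (rule sum.cong[OF refl], rule sum.cong[OF refl], rule sum.swap)
  also have "\<dots> = (\<Sum>i<2 ^ n. \<Sum>m\<le>n. \<Sum>j<2 ^ n. \<Sum>m'\<le>n. ?D f m i * ?D g m' j * ker i j)"
    by (intro sum.cong refl sum.swap)
  also have "\<dots> = (\<Sum>m\<le>n. \<Sum>i<2 ^ n. \<Sum>j<2 ^ n. \<Sum>m'\<le>n. ?D f m i * ?D g m' j * ker i j)"
    by (rule sum.swap)
  also have "\<dots> = (\<Sum>m\<le>n. \<Sum>i<2 ^ n. \<Sum>m'\<le>n. \<Sum>j<2 ^ n. ?D f m i * ?D g m' j * ker i j)"
    by (intro sum.cong refl sum.swap)
  also have "\<dots> = (\<Sum>m\<le>n. \<Sum>m'\<le>n. bform (2 ^ n) (?D f m) (?D g m'))"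
    unfolding bform_def by (intro sum.cong refl sum.swap)
  finally have "norm (bform (2 ^ n) f g)
     \<le> (\<Sum>m\<le>n. \<Sum>m'\<le>n. scale_const * (sqrt (gnorm n f m) * sqrt (gnorm n g m') * ?q ^ (max m m' - min m m')))"
    by (simp only:) (intro sum_norm_le bform_scales_sym, auto)
  also have "\<dots> = scale_const * (\<Sum>m\<le>n. \<Sum>m'\<le>n. sqrt (gnorm n f m) * sqrt (gnorm n g m') * ?q ^ (max m m' - min m m'))"
    by (simp only: sum_distrib_left)
  also have "\<dots> \<le> scale_const * (2 / (1 - ?q) * sqrt (\<Sum>m\<le>n. (sqrt (gnorm n f m))\<^sup>2) * sqrt (\<Sum>m\<le>n. (sqrt (gnorm n g m))\<^sup>2))"
  proof (intro mult_left_mono[OF _ sc] Schur_sum)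
    show "(\<Sum>m'\<le>n. ?q ^ (max m m' - min m m')) \<le> 2 / (1 - ?q)" for m
      by (rule geometric_row[OF q])
    show "(\<Sum>m\<le>n. ?q ^ (max m m' - min m m')) \<le> 2 / (1 - ?q)" for m'
      using geometric_row[OF q, of m' n] by (simp only: max.commute min.commute)
  qed (use X in auto)
  also have "\<dots> = scale_const * (2 / (1 - ?q)) * (sqrt (\<Sum>m\<le>n. gnorm n f m) * sqrt (\<Sum>m\<le>n. gnorm n g m))"
    by (simp add: gnorm_nonneg)
  also have "\<dots> \<le> scale_const * (2 / (1 - ?q)) * (sqrt (36 * L ^ 6 * (\<Sum>i<2 ^ n. (cmod (f i))\<^sup>2)) * sqrt (36 * L ^ 6 * (\<Sum>i<2 ^ n. (cmod (g i))\<^sup>2)))"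
    by (intro mult_left_mono mult_mono real_sqrt_le_mono square_function_bound mult_nonneg_nonneg X sc)
      (auto intro!: sum_nonneg mult_nonneg_nonneg simp: gnorm_nonneg L_ge_1)
  also have "\<dots> = form_const * sqrt (\<Sum>i<2 ^ n. (cmod (f i))\<^sup>2) * sqrt (\<Sum>i<2 ^ n. (cmod (g i))\<^sup>2)"
  proof -
    have "sqrt (c * x) * sqrt (c * y) = c * (sqrt x * sqrt y)" if "0 \<le> c" for c x y :: real
    proof -
      have "sqrt (c * x) * sqrt (c * y) = (sqrt c * sqrt c) * (sqrt x * sqrt y)"
        by (simp add: real_sqrt_mult)
      then show ?thesis using that by simp
    qed
    moreover have "0 \<le> 36 * L ^ 6" by simp
    ultimately show ?thesis unfolding form_const_def by (simp only: mult.assoc)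
  qed
  finally show ?thesis .
qed

section \<open>From second differences to the Cauchy matrix\<close>

definition kern :: "nat \<Rightarrow> nat \<Rightarrow> complex" where
  "kern i j = (if i = j then 0 else 1 / (z j - z i))"

lemma ker_diag: "ker i i = 0"
  using ker_commute[of i i] by simp

text \<open>H is arranged so that its increment along the edge b j is the whole error, the linear
  term producing b i b j / w. Its derivative Ln t - Ln (t - b i) - b i / w splits into a second
  order remainder, at most 4 L^2 / r^2, and the change from 1 / w to 1 / t, at most L^2 / r^2. The
  distance r \<ge> 2 keeps t - b i in the half plane Re \<ge> r / 2.\<close>

lemma ker_approx_far:
  assumes ij: "Suc (Suc i) \<le> j"
  shows "norm (ker i j - b i * b j / (z j - z i)) \<le> 5 * L ^ 3 / (real j - real i)\<^sup>2"
proof -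
  define w where "w = z j - z i"
  define r where "r = real j - real i"
  have r: "2 \<le> r" using ij by (simp add: r_def)
  have Rew: "Re w = r" by (simp add: w_def r_def)
  have w0: "w \<noteq> 0" using Rew r by auto
  let ?S = "closed_segment w (w + b j)"
  let ?H = "\<lambda>t. (t * Ln t - t) - ((t - b i) * Ln (t - b i) - (t - b i)) - b i * t / w"
  have Reb: "Re (b k) = 1" for k by (simp add: b_def)
  have sub: "?S \<subseteq> {z. r \<le> Re z}"
    by (rule closed_segment_subset) (use r Rew Reb convex_halfplane_Re_ge in auto)
  have "norm (?H (w + b j) - ?H w) \<le> (5 * L\<^sup>2 / r\<^sup>2) * norm ((w + b j) - w)"
  proof (rule field_differentiable_bound[of ?S])
    fix t assume t: "t \<in> ?S"
    then have rt: "r \<le> Re t" "r / 2 \<le> Re t" "r / 2 \<le> Re (t - b i)" using sub Reb r by auto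
    then have np: "t \<notin> \<real>\<^sub>\<le>\<^sub>0" "t - b i \<notin> \<real>\<^sub>\<le>\<^sub>0" "t \<noteq> 0" "t - b i \<noteq> 0"
      using r not_nonpos_if_Re_pos[of t] not_nonpos_if_Re_pos[of "t - b i"] by fastforce+
    have D1: "((\<lambda>t. t * Ln t - t) has_field_derivative Ln t) (at t within ?S)"
      using np by (auto intro!: derivative_eq_intros)
    have D2: "((\<lambda>t. (t - b i) * Ln (t - b i) - (t - b i)) has_field_derivative Ln (t - b i)) (at t within ?S)"
      using np by (auto intro!: derivative_eq_intros)
    have D3: "((\<lambda>t. b i * t / w) has_field_derivative b i / w) (at t within ?S)"
      using w0 by (auto intro!: derivative_eq_intros)
    show "(?H has_field_derivative (Ln t - Ln (t - b i) - b i / w)) (at t within ?S)"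
      by (intro DERIV_diff D1 D2 D3)
    have "norm (Ln (t - b i) - Ln t - (t - b i - t) / t) \<le> (norm (t - b i - t) / (r / 2))\<^sup>2"
      by (rule Ln_second_order) (use rt r in auto)
    also have "\<dots> = 4 * (norm (b i))\<^sup>2 / r\<^sup>2" by (simp add: power_divide power_mult_distrib)
    also have "\<dots> \<le> 4 * L\<^sup>2 / r\<^sup>2"
      using norm_b_le[of i] by (intro divide_right_mono mult_left_mono power_mono) auto
    finally have 1: "norm (Ln (t - b i) - Ln t - (t - b i - t) / t) \<le> 4 * L\<^sup>2 / r\<^sup>2" .
    have "norm (t - w) \<le> norm (b j)"
      using segment_bound1[OF t] by simp
    then have tw: "norm (t - w) \<le> L" using norm_b_le[of j] by simp
    have "b i / t - b i / w = b i * (w - t) / (t * w)"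
      using np w0 by (simp add: field_simps)
    then have "norm (b i / t - b i / w) = norm (b i) * norm (t - w) / (norm t * norm w)"
      by (simp add: norm_divide norm_mult norm_minus_commute)
    also have "\<dots> \<le> (L * L) / (r * r)"
      using norm_b_le[of i] tw norm_ge_Re[of r t] norm_ge_Re[of r w] rt Rew r L_ge_1
      by (intro frac_le mult_mono) auto
    finally have 2: "norm (b i / t - b i / w) \<le> L\<^sup>2 / r\<^sup>2" by (simp add: power2_eq_square)
    have "Ln t - Ln (t - b i) - b i / w = - (Ln (t - b i) - Ln t - (t - b i - t) / t) + (b i / t - b i / w)"
      by simp
    then have "norm (Ln t - Ln (t - b i) - b i / w) \<le> norm (- (Ln (t - b i) - Ln t - (t - b i - t) / t)) + norm (b i / t - b i / w)"
      by (metis norm_triangle_ineq)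
    also have "\<dots> \<le> 4 * L\<^sup>2 / r\<^sup>2 + L\<^sup>2 / r\<^sup>2" using 1 2 by (simp only: norm_minus_cancel add_mono)
    finally show "norm (Ln t - Ln (t - b i) - b i / w) \<le> 5 * L\<^sup>2 / r\<^sup>2" by simp
  qed auto
  also have "\<dots> \<le> (5 * L\<^sup>2 / r\<^sup>2) * L" using norm_b_le[of j] by (intro mult_left_mono) auto
  finally have H: "norm (?H (w + b j) - ?H w) \<le> 5 * L ^ 3 / r\<^sup>2" by (simp add: power2_eq_square power3_eq_cube)
  have lp: "log_prim x = x * Ln x - x" if "1 \<le> Re x" for x
    using that by (simp add: log_prim_pos)
  have P: "prim (Suc j) i = log_prim (w + b j)" "prim (Suc j) (Suc i) = log_prim (w + b j - b i)"
    "prim j i = log_prim w" "prim j (Suc i) = log_prim (w - b i)"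
    by (auto simp: prim_def w_def b_def)
  have k: "ker i j = ((w + b j) * Ln (w + b j) - (w + b j) - ((w + b j - b i) * Ln (w + b j - b i) - (w + b j - b i)))
     - (w * Ln w - w - ((w - b i) * Ln (w - b i) - (w - b i)))"
    unfolding ker_def P using r Rew Reb lp[of "w + b j"] lp[of "w + b j - b i"] lp[of w] lp[of "w - b i"] by simp
  have "b i * (w + b j) / w - b i * w / w = b i * b j / w"
    by (simp add: distrib_left add_divide_distrib)
  then have "ker i j - b i * b j / w = ?H (w + b j) - ?H w"
    unfolding k by (simp only: diff_diff_eq2 diff_diff_add) (simp only: algebra_simps)
  then show ?thesis using H by (simp add: w_def r_def)
qed

text \<open>Adjacent edges share a vertex, where the primitive vanishes, and the linear terms of the
  primitive cancel. What is left are two products controlled by \<open>Ln_diff_le\<close> with r =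
  1. Since the comparison term equals b (Suc i), both sides are simply bounded on their own.\<close>

lemma ker_approx_near:
  "norm (ker i (Suc i) - b i * b (Suc i) / (z (Suc i) - z i)) \<le> 5 * L ^ 3"
proof -
  let ?a = "b i" and ?c = "b (Suc i)"
  have Reb: "Re (b k) = 1" for k by (simp add: b_def)
  have P: "prim (Suc (Suc i)) i = log_prim (?a + ?c)" "prim (Suc (Suc i)) (Suc i) = log_prim ?c"
    "prim (Suc i) i = log_prim ?a" "prim (Suc i) (Suc i) = 0"
    by (auto simp: prim_def b_def)
  have k: "ker i (Suc i) = ?a * (Ln (?a + ?c) - Ln ?a) + ?c * (Ln (?a + ?c) - Ln ?c)"
    unfolding ker_def P by (simp add: log_prim_pos Reb algebra_simps)
  have n1: "norm (Ln (?a + ?c) - Ln ?a) \<le> norm ?c"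
    using Ln_diff_le[of 1 "?a + ?c" ?a] Reb by simp
  have n2: "norm (Ln (?a + ?c) - Ln ?c) \<le> norm ?a"
    using Ln_diff_le[of 1 "?a + ?c" ?c] Reb by simp
  have "norm (ker i (Suc i)) \<le> norm ?a * norm ?c + norm ?c * norm ?a"
    unfolding k by (intro order_trans[OF norm_triangle_ineq] add_mono) (auto simp: norm_mult intro!: mult_left_mono n1 n2)
  also have "\<dots> \<le> L * L + L * L"
    using norm_b_le L_ge_1 by (intro add_mono mult_mono) auto
  finally have 1: "norm (ker i (Suc i)) \<le> 2 * (L * L)" by simp
  have "b i * b (Suc i) / (z (Suc i) - z i) = ?c" using b_nz[of i] by (simp add: b_def)
  then have "norm (ker i (Suc i) - b i * b (Suc i) / (z (Suc i) - z i)) \<le> 2 * (L * L) + L"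
    using 1 norm_b_le[of "Suc i"] norm_triangle_ineq4[of "ker i (Suc i)" ?c] by simp
  also have "\<dots> \<le> 5 * L ^ 3"
  proof -
    have "L * 1 \<le> L * (L * L)" using L_ge_1 mult_mono[of 1 L 1 L] by (intro mult_left_mono) auto
    moreover have "1 * (L * L) \<le> L * (L * L)" using L_ge_1 by (intro mult_right_mono) auto
    ultimately have "2 * (L * L) + L \<le> 3 * (L * (L * L))" by linarith
    also have "\<dots> \<le> 5 * L ^ 3" using L_ge_1 by (simp add: power3_eq_cube)
    finally show ?thesis .
  qed
  finally show ?thesis .
qed

lemma ker_approx:
  assumes ij: "i \<noteq> j"
  shows "norm (ker i j / (b i * b j) - kern i j) \<le> 20 * L ^ 3 * decay (int i - int j)"
proof -
  have main: "norm (ker i j / (b i * b j) - kern i j) \<le> 20 * L ^ 3 * decay (int j - int i)" if ij: "i < j" for i j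
  proof -
    define r where "r = real j - real i"
    have r1: "1 \<le> r" using ij by (simp add: r_def)
    have "norm (ker i j - b i * b j / (z j - z i)) \<le> 5 * L ^ 3 / r\<^sup>2"
    proof (cases "j = Suc i")
      case True
      then show ?thesis using ker_approx_near[of i] by (simp add: r_def)
    next
      case False
      then show ?thesis using ker_approx_far[of i j] ij by (simp add: r_def)
    qed
    moreover have "ker i j / (b i * b j) - kern i j = (ker i j - b i * b j / (z j - z i)) / (b i * b j)"
      using b_nz[of i] b_nz[of j] ij z_diff_nz[of j i] by (simp add: kern_def diff_divide_distrib)
    moreover have "1 \<le> norm (b i * b j)"
      using mult_mono[OF norm_b_ge[of i] norm_b_ge[of j]] by (simp add: norm_mult)
    ultimately have "norm (ker i j / (b i * b j) - kern i j) \<le> (5 * L ^ 3 / r\<^sup>2) / 1"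
      unfolding norm_divide using L_ge_1 by (simp only: norm_divide) (intro frac_le, auto)
    also have "\<dots> \<le> 5 * L ^ 3 * (4 * decay (int j - int i))"
    proof -
      have "1 / (1 + real_of_int \<bar>int j - int i\<bar>)\<^sup>2 \<le> decay (int j - int i)"
        using inverse_square_le_decay[of 1 "int j - int i"] by simp
      also have "real_of_int \<bar>int j - int i\<bar> = r" using ij by (simp add: r_def)
      finally have d: "1 / (1 + r)\<^sup>2 \<le> decay (int j - int i)" .
      have "(1 + r)\<^sup>2 \<le> (2 * r)\<^sup>2" using r1 by (intro power_mono) auto
      then have "1 / r\<^sup>2 \<le> 4 * (1 / (1 + r)\<^sup>2)" using r1 by (simp add: divide_simps power_mult_distrib)
      then have "1 / r\<^sup>2 \<le> 4 * decay (int j - int i)" using d by linarith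
      then have "5 * L ^ 3 * (1 / r\<^sup>2) \<le> 5 * L ^ 3 * (4 * decay (int j - int i))" using L_ge_1 by (intro mult_left_mono) auto
      then show ?thesis by simp
    qed
    finally show ?thesis by simp
  qed
  show ?thesis
  proof (cases "i < j")
    case True
    then show ?thesis using main[OF True] by (simp add: decay_def abs_minus_commute)
  next
    case False
    then have ji: "j < i" using ij by simp
    have "1 / (z j - z i) = - (1 / (z i - z j))"
      by (subst minus_divide_right) simp
    then have "kern i j = - kern j i"
      using ij by (simp add: kern_def)
    then have "ker i j / (b i * b j) - kern i j = - (ker j i / (b j * b i) - kern j i)"
      using ker_commute[of i j] by (simp add: mult.commute)
    then show ?thesis using main[OF ji] by (simp only: norm_minus_cancel)
  qed
qed

definition hilbert_const :: real where
  "hilbert_const = form_const + 20 * L ^ 3 * decay_sum"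

text \<open>Dividing f and g by b turns b i b j / (z j - z i) into the Cauchy kernel, and does not
  increase norms because |b| \<ge> 1. The error matrix is dominated by
  \<open>decay (int i - int j)\<close> and left to Schur's test.\<close>

theorem discrete_Cauchy_bound:
  "norm (\<Sum>i<2 ^ n. \<Sum>j<2 ^ n. f i * g j * kern i j)
    \<le> hilbert_const * sqrt (\<Sum>i<2 ^ n. (cmod (f i))\<^sup>2) * sqrt (\<Sum>i<2 ^ n. (cmod (g i))\<^sup>2)"
proof -
  let ?f = "\<lambda>i. f i / b i" and ?g = "\<lambda>i. g i / b i"
  let ?N = "2 ^ n :: nat"
  let ?nf = "sqrt (\<Sum>i<?N. (cmod (f i))\<^sup>2)" and ?ng = "sqrt (\<Sum>i<?N. (cmod (g i))\<^sup>2)"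
  have le: "sqrt (\<Sum>i<?N. (cmod (h i / b i))\<^sup>2) \<le> sqrt (\<Sum>i<?N. (cmod (h i))\<^sup>2)" for h
  proof (intro real_sqrt_le_mono sum_mono power_mono)
    fix i
    have "cmod (h i) / cmod (b i) \<le> cmod (h i) / 1"
      using norm_b_ge[of i] by (intro frac_le) auto
    then show "cmod (h i / b i) \<le> cmod (h i)" by (simp add: norm_divide)
  qed simp
  have fc: "0 \<le> form_const"
  proof -
    have "2 powr (- 1/4) < (1::real)" by (simp add: powr_less_one)
    then show ?thesis using L_ge_1 decay_sum_ge_1 by (auto simp: form_const_def scale_const_def)
  qed
  have "norm (bform ?N ?f ?g) \<le> form_const * sqrt (\<Sum>i<?N. (cmod (?f i))\<^sup>2) * sqrt (\<Sum>i<?N. (cmod (?g i))\<^sup>2)"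
    by (rule bform_bound)
  also have "\<dots> \<le> form_const * ?nf * ?ng"
    using fc by (intro mult_mono le mult_nonneg_nonneg) (auto intro!: sum_nonneg)
  finally have 1: "norm (bform ?N ?f ?g) \<le> form_const * ?nf * ?ng" .
  have bf: "bform ?N ?f ?g = (\<Sum>i<?N. \<Sum>j<?N. f i * g j * (ker i j / (b i * b j)))"
    unfolding bform_def by (intro sum.cong refl) simp
  have "norm ((\<Sum>i<?N. \<Sum>j<?N. f i * g j * kern i j) - bform ?N ?f ?g)
     = norm (\<Sum>i<?N. \<Sum>j<?N. f i * g j * (kern i j - ker i j / (b i * b j)))"
    unfolding bf sum_subtractf[symmetric] right_diff_distrib[symmetric] ..
  also have "\<dots> \<le> (\<Sum>i<?N. \<Sum>j<?N. cmod (f i) * cmod (g j) * (20 * L ^ 3 * decay (int i - int j)))"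
  proof (intro sum_norm_le)
    fix i j
    have "norm (kern i j - ker i j / (b i * b j)) \<le> 20 * L ^ 3 * decay (int i - int j)"
    proof (cases "i = j")
      case True
      then show ?thesis using L_ge_1 by (simp add: kern_def ker_diag decay_nonneg)
    next
      case False
      then show ?thesis using ker_approx[OF False] by (simp add: norm_minus_commute)
    qed
    then show "norm (f i * g j * (kern i j - ker i j / (b i * b j))) \<le> cmod (f i) * cmod (g j) * (20 * L ^ 3 * decay (int i - int j))"
      unfolding norm_mult by (intro mult_left_mono) auto
  qed
  also have "\<dots> = 20 * L ^ 3 * (\<Sum>i<?N. \<Sum>j<?N. cmod (f i) * cmod (g j) * decay (int i - int j))"
    by (simp only: sum_distrib_left mult_ac)
  also have "\<dots> \<le> 20 * L ^ 3 * (decay_sum * ?nf * ?ng)"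
  proof (intro mult_left_mono Schur_sum)
    show "(\<Sum>t<?N. decay (int s - int t)) \<le> decay_sum" for s
      by (intro sum_decay_le) (auto simp: inj_on_def)
    show "(\<Sum>s<?N. decay (int s - int t)) \<le> decay_sum" for t
      by (intro sum_decay_le) (auto simp: inj_on_def)
  qed (use decay_sum_ge_1 L_ge_1 in \<open>auto simp: decay_nonneg\<close>)
  finally have 2: "norm ((\<Sum>i<?N. \<Sum>j<?N. f i * g j * kern i j) - bform ?N ?f ?g) \<le> 20 * L ^ 3 * (decay_sum * ?nf * ?ng)" .
  have "norm (\<Sum>i<?N. \<Sum>j<?N. f i * g j * kern i j) \<le> norm (bform ?N ?f ?g) + norm ((\<Sum>i<?N. \<Sum>j<?N. f i * g j * kern i j) - bform ?N ?f ?g)"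
    using norm_triangle_sub by blast
  also have "\<dots> \<le> form_const * ?nf * ?ng + 20 * L ^ 3 * (decay_sum * ?nf * ?ng)" by (intro add_mono 1 2)
  also have "\<dots> = hilbert_const * ?nf * ?ng" by (simp add: hilbert_const_def algebra_simps)
  finally show ?thesis .
qed

text \<open>Duality: the form is tested against the conjugate of the image W, which makes it equal
  to the squared norm of W.\<close>

lemma discrete_Cauchy_operator_bound:
  "(\<Sum>i<2 ^ n. (cmod (\<Sum>j<2 ^ n. g j * kern i j))\<^sup>2) \<le> hilbert_const\<^sup>2 * (\<Sum>j<2 ^ n. (cmod (g j))\<^sup>2)"
proof -
  define W where "W i = (\<Sum>j<2 ^ n. g j * kern i j)" for i
  let ?S = "\<Sum>i<2 ^ n. (cmod (W i))\<^sup>2" and ?G = "\<Sum>j<2 ^ n. (cmod (g j))\<^sup>2"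
  have S0: "0 \<le> ?S" and G0: "0 \<le> ?G" by (auto intro!: sum_nonneg)
  have "(\<Sum>i<2 ^ n. \<Sum>j<2 ^ n. cnj (W i) * g j * kern i j) = (\<Sum>i<2 ^ n. cnj (W i) * W i)"
    unfolding W_def by (simp only: sum_distrib_left mult.assoc)
  also have "\<dots> = of_real ?S"
    by (simp only: of_real_sum complex_norm_square mult.commute)
  finally have "norm (complex_of_real ?S) \<le> hilbert_const * sqrt (\<Sum>i<2 ^ n. (cmod (cnj (W i)))\<^sup>2) * sqrt ?G"
    using discrete_Cauchy_bound[where n = n and f = "\<lambda>i. cnj (W i)" and g = g] by (simp only:)
  then have "?S \<le> hilbert_const * sqrt ?S * sqrt ?G" using S0 by (simp only: norm_of_real abs_of_nonneg complex_mod_cnj)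
  then have le: "sqrt ?S * sqrt ?S \<le> (hilbert_const * sqrt ?G) * sqrt ?S"
    using real_sqrt_mult_self[of ?S] S0 by (simp only: abs_of_nonneg mult_ac)
  have "sqrt ?S \<le> \<bar>hilbert_const\<bar> * sqrt ?G"
  proof (cases "sqrt ?S = 0")
    case False
    then have "0 < sqrt ?S" using S0 by (simp add: less_le)
    with le have "sqrt ?S \<le> hilbert_const * sqrt ?G" by (rule mult_right_le_imp_le)
    also have "\<dots> \<le> \<bar>hilbert_const\<bar> * sqrt ?G" using G0 by (intro mult_right_mono) auto
    finally show ?thesis .
  qed (use G0 in auto)
  then have "(sqrt ?S)\<^sup>2 \<le> (\<bar>hilbert_const\<bar> * sqrt ?G)\<^sup>2" using S0 by (intro power_mono) auto
  then show ?thesis using S0 G0 by (simp add: W_def power_mult_distrib)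
qed

end

section \<open>Schur's test and measures of linear growth\<close>

lemma ennreal_le_suminf: "f k \<le> (\<Sum>k. f k)" for f :: "nat \<Rightarrow> ennreal"
  using sum_le_suminf[of f "{k}"] by simp

lemma nn_Schur:
  fixes p :: "'a \<Rightarrow> 'b \<Rightarrow> real" and g :: "'b \<Rightarrow> ennreal"
  assumes "sigma_finite_measure N" "sigma_finite_measure N'"
    and p [measurable]: "(\<lambda>(x, y). p x y) \<in> borel_measurable (N \<Otimes>\<^sub>M N')"
    and g [measurable]: "g \<in> borel_measurable N'"
    and p0: "\<And>x y. 0 \<le> p x y"
    and row: "\<And>x. x \<in> space N \<Longrightarrow> (\<integral>\<^sup>+ y. ennreal (p x y) \<partial>N') \<le> X"
    and col: "\<And>y. y \<in> space N' \<Longrightarrow> (\<integral>\<^sup>+ x. ennreal (p x y) \<partial>N) \<le> X"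
  shows "(\<integral>\<^sup>+ x. (\<integral>\<^sup>+ y. ennreal (p x y) * g y \<partial>N')\<^sup>2 \<partial>N) \<le> X * X * (\<integral>\<^sup>+ y. (g y)\<^sup>2 \<partial>N')"
proof -
  interpret N: sigma_finite_measure N by fact
  interpret N': sigma_finite_measure N' by fact
  interpret P: pair_sigma_finite N N' ..
  have sq: "ennreal (sqrt (p x y)) * ennreal (sqrt (p x y)) = ennreal (p x y)" for x y
    using p0 by (simp add: ennreal_mult[symmetric])
  have "(\<integral>\<^sup>+ x. (\<integral>\<^sup>+ y. ennreal (p x y) * g y \<partial>N')\<^sup>2 \<partial>N) \<le> (\<integral>\<^sup>+ x. X * (\<integral>\<^sup>+ y. ennreal (p x y) * (g y)\<^sup>2 \<partial>N') \<partial>N)"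
  proof (rule nn_integral_mono)
    fix x assume x: "x \<in> space N"
    then have [measurable]: "(\<lambda>y. p x y) \<in> borel_measurable N'"
      using measurable_Pair_compose_split[OF p measurable_const[OF x] measurable_ident] by simp
    have "(\<integral>\<^sup>+ y. ennreal (p x y) * g y \<partial>N') = (\<integral>\<^sup>+ y. ennreal (sqrt (p x y)) * (ennreal (sqrt (p x y)) * g y) \<partial>N')"
      by (simp add: mult.assoc[symmetric] sq)
    then have "(\<integral>\<^sup>+ y. ennreal (p x y) * g y \<partial>N')\<^sup>2 \<le>
       (\<integral>\<^sup>+ y. (ennreal (sqrt (p x y)))\<^sup>2 \<partial>N') * (\<integral>\<^sup>+ y. (ennreal (sqrt (p x y)) * g y)\<^sup>2 \<partial>N')"
      using Cauchy_Schwarz_nn_integral[of "\<lambda>y. ennreal (sqrt (p x y))" N' "\<lambda>y. ennreal (sqrt (p x y)) * g y"] by simp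
    also have "(\<lambda>y. (ennreal (sqrt (p x y)))\<^sup>2) = (\<lambda>y. ennreal (p x y))"
      by (simp add: power2_eq_square sq)
    also have "(\<lambda>y. (ennreal (sqrt (p x y)) * g y)\<^sup>2) = (\<lambda>y. ennreal (p x y) * (g y)\<^sup>2)"
      by (simp add: power_mult_distrib) (simp add: power2_eq_square sq)
    finally show "(\<integral>\<^sup>+ y. ennreal (p x y) * g y \<partial>N')\<^sup>2 \<le> X * (\<integral>\<^sup>+ y. ennreal (p x y) * (g y)\<^sup>2 \<partial>N')"
      using row[OF x] by (meson mult_right_mono order_trans zero_le)
  qed
  also have "\<dots> = X * (\<integral>\<^sup>+ x. (\<integral>\<^sup>+ y. ennreal (p x y) * (g y)\<^sup>2 \<partial>N') \<partial>N)"
    by (rule nn_integral_cmult) measurable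
  also have "(\<integral>\<^sup>+ x. (\<integral>\<^sup>+ y. ennreal (p x y) * (g y)\<^sup>2 \<partial>N') \<partial>N) = (\<integral>\<^sup>+ y. (\<integral>\<^sup>+ x. ennreal (p x y) * (g y)\<^sup>2 \<partial>N) \<partial>N')"
    by (rule P.Fubini'[symmetric]) measurable
  also have "\<dots> \<le> (\<integral>\<^sup>+ y. X * (g y)\<^sup>2 \<partial>N')"
  proof (rule nn_integral_mono)
    fix y assume y: "y \<in> space N'"
    then have [measurable]: "(\<lambda>x. p x y) \<in> borel_measurable N"
      using measurable_Pair_compose_split[OF p measurable_ident measurable_const[OF y]] by simp
    have "(\<integral>\<^sup>+ x. ennreal (p x y) * (g y)\<^sup>2 \<partial>N) = (\<integral>\<^sup>+ x. ennreal (p x y) \<partial>N) * (g y)\<^sup>2"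
      by (rule nn_integral_multc) measurable
    then show "(\<integral>\<^sup>+ x. ennreal (p x y) * (g y)\<^sup>2 \<partial>N) \<le> X * (g y)\<^sup>2"
      using col[OF y] by (simp add: mult_right_mono)
  qed
  also have "\<dots> = X * (\<integral>\<^sup>+ y. (g y)\<^sup>2 \<partial>N')"
    by (rule nn_integral_cmult) measurable
  finally show ?thesis by (simp add: mult.assoc mult_left_mono)
qed

section \<open>Measures of linear growth\<close>

locale growth_measure = finite_measure N for N :: "(real^2) measure" +
  fixes c :: real
  assumes sets_N [measurable_cong, simp]: "sets N = sets borel" and c_nonneg: "0 \<le> c"
    and growth: "\<And>x r. 0 < r \<Longrightarrow> emeasure N (cball x r) \<le> ennreal (c * r)"
begin

lemma space_N [simp]: "space N = UNIV"
  using sets_eq_imp_space_eq[OF sets_N] by simp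

text \<open>Each ball contributes its height times at most c times its radius. This serves kernels
  dominated by a superposition of concentric balls, namely \<open>pois\<close> below and the
  logarithm in \<open>log_integral_le\<close>.\<close>

lemma layer_bound:
  fixes a r :: "nat \<Rightarrow> real"
  assumes pos: "\<And>k. 0 \<le> a k" "\<And>k. 0 < r k"
    and le: "\<And>y. y \<in> U \<Longrightarrow> ennreal (h y) \<le> (\<Sum>k. ennreal (a k) * indicator (cball x (r k)) y)"
    and sums: "(\<lambda>k. a k * r k) sums T"
  shows "(\<integral>\<^sup>+ y. ennreal (h y) * indicator U y \<partial>N) \<le> ennreal (c * T)"
proof -
  have [measurable]: "cball x (r k) \<in> sets N" for k by simp
  have T: "0 \<le> T"
    using pos less_imp_le[OF pos(2)] by (auto intro!: sums_le[OF _ sums_zero sums] mult_nonneg_nonneg)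
  have "(\<integral>\<^sup>+ y. ennreal (h y) * indicator U y \<partial>N) \<le> (\<integral>\<^sup>+ y. (\<Sum>k. ennreal (a k) * indicator (cball x (r k)) y) \<partial>N)"
    by (rule nn_integral_mono) (use le in \<open>auto split: split_indicator\<close>)
  also have "\<dots> = (\<Sum>k. (\<integral>\<^sup>+ y. ennreal (a k) * indicator (cball x (r k)) y \<partial>N))"
    by (rule nn_integral_suminf) measurable
  also have "\<dots> = (\<Sum>k. ennreal (a k) * emeasure N (cball x (r k)))"
    by (subst nn_integral_cmult) auto
  also have "\<dots> \<le> (\<Sum>k. ennreal (c * (a k * r k)))"
  proof (rule suminf_le)
    fix k
    have "ennreal (a k) * emeasure N (cball x (r k)) \<le> ennreal (a k) * ennreal (c * r k)"
      by (intro mult_left_mono growth pos) auto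
    also have "\<dots> = ennreal (c * (a k * r k))"
      using pos(1)[of k] pos(2)[of k] c_nonneg by (simp add: ennreal_mult[symmetric] mult_ac)
    finally show "ennreal (a k) * emeasure N (cball x (r k)) \<le> ennreal (c * (a k * r k))" .
  qed auto
  also have "\<dots> = ennreal (c * T)"
    using sums_mult[OF sums, of c] pos(1) less_imp_le[OF pos(2)] c_nonneg T
    by (intro sums_unique[symmetric]) (subst sums_ennreal, auto)
  finally show ?thesis .
qed

text \<open>A scale invariant majorant of Poisson type. It dominates the error committed when the
  Cauchy kernel truncated at \<epsilon> is replaced by a step function of mesh \<epsilon>. On the
  diagonal its value is 0, by division by zero, and the error vanishes there as well.\<close>

definition pois :: "real \<Rightarrow> real^2 \<Rightarrow> real^2 \<Rightarrow> real" where
  "pois \<epsilon> x y = min (1 / \<epsilon>) (\<epsilon> / (dist x y)\<^sup>2)"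

lemma pois_nonneg: "0 < \<epsilon> \<Longrightarrow> 0 \<le> pois \<epsilon> x y" by (simp add: pois_def)

lemma pois_measurable [measurable]:
  "(\<lambda>(x, y). pois \<epsilon> x y) \<in> borel_measurable (borel \<Otimes>\<^sub>M borel)"
  unfolding pois_def by measurable

lemma pois_commute: "pois \<epsilon> x y = pois \<epsilon> y x"
  by (simp add: pois_def dist_commute)

lemma pois_integral_le:
  assumes e: "0 < \<epsilon>"
  shows "(\<integral>\<^sup>+ y. ennreal (pois \<epsilon> x y) \<partial>N) \<le> ennreal (8 * c)"
proof -
  have "(\<integral>\<^sup>+ y. ennreal (pois \<epsilon> x y) * indicator UNIV y \<partial>N) \<le> ennreal (c * 8)"
  proof (rule layer_bound)
    fix y
    let ?a = "\<lambda>k. 4 / (\<epsilon> * 4 ^ k)" and ?r = "\<lambda>k. 2 ^ k * \<epsilon>"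
    define d where "d = dist x y"
    obtain k0 where k0: "d / \<epsilon> < 2 ^ k0" using real_arch_pow[of 2 "d / \<epsilon>"] by auto
    then have ex: "\<exists>k. d \<le> 2 ^ k * \<epsilon>" using e by (auto simp: field_simps intro!: exI[of _ k0])
    \<comment> \<open>The smallest dyadic multiple of \<epsilon> that reaches y. Unless k = 0, y
      lies outside the ball of half that radius, whence the height 4 / (\<epsilon> 4^k); the layers
      add up to 4 * 2 = 8.\<close>
    define k where "k = (LEAST k. d \<le> 2 ^ k * \<epsilon>)"
    have k: "d \<le> 2 ^ k * \<epsilon>" unfolding k_def by (rule LeastI_ex[OF ex])
    have "pois \<epsilon> x y \<le> ?a k"
    proof (cases k)
      case 0
      have "pois \<epsilon> x y \<le> 1 / \<epsilon>" by (simp add: pois_def)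
      also have "\<dots> \<le> 4 / \<epsilon>" using e by (intro divide_right_mono) auto
      finally show ?thesis using 0 by simp
    next
      case (Suc j)
      then have "\<not> d \<le> 2 ^ j * \<epsilon>" using not_less_Least[of j "\<lambda>k. d \<le> 2 ^ k * \<epsilon>"] by (auto simp: k_def)
      then have d: "2 ^ j * \<epsilon> \<le> d" by simp
      have d0: "0 < d" by (rule less_le_trans[OF _ d]) (use e in simp)
      have "(2 ^ j * \<epsilon>)\<^sup>2 \<le> d\<^sup>2" using d e by (intro power_mono) auto
      then have "\<epsilon> / d\<^sup>2 \<le> \<epsilon> / (2 ^ j * \<epsilon>)\<^sup>2" using e by (intro divide_left_mono) (use d0 e in \<open>auto intro!: mult_pos_pos zero_less_power\<close>)
      also have "\<dots> = ?a k"
      proof -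
        have "(2 ^ j * \<epsilon>)\<^sup>2 = 4 ^ j * \<epsilon>\<^sup>2" by (simp add: power_mult_distrib power2_eq_square) (simp add: power_mult_distrib[symmetric])
        then show ?thesis using e Suc by (simp add: power2_eq_square)
      qed
      finally show ?thesis by (simp add: pois_def d_def)
    qed
    then have "ennreal (pois \<epsilon> x y) \<le> ennreal (?a k) * indicator (cball x (?r k)) y"
      using k by (simp add: d_def ennreal_leI)
    also have "\<dots> \<le> (\<Sum>k. ennreal (?a k) * indicator (cball x (?r k)) y)"
      by (rule ennreal_le_suminf)
    finally show "ennreal (pois \<epsilon> x y) \<le> (\<Sum>k. ennreal (?a k) * indicator (cball x (?r k)) y)" .
  next
    have "(\<lambda>k. 4 * (1/2::real) ^ k) sums (4 * (1 / (1 - 1/2)))"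
      by (intro sums_mult geometric_sums) simp
    moreover have "(4 / (\<epsilon> * 4 ^ k)) * (2 ^ k * \<epsilon>) = 4 * (1/2) ^ k" for k
    proof -
      have "(4::real) ^ k = 2 ^ k * 2 ^ k" by (simp add: power_mult_distrib[symmetric])
      then show ?thesis using e by (simp add: power_divide)
    qed
    ultimately show "(\<lambda>k. (4 / (\<epsilon> * 4 ^ k)) * (2 ^ k * \<epsilon>)) sums 8" by simp
  qed (use e in auto)
  then show ?thesis by (simp add: mult.commute)
qed

end

section \<open>Lipschitz graphs\<close>

lemma orthonormal_expand:
  fixes a b v :: "real^2"
  assumes "norm a = 1" "norm b = 1" "a \<bullet> b = 0"
  shows "v = (v \<bullet> a) *\<^sub>R a + (v \<bullet> b) *\<^sub>R b"
proof -
  have ne: "a \<noteq> b" using assms by (auto simp: norm_eq_1)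
  have po: "pairwise orthogonal {a, b}" using assms by (auto simp: pairwise_def orthogonal_def inner_commute)
  have ind: "independent {a, b}"
    by (rule pairwise_orthogonal_independent[OF po]) (use assms in auto)
  have "UNIV \<subseteq> span {a, b}"
    by (rule card_ge_dim_independent[OF _ ind]) (use ne in auto)
  then have "v \<in> span {a, b}" by auto
  then have "(\<Sum>x\<in>{a, b}. (v \<bullet> x) *\<^sub>R x) = v"
    by (intro orthonormal_basis_expand[OF po]) (use assms in auto)
  then show ?thesis using ne by simp
qed

section \<open>Discretising the truncated Cauchy kernel on a Lipschitz graph\<close>

locale lipschitz_frame =
  fixes a b :: "real^2" and f :: "real \<Rightarrow> real" and K :: real
  assumes norm_a: "norm a = 1" and norm_b: "norm b = 1" and orth: "a \<bullet> b = 0"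
    and lip: "K-lipschitz_on UNIV f"
begin

definition \<zeta> :: "real^2 \<Rightarrow> complex" where "\<zeta> x = Complex (x \<bullet> a) (x \<bullet> b)"

definition graph :: "(real^2) set" where "graph = {x. x \<bullet> b = f (x \<bullet> a)}"

lemma K_nonneg: "0 \<le> K" using lip by (simp add: lipschitz_on_def)

lemma f_lip: "\<bar>f s - f t\<bar> \<le> K * \<bar>s - t\<bar>"
  using lipschitz_onD[OF lip, of s t] by (simp add: dist_real_def)

lemma inner_expand: "v \<bullet> w = (v \<bullet> a) * (w \<bullet> a) + (v \<bullet> b) * (w \<bullet> b)"
proof -
  have "v \<bullet> w = ((v \<bullet> a) *\<^sub>R a + (v \<bullet> b) *\<^sub>R b) \<bullet> w"
    using orthonormal_expand[OF norm_a norm_b orth, of v] by simp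
  also have "\<dots> = (v \<bullet> a) * (a \<bullet> w) + (v \<bullet> b) * (b \<bullet> w)"
    by (simp only: inner_add_left inner_scaleR_left)
  finally show ?thesis by (simp add: inner_commute)
qed

lemma dist_eq_cmod: "dist x y = cmod (\<zeta> x - \<zeta> y)"
proof -
  have "(dist x y)\<^sup>2 = (cmod (\<zeta> x - \<zeta> y))\<^sup>2"
    unfolding dist_norm power2_norm_eq_inner[of "x - y"] cmod_power2 inner_expand[of "x - y" "x - y"]
    by (simp add: \<zeta>_def inner_diff_left power2_eq_square)
  then show ?thesis by (simp add: power2_eq_iff_nonneg)
qed

lemma \<zeta>_measurable [measurable]: "\<zeta> \<in> borel_measurable borel"
  unfolding \<zeta>_def Complex_eq by measurable

definition cz :: "real \<Rightarrow> real^2 \<Rightarrow> real^2 \<Rightarrow> complex" where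
  "cz \<epsilon> x y = (if \<epsilon> < dist x y then 1 / (\<zeta> x - \<zeta> y) else 0)"

lemma cz_measurable [measurable]: "(\<lambda>(x, y). cz \<epsilon> x y) \<in> borel_measurable (borel \<Otimes>\<^sub>M borel)"
  unfolding cz_def by measurable

lemma norm_cz_le: "0 < \<epsilon> \<Longrightarrow> cmod (cz \<epsilon> x y) \<le> 1 / \<epsilon>"
  by (auto simp: cz_def norm_divide dist_eq_cmod[symmetric] intro!: frac_le)

text \<open>The offset s is placed to the left of the set under consideration, so that the floor is
  nonnegative and \<open>nat\<close> loses nothing.\<close>

definition cell :: "real \<Rightarrow> real \<Rightarrow> real^2 \<Rightarrow> nat" where
  "cell s \<epsilon> x = nat \<lfloor>(x \<bullet> a - s) / \<epsilon>\<rfloor>"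

lemma cell_measurable [measurable]: "cell s \<epsilon> \<in> borel \<rightarrow>\<^sub>M count_space UNIV"
  unfolding cell_def by measurable

lemma cell_bounds:
  assumes "0 < \<epsilon>" "s \<le> x \<bullet> a"
  shows "s + real (cell s \<epsilon> x) * \<epsilon> \<le> x \<bullet> a" "x \<bullet> a < s + real (cell s \<epsilon> x) * \<epsilon> + \<epsilon>"
proof -
  let ?v = "(x \<bullet> a - s) / \<epsilon>"
  have "0 \<le> ?v" using assms by simp
  then have e: "real (cell s \<epsilon> x) = real_of_int \<lfloor>?v\<rfloor>" by (simp add: cell_def)
  have "real (cell s \<epsilon> x) \<le> ?v" "?v < real (cell s \<epsilon> x) + 1" unfolding e by linarith+
  then show "s + real (cell s \<epsilon> x) * \<epsilon> \<le> x \<bullet> a" "x \<bullet> a < s + real (cell s \<epsilon> x) * \<epsilon> + \<epsilon>"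
    using assms by (simp_all add: field_simps)
qed

lemma graph_dist_le:
  assumes "x \<in> graph" "y \<in> graph"
  shows "dist x y \<le> (1 + K) * \<bar>x \<bullet> a - y \<bullet> a\<bar>"
  using cmod_le[of "\<zeta> x - \<zeta> y"] f_lip[of "x \<bullet> a" "y \<bullet> a"] assms
  by (simp add: dist_eq_cmod \<zeta>_def graph_def algebra_simps)

text \<open>Dividing heights as well as abscissae by \<epsilon> rescales the graph to unit mesh
  without changing its Lipschitz constant, so one constant serves all truncation levels.\<close>

definition sample :: "real \<Rightarrow> real \<Rightarrow> nat \<Rightarrow> real" where
  "sample s \<epsilon> j = f (s + real j * \<epsilon>) / \<epsilon>"

lemma lattice: "0 < \<epsilon> \<Longrightarrow> lipschitz_lattice (sample s \<epsilon>) K"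
proof (unfold_locales, rule K_nonneg)
  fix j assume e: "0 < \<epsilon>"
  have "\<bar>f (s + real (Suc j) * \<epsilon>) - f (s + real j * \<epsilon>)\<bar> \<le> K * \<bar>(s + real (Suc j) * \<epsilon>) - (s + real j * \<epsilon>)\<bar>"
    by (rule f_lip)
  also have "\<dots> = K * \<epsilon>" using e by (simp add: algebra_simps)
  finally have "\<bar>f (s + real (Suc j) * \<epsilon>) - f (s + real j * \<epsilon>)\<bar> / \<epsilon> \<le> K"
    using e by (simp add: divide_le_eq)
  then show "\<bar>sample s \<epsilon> (Suc j) - sample s \<epsilon> j\<bar> \<le> K"
    using e by (simp add: sample_def diff_divide_distrib[symmetric])
qed

text \<open>The sign reconciles 1 / (\<zeta> x - \<zeta> y) with the opposite order of the indices
  in \<open>kern\<close>. The zero diagonal of \<open>kern\<close> is the counterpart of the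
  truncation: points of one cell do not interact.\<close>

definition step :: "real \<Rightarrow> real \<Rightarrow> real^2 \<Rightarrow> real^2 \<Rightarrow> complex" where
  "step s \<epsilon> x y = - lipschitz_lattice.kern (sample s \<epsilon>) (cell s \<epsilon> x) (cell s \<epsilon> y) / of_real \<epsilon>"

text \<open>Where both kernels are nonzero they are reciprocals of numbers at most 2 (1 + K)
  \<epsilon> apart, and d \<le> 2 (1 + K) \<epsilon> |i - j| completes the constant 4 (1 + K)^2.
  Where exactly one of them is zero, either d \<le> \<epsilon> with distinct cells, and the bound is
  1 / \<epsilon>, or \<epsilon> < d \<le> (1 + K) \<epsilon> within one cell, and 1 / d is written
  as d / d^2.\<close>

lemma step_approx:
  assumes e: "0 < \<epsilon>" and x: "x \<in> graph" "s \<le> x \<bullet> a" and y: "y \<in> graph" "s \<le> y \<bullet> a"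
  shows "cmod (cz \<epsilon> x y - step s \<epsilon> x y) \<le> 4 * (1 + K)\<^sup>2 * min (1 / \<epsilon>) (\<epsilon> / (dist x y)\<^sup>2)"
proof -
  interpret lipschitz_lattice "sample s \<epsilon>" K by (rule lattice[OF e])
  define i where "i = cell s \<epsilon> x"
  define j where "j = cell s \<epsilon> y"
  define d where "d = dist x y"
  let ?C = "4 * (1 + K)\<^sup>2"
  have K: "1 \<le> 1 + K" using K_nonneg by simp
  have C1: "1 \<le> ?C" and CK: "1 + K \<le> ?C" using K by (auto simp: power2_eq_square algebra_simps)
  have d0: "0 \<le> d" by (simp add: d_def)
  have near: "cmod (\<zeta> v - (of_real s + of_real \<epsilon> * z (cell s \<epsilon> v))) \<le> (1 + K) * \<epsilon>"
    if "v \<in> graph" "s \<le> v \<bullet> a" for v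
  proof -
    let ?t = "s + real (cell s \<epsilon> v) * \<epsilon>"
    have t: "\<bar>v \<bullet> a - ?t\<bar> \<le> \<epsilon>" using cell_bounds[OF e that(2)] by linarith
    have "cmod (\<zeta> v - (of_real s + of_real \<epsilon> * z (cell s \<epsilon> v))) \<le> \<bar>v \<bullet> a - ?t\<bar> + \<bar>f (v \<bullet> a) - f ?t\<bar>"
      using cmod_le[of "\<zeta> v - (of_real s + of_real \<epsilon> * z (cell s \<epsilon> v))"] that e
      by (simp add: \<zeta>_def graph_def sample_def mult.commute algebra_simps)
    also have "\<dots> \<le> \<bar>v \<bullet> a - ?t\<bar> + K * \<bar>v \<bullet> a - ?t\<bar>" using f_lip by (intro add_left_mono)
    also have "\<dots> = (1 + K) * \<bar>v \<bullet> a - ?t\<bar>" by (simp add: algebra_simps)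
    also have "\<dots> \<le> (1 + K) * \<epsilon>" using t K by (intro mult_left_mono) auto
    finally show ?thesis .
  qed
  have dle: "d \<le> (1 + K) * (\<epsilon> * (\<bar>real i - real j\<bar> + 1))"
  proof -
    have "\<bar>x \<bullet> a - y \<bullet> a\<bar> \<le> \<epsilon> * (\<bar>real i - real j\<bar> + 1)"
    proof -
      have "real i * \<epsilon> - real j * \<epsilon> \<le> \<bar>real i - real j\<bar> * \<epsilon>" "real j * \<epsilon> - real i * \<epsilon> \<le> \<bar>real i - real j\<bar> * \<epsilon>"
        using e by (simp_all add: left_diff_distrib[symmetric] mult_right_mono)
      then show ?thesis using cell_bounds[OF e x(2)] cell_bounds[OF e y(2)]
        unfolding i_def[symmetric] j_def[symmetric] distrib_left mult_1_right mult.commute[of \<epsilon> "\<bar>_\<bar>"] by linarith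
    qed
    then show ?thesis using graph_dist_le[OF x(1) y(1)] K unfolding d_def
      by (meson mult_left_mono order_trans zero_le_one)
  qed
  have stepv: "step s \<epsilon> x y = (if i = j then 0 else 1 / (of_real \<epsilon> * (z i - z j)))"
  proof -
    have "- (1 / (z j - z i)) = 1 / (z i - z j)" by (subst minus_divide_right) simp
    then have "- (1 / (z j - z i)) / of_real \<epsilon> = 1 / (of_real \<epsilon> * (z i - z j))"
      by (simp only: divide_divide_eq_left' mult.commute)
    then show ?thesis by (simp add: step_def kern_def i_def[symmetric] j_def[symmetric])
  qed
  have zij: "i \<noteq> j \<Longrightarrow> \<epsilon> * \<bar>real i - real j\<bar> \<le> cmod (of_real \<epsilon> * (z i - z j))"
    using norm_z_diff_ge[of i j] e by (simp add: norm_mult)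
  have ij1: "i \<noteq> j \<Longrightarrow> 1 \<le> \<bar>real i - real j\<bar>" by linarith
  consider "\<epsilon> < d" "i \<noteq> j" | "\<epsilon> < d" "i = j" | "d \<le> \<epsilon>" "i \<noteq> j" | "d \<le> \<epsilon>" "i = j" by linarith
  then show ?thesis
  proof cases
    case 1
    have czv: "cz \<epsilon> x y = 1 / (\<zeta> x - \<zeta> y)" using 1 by (simp add: cz_def d_def)
    have dz: "cmod (\<zeta> x - \<zeta> y) = d" by (simp add: d_def dist_eq_cmod)
    then have nz: "\<zeta> x - \<zeta> y \<noteq> 0" using 1 e by auto
    have nz2: "of_real \<epsilon> * (z i - z j) \<noteq> 0" using 1 e z_diff_nz[of i j] by simp
    let ?w = "of_real \<epsilon> * (z i - z j)"
    have "cz \<epsilon> x y - step s \<epsilon> x y = (?w - (\<zeta> x - \<zeta> y)) / ((\<zeta> x - \<zeta> y) * ?w)"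
      using 1 diff_frac_eq[OF nz nz2, of 1 1] by (simp only: czv stepv if_False mult_1_left)
    then have "cmod (cz \<epsilon> x y - step s \<epsilon> x y) = cmod (?w - (\<zeta> x - \<zeta> y)) / (d * cmod ?w)"
      by (simp only: norm_divide norm_mult[of "\<zeta> x - \<zeta> y"] dz)
    also have "\<dots> \<le> (2 * (1 + K) * \<epsilon>) / (d * (\<epsilon> * \<bar>real i - real j\<bar>))"
    proof (rule frac_le)
      have "?w - (\<zeta> x - \<zeta> y) = (\<zeta> y - (of_real s + of_real \<epsilon> * z j)) - (\<zeta> x - (of_real s + of_real \<epsilon> * z i))"
        by (simp add: algebra_simps)
      also have "cmod \<dots> \<le> (1 + K) * \<epsilon> + (1 + K) * \<epsilon>"
        unfolding i_def j_def by (intro order_trans[OF norm_triangle_ineq4] add_mono near x y)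
      finally show "cmod (?w - (\<zeta> x - \<zeta> y)) \<le> 2 * (1 + K) * \<epsilon>" by (simp add: algebra_simps)
      show "0 < d * (\<epsilon> * \<bar>real i - real j\<bar>)" using 1 e by simp
      show "d * (\<epsilon> * \<bar>real i - real j\<bar>) \<le> d * cmod ?w" using zij 1 d0 by (intro mult_left_mono) auto
    qed (use e K in auto)
    also have "\<dots> \<le> ?C * (\<epsilon> / d\<^sup>2)"
    proof -
      have "d \<le> (1 + K) * (\<epsilon> * (2 * \<bar>real i - real j\<bar>))"
        using dle ij1[OF 1(2)] e K by (elim order_trans) (intro mult_left_mono, auto)
      then have "(2 * (1 + K) * \<epsilon>) * d\<^sup>2 \<le> ?C * \<epsilon> * (d * (\<epsilon> * \<bar>real i - real j\<bar>))"
      proof -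
        assume h: "d \<le> (1 + K) * (\<epsilon> * (2 * \<bar>real i - real j\<bar>))"
        have "(2 * (1 + K) * \<epsilon> * d) * d \<le> (2 * (1 + K) * \<epsilon> * d) * ((1 + K) * (\<epsilon> * (2 * \<bar>real i - real j\<bar>)))"
          using h e d0 K by (intro mult_left_mono) auto
        also have "\<dots> = ?C * \<epsilon> * (d * (\<epsilon> * \<bar>real i - real j\<bar>))"
        proof -
          have "2 * k * \<epsilon> * d * (k * (\<epsilon> * (2 * r))) = 4 * k\<^sup>2 * \<epsilon> * (d * (\<epsilon> * r))" for k r
            by (simp add: power2_eq_square)
          then show ?thesis .
        qed
        finally show ?thesis by (simp only: power2_eq_square mult.assoc)
      qed
      moreover have "0 < d" using 1 e by simp
      ultimately show ?thesis using e ij1[OF 1(2)]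
        by (simp add: divide_le_eq le_divide_eq zero_less_mult_iff)
          (simp add: mult_ac)
    qed
    also have "\<epsilon> / d\<^sup>2 = min (1 / \<epsilon>) (\<epsilon> / d\<^sup>2)"
    proof -
      have "\<epsilon> * \<epsilon> \<le> d * d" using 1 e by (intro mult_mono) auto
      then show ?thesis using 1 e by (simp add: min_def field_simps power2_eq_square)
    qed
    finally show ?thesis by (simp add: d_def)
  next
    case 2
    have czv: "cz \<epsilon> x y - step s \<epsilon> x y = 1 / (\<zeta> x - \<zeta> y)" using 2 by (simp add: cz_def d_def stepv)
    have dz: "cmod (\<zeta> x - \<zeta> y) = d" by (simp add: d_def dist_eq_cmod)
    have d1: "0 < d" using 2 e by simp
    have "cmod (cz \<epsilon> x y - step s \<epsilon> x y) = d / d\<^sup>2"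
      unfolding czv norm_divide dz using d1 by (simp add: power2_eq_square)
    also have "\<dots> \<le> ((1 + K) * \<epsilon>) / d\<^sup>2" using dle 2 by (intro divide_right_mono) auto
    also have "\<dots> = (1 + K) * (\<epsilon> / d\<^sup>2)" by simp
    also have "\<dots> \<le> ?C * (\<epsilon> / d\<^sup>2)" using CK e by (intro mult_right_mono) auto
    also have "\<epsilon> / d\<^sup>2 = min (1 / \<epsilon>) (\<epsilon> / d\<^sup>2)"
    proof -
      have "\<epsilon> * \<epsilon> \<le> d * d" using 2 e by (intro mult_mono) auto
      then show ?thesis using d1 e by (simp add: min_def field_simps power2_eq_square)
    qed
    finally show ?thesis by (simp add: d_def)
  next
    case 3
    have "x \<noteq> y" using 3 by (auto simp: i_def j_def)
    then have d1: "0 < d" by (simp add: d_def)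
    have "cmod (cz \<epsilon> x y - step s \<epsilon> x y) = 1 / cmod (of_real \<epsilon> * (z i - z j))"
      using 3 by (simp add: cz_def d_def stepv norm_divide)
    also have "\<dots> \<le> 1 / (\<epsilon> * \<bar>real i - real j\<bar>)"
      using zij 3 e ij1 by (intro frac_le) auto
    also have "\<dots> \<le> 1 / (\<epsilon> * 1)" using 3 e ij1 by (intro frac_le mult_left_mono) auto
    also have "\<dots> = 1 * (1 / \<epsilon>)" by simp
    also have "\<dots> \<le> ?C * (1 / \<epsilon>)" using C1 e by (intro mult_right_mono) auto
    also have "1 / \<epsilon> = min (1 / \<epsilon>) (\<epsilon> / d\<^sup>2)"
    proof -
      have "d * d \<le> \<epsilon> * \<epsilon>" using 3 d0 by (intro mult_mono) auto
      then show ?thesis using d1 e by (simp add: min_def field_simps power2_eq_square)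
    qed
    finally show ?thesis by (simp add: d_def)
  next
    case 4
    then have "cz \<epsilon> x y - step s \<epsilon> x y = 0" by (simp add: cz_def d_def stepv)
    then show ?thesis using e K_nonneg by simp
  qed
qed

end

section \<open>Squared norms and the Cauchy integral on a graph\<close>

lemma cmod_square_add_le: "(cmod (u + v))\<^sup>2 \<le> 2 * (cmod u)\<^sup>2 + 2 * (cmod v)\<^sup>2"
proof -
  have "(cmod (u + v))\<^sup>2 \<le> (cmod u + cmod v)\<^sup>2" by (intro power_mono norm_triangle_ineq) simp
  also have "\<dots> \<le> 2 * (cmod u)\<^sup>2 + 2 * (cmod v)\<^sup>2"
    using sum_squares_bound[of "cmod u" "cmod v"] by (simp add: power2_sum)
  finally show ?thesis .
qed

text \<open>Valued in \<open>ennreal\<close>, so that estimates can be chained before finiteness is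
  known, and left squared, so that contributions of disjoint pieces add up.\<close>

definition sqn :: "'a measure \<Rightarrow> ('a \<Rightarrow> complex) \<Rightarrow> ennreal" where
  "sqn M \<phi> = (\<integral>\<^sup>+ x. ennreal ((cmod (\<phi> x))\<^sup>2) \<partial>M)"

lemma sqn_mono:
  assumes "\<And>x. x \<in> space M \<Longrightarrow> cmod (\<phi> x) \<le> cmod (\<psi> x)"
  shows "sqn M \<phi> \<le> sqn M \<psi>"
  unfolding sqn_def using assms by (intro nn_integral_mono ennreal_leI power_mono) auto

lemma sqn_add_le:
  assumes [measurable]: "\<phi> \<in> borel_measurable M" "\<psi> \<in> borel_measurable M"
  shows "sqn M (\<lambda>x. \<phi> x + \<psi> x) \<le> 2 * sqn M \<phi> + 2 * sqn M \<psi>"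
proof -
  have "sqn M (\<lambda>x. \<phi> x + \<psi> x) \<le> (\<integral>\<^sup>+ x. 2 * ennreal ((cmod (\<phi> x))\<^sup>2) + 2 * ennreal ((cmod (\<psi> x))\<^sup>2) \<partial>M)"
    unfolding sqn_def
  proof (rule nn_integral_mono)
    fix x
    have "ennreal ((cmod (\<phi> x + \<psi> x))\<^sup>2) \<le> ennreal (2 * (cmod (\<phi> x))\<^sup>2 + 2 * (cmod (\<psi> x))\<^sup>2)"
      by (intro ennreal_leI cmod_square_add_le)
    then show "ennreal ((cmod (\<phi> x + \<psi> x))\<^sup>2) \<le> 2 * ennreal ((cmod (\<phi> x))\<^sup>2) + 2 * ennreal ((cmod (\<psi> x))\<^sup>2)"
      by (simp add: ennreal_plus ennreal_mult)
  qed
  also have "\<dots> = 2 * sqn M \<phi> + 2 * sqn M \<psi>"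
    unfolding sqn_def by (subst nn_integral_add) (auto simp: nn_integral_cmult)
  finally show ?thesis .
qed

lemma sqn_cmult:
  assumes [measurable]: "\<phi> \<in> borel_measurable M"
  shows "sqn M (\<lambda>x. k * \<phi> x) = ennreal ((cmod k)\<^sup>2) * sqn M \<phi>"
  unfolding sqn_def by (simp add: norm_mult power_mult_distrib ennreal_mult nn_integral_cmult)

lemma integrable_if_sqn:
  assumes "finite_measure M" and [measurable]: "\<phi> \<in> borel_measurable M" and fin: "sqn M \<phi> < \<infinity>"
  shows "integrable M \<phi>"
proof -
  interpret finite_measure M by fact
  have "integrable M (\<lambda>x. (cmod (\<phi> x))\<^sup>2)"
    using fin by (intro integrableI_bounded) (auto simp: sqn_def)
  then have "integrable M (\<lambda>x. 1 + (cmod (\<phi> x))\<^sup>2)" by auto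
  then show ?thesis
  proof (rule Bochner_Integration.integrable_bound)
    have "t \<le> 1 + t\<^sup>2" if "0 \<le> t" for t :: real
      using zero_le_power2[of "t - 1/2"] zero_le_power2[of t] by (simp add: power2_diff power_divide)
    then show "AE x in M. norm (\<phi> x) \<le> norm (1 + (cmod (\<phi> x))\<^sup>2)" by (auto simp: abs_of_nonneg add_nonneg_nonneg)
  qed measurable
qed

context growth_measure
begin

lemma integrable_bounded_mult:
  fixes \<phi> h :: "real^2 \<Rightarrow> complex"
  assumes \<phi>: "integrable N \<phi>" and h: "h \<in> borel_measurable borel" and le: "\<And>y. cmod (h y) \<le> D"
  shows "integrable N (\<lambda>y. h y * \<phi> y)"
proof (rule Bochner_Integration.integrable_bound[OF integrable_mult_right[OF integrable_norm[OF \<phi>]]])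
  show "AE y in N. norm (h y * \<phi> y) \<le> norm (D * norm (\<phi> y))"
    using le by (auto simp: norm_mult abs_mult intro!: mult_right_mono order_trans[OF _ abs_ge_self])
qed (use h borel_measurable_integrable[OF \<phi>] in measurable)

lemma cell_sum_bound:
  assumes \<phi> [measurable]: "\<phi> \<in> borel_measurable borel" and U [measurable]: "U \<in> sets borel"
    and sub: "U \<subseteq> cball x r" and r: "0 < r"
  shows "ennreal ((cmod (\<integral>y. indicator U y *\<^sub>R \<phi> y \<partial>N))\<^sup>2) \<le> ennreal (c * r) * (\<integral>\<^sup>+ y. indicator U y * ennreal ((cmod (\<phi> y))\<^sup>2) \<partial>N)"
proof -
  \<comment> \<open>The indicator is written twice so that Cauchy-Schwarz yields the mass of U from
    one copy and the energy of \<phi> on U from the other. A non-integrable integrand has integral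
    0, and then the bound is trivial.\<close>
  have "ennreal (cmod (\<integral>y. indicator U y *\<^sub>R \<phi> y \<partial>N)) \<le> (\<integral>\<^sup>+ y. indicator U y * (indicator U y * ennreal (cmod (\<phi> y))) \<partial>N)"
  proof (cases "integrable N (\<lambda>y. indicator U y *\<^sub>R \<phi> y)")
    case True
    have "ennreal (cmod (\<integral>y. indicator U y *\<^sub>R \<phi> y \<partial>N)) \<le> (\<integral>\<^sup>+ y. ennreal (cmod (indicator U y *\<^sub>R \<phi> y)) \<partial>N)"
      by (rule integral_norm_bound_ennreal[OF True])
    also have "\<dots> = (\<integral>\<^sup>+ y. indicator U y * (indicator U y * ennreal (cmod (\<phi> y))) \<partial>N)"
      by (intro nn_integral_cong) (auto split: split_indicator)
    finally show ?thesis .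
  next
    case False
    then show ?thesis by (simp add: not_integrable_integral_eq)
  qed
  then have "(ennreal (cmod (\<integral>y. indicator U y *\<^sub>R \<phi> y \<partial>N)))\<^sup>2 \<le> (\<integral>\<^sup>+ y. indicator U y * (indicator U y * ennreal (cmod (\<phi> y))) \<partial>N)\<^sup>2"
    by (rule power_mono) simp
  also have "\<dots> \<le> (\<integral>\<^sup>+ y. (indicator U y)\<^sup>2 \<partial>N) * (\<integral>\<^sup>+ y. (indicator U y * ennreal (cmod (\<phi> y)))\<^sup>2 \<partial>N)"
    by (rule Cauchy_Schwarz_nn_integral) measurable
  also have "(\<integral>\<^sup>+ y. (indicator U y)\<^sup>2 \<partial>N) = emeasure N U"
  proof -
    have "(\<lambda>y. (indicator U y :: ennreal)\<^sup>2) = indicator U" by (auto split: split_indicator)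
    then show ?thesis by simp
  qed
  also have "(\<integral>\<^sup>+ y. (indicator U y * ennreal (cmod (\<phi> y)))\<^sup>2 \<partial>N) = (\<integral>\<^sup>+ y. indicator U y * ennreal ((cmod (\<phi> y))\<^sup>2) \<partial>N)"
    by (intro nn_integral_cong) (auto split: split_indicator simp: ennreal_power)
  also have "emeasure N U * (\<integral>\<^sup>+ y. indicator U y * ennreal ((cmod (\<phi> y))\<^sup>2) \<partial>N) \<le> ennreal (c * r) * (\<integral>\<^sup>+ y. indicator U y * ennreal ((cmod (\<phi> y))\<^sup>2) \<partial>N)"
  proof (intro mult_right_mono)
    have "emeasure N U \<le> emeasure N (cball x r)" by (rule emeasure_mono[OF sub]) simp
    then show "emeasure N U \<le> ennreal (c * r)" using growth[OF r, of x] by simp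
  qed simp
  finally show ?thesis by (simp add: ennreal_power)
qed

lemma kernel_sqn_le:
  fixes k :: "real^2 \<Rightarrow> real^2 \<Rightarrow> complex" and p :: "real^2 \<Rightarrow> real^2 \<Rightarrow> real"
  assumes k [measurable]: "(\<lambda>(x, y). k x y) \<in> borel_measurable (borel \<Otimes>\<^sub>M borel)"
    and p [measurable]: "(\<lambda>(x, y). p x y) \<in> borel_measurable (borel \<Otimes>\<^sub>M borel)"
    and le: "\<And>x y. cmod (k x y) \<le> p x y"
    and row: "\<And>x. (\<integral>\<^sup>+ y. ennreal (p x y) \<partial>N) \<le> X"
    and col: "\<And>y. (\<integral>\<^sup>+ x. ennreal (p x y) \<partial>N) \<le> X"
    and \<phi> [measurable]: "\<phi> \<in> borel_measurable borel"
  shows "sqn N (\<lambda>x. \<integral>y. k x y * \<phi> y \<partial>N) \<le> X * X * sqn N \<phi>"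
proof -
  have p0: "0 \<le> p x y" for x y using le[of x y] norm_ge_zero order_trans by blast
  have "sqn N (\<lambda>x. \<integral>y. k x y * \<phi> y \<partial>N) \<le> (\<integral>\<^sup>+ x. (\<integral>\<^sup>+ y. ennreal (p x y) * ennreal (cmod (\<phi> y)) \<partial>N)\<^sup>2 \<partial>N)"
    unfolding sqn_def
  proof (rule nn_integral_mono)
    fix x
    have "ennreal (cmod (\<integral>y. k x y * \<phi> y \<partial>N)) \<le> (\<integral>\<^sup>+ y. ennreal (cmod (k x y * \<phi> y)) \<partial>N)"
      by (cases "integrable N (\<lambda>y. k x y * \<phi> y)") (auto intro: integral_norm_bound_ennreal simp: not_integrable_integral_eq)
    also have "\<dots> \<le> (\<integral>\<^sup>+ y. ennreal (p x y) * ennreal (cmod (\<phi> y)) \<partial>N)"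
      using le p0 by (intro nn_integral_mono) (auto simp: norm_mult ennreal_mult[symmetric] intro!: ennreal_leI mult_right_mono)
    finally have "(ennreal (cmod (\<integral>y. k x y * \<phi> y \<partial>N)))\<^sup>2 \<le> (\<integral>\<^sup>+ y. ennreal (p x y) * ennreal (cmod (\<phi> y)) \<partial>N)\<^sup>2"
      by (rule power_mono) simp
    then show "ennreal ((cmod (\<integral>y. k x y * \<phi> y \<partial>N))\<^sup>2) \<le> (\<integral>\<^sup>+ y. ennreal (p x y) * ennreal (cmod (\<phi> y)) \<partial>N)\<^sup>2"
      by (simp add: ennreal_power)
  qed
  also have "\<dots> \<le> X * X * (\<integral>\<^sup>+ y. (ennreal (cmod (\<phi> y)))\<^sup>2 \<partial>N)"
    by (rule nn_Schur) (use row col p0 in \<open>auto intro!: sigma_finite_measure_axioms\<close>)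
  also have "(\<integral>\<^sup>+ y. (ennreal (cmod (\<phi> y)))\<^sup>2 \<partial>N) = sqn N \<phi>"
    by (simp add: sqn_def ennreal_power)
  finally show ?thesis .
qed

end

locale growth_graph = growth_measure N c + lipschitz_frame a b f K
  for N :: "(real^2) measure" and c a b f K
begin

text \<open>The summands belong to the step kernel and to the error kernel. Here 32 = 4 * 8 combines
  the constants of \<open>step_approx\<close> and \<open>pois_integral_le\<close>, and the outer
  factors 2 come from \<open>sqn_add_le\<close>.\<close>

definition graph_const :: real where
  "graph_const = 2 * (c * (1 + K) * lipschitz_lattice.hilbert_const K)\<^sup>2 + 2 * (32 * c * (1 + K)\<^sup>2)\<^sup>2"

text \<open>On the step kernel the operator factors through the cell integrals w j. Forming them
  costs the mass c (1 + K) \<epsilon> of a cell, spreading the result over the cells costs it once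
  more, and the rescaled matrix has \<epsilon>^2 in the denominator of its squared norm, so no power
  of \<epsilon> survives. The error kernel falls under Schur's test with
  \<open>pois\<close>.\<close>

theorem truncated_Cauchy_graph:
  assumes e: "0 < \<epsilon>" and P [measurable]: "P \<in> sets borel" and sub: "P \<subseteq> graph" and bdd: "bounded P"
    and \<phi> [measurable]: "\<phi> \<in> borel_measurable borel" and fin: "sqn N \<phi> < \<infinity>"
  shows "sqn N (\<lambda>x. indicator P x * (\<integral>y. cz \<epsilon> x y * (indicator P y * \<phi> y) \<partial>N)) \<le> ennreal graph_const * sqn N \<phi>"
proof -
  obtain B where B: "\<And>x. x \<in> P \<Longrightarrow> norm x \<le> B" using bdd by (auto simp: bounded_iff)
  define s where "s = - B"
  have abs_a: "\<bar>x \<bullet> a\<bar> \<le> B" if "x \<in> P" for x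
    using Cauchy_Schwarz_ineq2[of x a] B[OF that] norm_a by simp
  then have s: "s \<le> x \<bullet> a" if "x \<in> P" for x using that by (force simp: s_def)
  interpret lat: lipschitz_lattice "sample s \<epsilon>" K by (rule lattice[OF e])
  let ?H = "lipschitz_lattice.hilbert_const K"
  \<comment> \<open>The number of cells is a power of two, as the dyadic bound requires; P has
    horizontal extent at most 2 B.\<close>
  obtain n :: nat where n: "2 * B / \<epsilon> < 2 ^ n" using real_arch_pow[of 2 "2 * B / \<epsilon>"] by auto
  let ?J = "2 ^ n :: nat"
  have cell_less: "cell s \<epsilon> x < ?J" if "x \<in> P" for x
  proof -
    have "real (cell s \<epsilon> x) * \<epsilon> \<le> x \<bullet> a - s" using cell_bounds(1)[OF e s[OF that]] by simp
    also have "\<dots> \<le> 2 * B" using abs_a[OF that] by (simp add: s_def)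
    finally have "real (cell s \<epsilon> x) \<le> 2 * B / \<epsilon>" using e by (simp add: le_divide_eq)
    also have "\<dots> < real ?J" using n by simp
    finally show ?thesis by (simp only: of_nat_less_iff)
  qed
  define C where "C i = {x\<in>P. cell s \<epsilon> x = i}" for i
  have C [measurable]: "C i \<in> sets borel" for i
  proof -
    have "C i = P \<inter> (cell s \<epsilon> -` {i} \<inter> space borel)" by (auto simp: C_def)
    also have "\<dots> \<in> sets borel" by measurable
    finally show ?thesis .
  qed
  let ?r = "(1 + K) * \<epsilon>"
  have r: "0 < ?r" using e K_nonneg by simp
  have C_ball: "\<exists>x. C i \<subseteq> cball x ?r" for i
  proof (cases "C i = {}")
    case False
    then obtain x where x: "x \<in> C i" by auto
    have "dist x y \<le> ?r" if y: "y \<in> C i" for y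
    proof -
      have "\<bar>x \<bullet> a - y \<bullet> a\<bar> \<le> \<epsilon>"
        using x y s[of x] s[of y] cell_bounds[OF e, of s x] cell_bounds[OF e, of s y] by (simp add: C_def)
      then have "(1 + K) * \<bar>x \<bullet> a - y \<bullet> a\<bar> \<le> ?r" using K_nonneg by (intro mult_left_mono) auto
      moreover have "dist x y \<le> (1 + K) * \<bar>x \<bullet> a - y \<bullet> a\<bar>"
        using x y sub by (intro graph_dist_le) (auto simp: C_def)
      ultimately show ?thesis by linarith
    qed
    then show ?thesis by (auto intro!: exI[of _ x])
  qed auto
  have int\<phi>: "integrable N \<phi>" by (rule integrable_if_sqn[OF finite_measure_axioms _ fin]) measurable
  define w where "w j = (\<integral>y. indicator (C j) y *\<^sub>R \<phi> y \<partial>N)" for j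
  define V where "V i = - (\<Sum>j<?J. w j * lat.kern i j) / of_real \<epsilon>" for i
  have w_le: "ennreal ((cmod (w j))\<^sup>2) \<le> ennreal (c * ?r) * (\<integral>\<^sup>+ y. indicator (C j) y * ennreal ((cmod (\<phi> y))\<^sup>2) \<partial>N)" for j
    using C_ball[of j] unfolding w_def by (auto intro!: cell_sum_bound[OF _ _ _ r] simp del: mult_pos_pos)
  have part: "(\<Sum>j<?J. indicator (C j) y) = (indicator P y :: ennreal)" for y
  proof (cases "y \<in> P")
    case True
    then have "(\<Sum>j<?J. indicator (C j) y :: ennreal) = (\<Sum>j<?J. if j = cell s \<epsilon> y then 1 else 0)"
      by (intro sum.cong refl) (auto simp: C_def split: split_indicator)
    also have "\<dots> = 1" using cell_less[OF True] by (subst sum.delta) auto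
    finally show ?thesis using True by simp
  qed (auto simp: C_def intro!: sum.neutral split: split_indicator)
  have sum_w: "ennreal (\<Sum>j<?J. (cmod (w j))\<^sup>2) \<le> ennreal (c * ?r) * sqn N \<phi>"
  proof -
    have "ennreal (\<Sum>j<?J. (cmod (w j))\<^sup>2) = (\<Sum>j<?J. ennreal ((cmod (w j))\<^sup>2))"
      by (rule sum_ennreal[symmetric]) auto
    also have "\<dots> \<le> (\<Sum>j<?J. ennreal (c * ?r) * (\<integral>\<^sup>+ y. indicator (C j) y * ennreal ((cmod (\<phi> y))\<^sup>2) \<partial>N))"
      by (intro sum_mono w_le)
    also have "\<dots> = ennreal (c * ?r) * (\<integral>\<^sup>+ y. (\<Sum>j<?J. indicator (C j) y * ennreal ((cmod (\<phi> y))\<^sup>2)) \<partial>N)"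
      by (subst nn_integral_sum) (auto simp: sum_distrib_left)
    also have "(\<integral>\<^sup>+ y. (\<Sum>j<?J. indicator (C j) y * ennreal ((cmod (\<phi> y))\<^sup>2)) \<partial>N) \<le> sqn N \<phi>"
      unfolding sqn_def sum_distrib_right[symmetric] part
      by (intro nn_integral_mono) (auto split: split_indicator)
    finally show ?thesis by (simp add: mult_left_mono)
  qed
  have V_sum: "(\<Sum>i<?J. (cmod (V i))\<^sup>2) \<le> ?H\<^sup>2 / \<epsilon>\<^sup>2 * (\<Sum>j<?J. (cmod (w j))\<^sup>2)"
  proof -
    have "(\<Sum>i<?J. (cmod (V i))\<^sup>2) = (\<Sum>i<?J. (cmod (\<Sum>j<?J. w j * lat.kern i j))\<^sup>2) / \<epsilon>\<^sup>2"
      using e unfolding V_def norm_divide norm_minus_cancel power_divide sum_divide_distrib[symmetric] by simp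
    also have "\<dots> \<le> (?H\<^sup>2 * (\<Sum>j<?J. (cmod (w j))\<^sup>2)) / \<epsilon>\<^sup>2"
      by (intro divide_right_mono lat.discrete_Cauchy_operator_bound) auto
    finally show ?thesis by simp
  qed
  define St where "St x = (\<Sum>i<?J. indicator (C i) x * V i)" for x
  have St_meas [measurable]: "St \<in> borel_measurable borel" unfolding St_def by measurable
  have St_val: "St x = V (cell s \<epsilon> x)" if "x \<in> P" for x
  proof -
    have "St x = (\<Sum>i<?J. if i = cell s \<epsilon> x then V i else 0)"
      unfolding St_def using that by (intro sum.cong refl) (auto simp: C_def split: split_indicator)
    then show ?thesis using cell_less[OF that] by simp
  qed
  have St_bound: "sqn N St \<le> ennreal ((c * (1 + K) * ?H)\<^sup>2) * sqn N \<phi>"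
  proof -
    have "sqn N St \<le> (\<integral>\<^sup>+ x. (\<Sum>i<?J. ennreal ((cmod (V i))\<^sup>2) * indicator (C i) x) \<partial>N)"
      unfolding sqn_def
    proof (rule nn_integral_mono)
      fix x
      show "ennreal ((cmod (St x))\<^sup>2) \<le> (\<Sum>i<?J. ennreal ((cmod (V i))\<^sup>2) * indicator (C i) x)"
      proof (cases "x \<in> P")
        case True
        have "ennreal ((cmod (St x))\<^sup>2) = ennreal ((cmod (V (cell s \<epsilon> x)))\<^sup>2) * indicator (C (cell s \<epsilon> x)) x"
          using True St_val[OF True] by (simp add: C_def)
        also have "\<dots> \<le> (\<Sum>i<?J. ennreal ((cmod (V i))\<^sup>2) * indicator (C i) x)"
          using cell_less[OF True] by (intro member_le_sum) auto
        finally show ?thesis .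
      next
        case False
        then have "St x = 0" by (auto simp: St_def C_def intro!: sum.neutral)
        then show ?thesis by simp
      qed
    qed
    also have "\<dots> = (\<Sum>i<?J. ennreal ((cmod (V i))\<^sup>2) * emeasure N (C i))"
      by (subst nn_integral_sum) (auto simp: nn_integral_cmult)
    also have "\<dots> \<le> (\<Sum>i<?J. ennreal ((cmod (V i))\<^sup>2) * ennreal (c * ?r))"
    proof (intro sum_mono mult_left_mono)
      fix i
      obtain x where "C i \<subseteq> cball x ?r" using C_ball by blast
      then have "emeasure N (C i) \<le> emeasure N (cball x ?r)" by (rule emeasure_mono) simp
      then show "emeasure N (C i) \<le> ennreal (c * ?r)" using growth[OF r, of x] by simp
    qed simp
    also have "\<dots> = ennreal (c * ?r * (\<Sum>i<?J. (cmod (V i))\<^sup>2))"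
      unfolding sum_distrib_right[symmetric] using c_nonneg r
      by (subst sum_ennreal) (auto simp: ennreal_mult[symmetric] sum_nonneg mult.commute)
    also have "\<dots> \<le> ennreal ((c * ?r * (?H\<^sup>2 / \<epsilon>\<^sup>2)) * (\<Sum>j<?J. (cmod (w j))\<^sup>2))"
      unfolding mult.assoc[of "c * ?r"] using V_sum c_nonneg r by (intro ennreal_leI mult_left_mono) auto
    also have "\<dots> = ennreal (c * ?r * (?H\<^sup>2 / \<epsilon>\<^sup>2)) * ennreal (\<Sum>j<?J. (cmod (w j))\<^sup>2)"
      using c_nonneg r by (intro ennreal_mult) (auto intro!: sum_nonneg)
    also have "\<dots> \<le> ennreal (c * ?r * (?H\<^sup>2 / \<epsilon>\<^sup>2)) * (ennreal (c * ?r) * sqn N \<phi>)"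
      by (intro mult_left_mono sum_w) simp
    also have "\<dots> = ennreal ((c * ?r * (?H\<^sup>2 / \<epsilon>\<^sup>2)) * (c * ?r)) * sqn N \<phi>"
    proof -
      have 1: "0 \<le> c * ?r" by (rule mult_nonneg_nonneg[OF c_nonneg less_imp_le[OF r]])
      then have 2: "0 \<le> c * ?r * (?H\<^sup>2 / \<epsilon>\<^sup>2)" by (intro mult_nonneg_nonneg[OF 1]) simp
      show ?thesis unfolding ennreal_mult[OF 2 1] by (simp only: mult.assoc)
    qed
    also have "(c * ?r * (?H\<^sup>2 / \<epsilon>\<^sup>2)) * (c * ?r) = (c * (1 + K) * ?H)\<^sup>2"
      using e by (simp add: power2_eq_square)
    finally show ?thesis .
  qed
  let ?p = "\<lambda>x y. 4 * (1 + K)\<^sup>2 * pois \<epsilon> x y"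
  let ?k = "\<lambda>x y. indicator P x * indicator P y * (cz \<epsilon> x y - step s \<epsilon> x y)"
  have step_meas [measurable]: "(\<lambda>(x, y). step s \<epsilon> x y) \<in> borel_measurable (borel \<Otimes>\<^sub>M borel)"
  proof -
    have "(\<lambda>(x, y). lat.kern (cell s \<epsilon> x) (cell s \<epsilon> y)) \<in> borel_measurable (borel \<Otimes>\<^sub>M borel)"
      unfolding split_beta by measurable
    then show ?thesis unfolding step_def split_beta by measurable
  qed
  define Er where "Er x = (\<integral>y. ?k x y * \<phi> y \<partial>N)" for x
  have Er_meas [measurable]: "Er \<in> borel_measurable borel"
    unfolding Er_def by measurable
  have Er_bound: "sqn N Er \<le> ennreal ((32 * c * (1 + K)\<^sup>2)\<^sup>2) * sqn N \<phi>"
  proof -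
    have row: "(\<integral>\<^sup>+ y. ennreal (?p x y) \<partial>N) \<le> ennreal (32 * c * (1 + K)\<^sup>2)" for x
    proof -
      have "(\<integral>\<^sup>+ y. ennreal (?p x y) \<partial>N) = ennreal (4 * (1 + K)\<^sup>2) * (\<integral>\<^sup>+ y. ennreal (pois \<epsilon> x y) \<partial>N)"
        using pois_nonneg[OF e] by (subst nn_integral_cmult[symmetric]) (auto simp: ennreal_mult)
      also have "\<dots> \<le> ennreal (4 * (1 + K)\<^sup>2) * ennreal (8 * c)"
        by (intro mult_left_mono pois_integral_le[OF e]) simp
      also have "\<dots> = ennreal (32 * c * (1 + K)\<^sup>2)"
        using c_nonneg by (simp add: ennreal_mult[symmetric] mult_ac)
      finally show ?thesis .
    qed
    have "sqn N Er \<le> ennreal (32 * c * (1 + K)\<^sup>2) * ennreal (32 * c * (1 + K)\<^sup>2) * sqn N \<phi>"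
      unfolding Er_def
    proof (rule kernel_sqn_le)
      fix x y
      show "cmod (?k x y) \<le> ?p x y"
      proof (cases "x \<in> P \<and> y \<in> P")
        case True
        then show ?thesis using step_approx[OF e, of x s y] sub s[of x] s[of y] by (auto simp: pois_def)
      qed (use pois_nonneg[OF e] in \<open>auto simp: indicator_def\<close>)
      show "(\<integral>\<^sup>+ y. ennreal (?p x y) \<partial>N) \<le> ennreal (32 * c * (1 + K)\<^sup>2)" by (rule row)
      show "(\<integral>\<^sup>+ x. ennreal (?p x y) \<partial>N) \<le> ennreal (32 * c * (1 + K)\<^sup>2)"
        using row[of y] by (simp add: pois_commute)
    qed measurable
    then show ?thesis using c_nonneg by (simp add: ennreal_mult[symmetric] power2_eq_square)
  qed
  have split: "indicator P x * (\<integral>y. cz \<epsilon> x y * (indicator P y * \<phi> y) \<partial>N) = St x + Er x" for x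
  proof (cases "x \<in> P")
    case False
    then have "St x = 0" by (auto simp: St_def C_def intro!: sum.neutral)
    then show ?thesis using False by (simp add: Er_def)
  next
    case True
    have "St x = (\<integral>y. (indicator P y * step s \<epsilon> x y) * \<phi> y \<partial>N)"
    proof -
      have "(\<integral>y. (indicator P y * step s \<epsilon> x y) * \<phi> y \<partial>N)
        = (\<integral>y. (\<Sum>j<?J. (- lat.kern (cell s \<epsilon> x) j / of_real \<epsilon>) * (indicator (C j) y *\<^sub>R \<phi> y)) \<partial>N)"
      proof (rule Bochner_Integration.integral_cong[OF refl])
        fix y
        show "(indicator P y * step s \<epsilon> x y) * \<phi> y = (\<Sum>j<?J. (- lat.kern (cell s \<epsilon> x) j / of_real \<epsilon>) * (indicator (C j) y *\<^sub>R \<phi> y))"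
        proof (cases "y \<in> P")
          case y: True
          have "(\<Sum>j<?J. (- lat.kern (cell s \<epsilon> x) j / of_real \<epsilon>) * (indicator (C j) y *\<^sub>R \<phi> y))
             = (\<Sum>j<?J. if j = cell s \<epsilon> y then (- lat.kern (cell s \<epsilon> x) j / of_real \<epsilon>) * \<phi> y else 0)"
            using y by (intro sum.cong refl) (auto simp: C_def split: split_indicator)
          also have "\<dots> = step s \<epsilon> x y * \<phi> y" using cell_less[OF y] by (simp add: step_def)
          finally show ?thesis using y by simp
        qed (auto simp: C_def intro!: sum.neutral)
      qed
      also have "\<dots> = (\<Sum>j<?J. (- lat.kern (cell s \<epsilon> x) j / of_real \<epsilon>) * w j)"
        unfolding w_def
        by (subst Bochner_Integration.integral_sum)
          (intro integrable_mult_right integrable_mult_indicator int\<phi>, simp,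
           intro sum.cong refl integral_mult_right_zero)
      also have "\<dots> = V (cell s \<epsilon> x)"
        by (simp add: V_def sum_divide_distrib sum_negf mult.commute)
      finally show ?thesis using St_val[OF True] by simp
    qed
    moreover have "Er x = (\<integral>y. (indicator P y * cz \<epsilon> x y) * \<phi> y \<partial>N) - (\<integral>y. (indicator P y * step s \<epsilon> x y) * \<phi> y \<partial>N)"
    proof -
      have i1: "integrable N (\<lambda>y. (indicator P y * cz \<epsilon> x y) * \<phi> y)"
        by (rule integrable_bounded_mult[OF int\<phi>, where D = "1 / \<epsilon>"]) (use norm_cz_le[OF e] e in \<open>auto simp: norm_mult indicator_def\<close>)
      have i2: "integrable N (\<lambda>y. (indicator P y * step s \<epsilon> x y) * \<phi> y)"
      proof (rule integrable_bounded_mult[OF int\<phi>, where D = "1 / \<epsilon>"])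
        fix y
        have "cmod (lat.kern i j) \<le> 1" for i j
        proof (cases "i = j")
          case False
          then have "1 \<le> \<bar>real j - real i\<bar>" by linarith
          then have "1 \<le> cmod (lat.z j - lat.z i)" using lat.norm_z_diff_ge[of j i] by linarith
          then show ?thesis using False by (simp add: lat.kern_def norm_divide divide_le_eq)
        qed (simp add: lat.kern_def)
        then show "cmod (indicator P y * step s \<epsilon> x y) \<le> 1 / \<epsilon>"
          using e by (auto simp: step_def norm_mult norm_divide indicator_def intro!: divide_right_mono)
      qed measurable
      show ?thesis unfolding Er_def using True
        by (subst Bochner_Integration.integral_diff[OF i1 i2, symmetric]) (simp add: algebra_simps)
    qed
    ultimately show ?thesis using True by (simp add: mult_ac)
  qed
  have "sqn N (\<lambda>x. St x + Er x) \<le> 2 * sqn N St + 2 * sqn N Er"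
    by (rule sqn_add_le) measurable
  also have "\<dots> \<le> 2 * (ennreal ((c * (1 + K) * ?H)\<^sup>2) * sqn N \<phi>) + 2 * (ennreal ((32 * c * (1 + K)\<^sup>2)\<^sup>2) * sqn N \<phi>)"
    by (intro add_mono mult_left_mono St_bound Er_bound) auto
  also have "\<dots> = ennreal graph_const * sqn N \<phi>"
    unfolding graph_const_def by (simp add: ennreal_plus ennreal_mult distrib_right mult.assoc)
  finally show ?thesis by (simp only: split)
qed

end

section \<open>The dipole kernel as the real part of a Cauchy kernel\<close>

lemma borel_measurable_cnj [measurable (raw)]:
  "f \<in> borel_measurable M \<Longrightarrow> (\<lambda>x. cnj (f x)) \<in> borel_measurable M"
  by (rule measurable_compose[OF _ borel_measurable_continuous_onI[OF continuous_on_cnj[OF continuous_on_id]]])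

lemma ennreal_lincomb:
  assumes "0 \<le> u" "0 \<le> v"
  shows "2 * (ennreal u * X) + 2 * (ennreal v * X) = ennreal (2 * u + 2 * v) * X"
proof -
  have "ennreal (2 * u + 2 * v) = 2 * ennreal u + 2 * ennreal v"
    using assms by (simp add: ennreal_plus ennreal_mult)
  then show ?thesis by (simp only: distrib_right mult.assoc)
qed

lemma sqn_cnj: "sqn M (\<lambda>x. cnj (\<phi> x)) = sqn M \<phi>"
  by (simp add: sqn_def)

lemma sqn_mult_bounded:
  assumes [measurable]: "\<phi> \<in> borel_measurable M" and B: "0 \<le> B" "\<And>x. cmod (h x) \<le> B"
  shows "sqn M (\<lambda>x. h x * \<phi> x) \<le> ennreal (B\<^sup>2) * sqn M \<phi>"
proof -
  have "sqn M (\<lambda>x. h x * \<phi> x) \<le> sqn M (\<lambda>x. of_real B * \<phi> x)"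
    using B by (intro sqn_mono) (auto simp: norm_mult intro!: mult_right_mono)
  also have "\<dots> = ennreal (B\<^sup>2) * sqn M \<phi>" by (subst sqn_cmult) (auto simp: B)
  finally show ?thesis .
qed

text \<open>Up to the factor 1 / (2 \<pi>), the truncated normal derivative of the fundamental
  solution of the Laplace equation.\<close>

definition dipole :: "(real^2 \<Rightarrow> real^2) \<Rightarrow> real \<Rightarrow> real^2 \<Rightarrow> real^2 \<Rightarrow> real" where
  "dipole n \<epsilon> x y = (if \<epsilon> < dist x y then ((x - y) \<bullet> n y) / (dist x y)\<^sup>2 else 0)"

lemma dipole_measurable [measurable]:
  assumes [measurable]: "n \<in> borel_measurable borel"
  shows "(\<lambda>(x, y). dipole n \<epsilon> x y) \<in> borel_measurable (borel \<Otimes>\<^sub>M borel)"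
  unfolding dipole_def by measurable

lemma dipole_le:
  assumes "0 < \<rho>" "\<rho> \<le> dist x y" "norm (n y) \<le> B"
  shows "\<bar>dipole n \<epsilon> x y\<bar> \<le> B / \<rho>"
proof -
  have d: "0 < dist x y" using assms by linarith
  have B: "0 \<le> B" using assms(3) norm_ge_zero order_trans by blast
  have "\<bar>dipole n \<epsilon> x y\<bar> \<le> \<bar>(x - y) \<bullet> n y\<bar> / (dist x y)\<^sup>2"
    by (simp add: dipole_def)
  also have "\<dots> \<le> (dist x y * B) / (dist x y)\<^sup>2"
    using Cauchy_Schwarz_ineq2[of "x - y" "n y"] mult_left_mono[OF assms(3), of "dist x y"]
    by (intro divide_right_mono) (auto simp: dist_norm)
  also have "\<dots> = B / dist x y" using d by (simp add: power2_eq_square)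
  also have "\<dots> \<le> B / \<rho>" using assms B d by (intro divide_left_mono mult_pos_pos) auto
  finally show ?thesis .
qed

lemma dipole_le_inverse:
  assumes "0 < \<epsilon>" "norm (n y) \<le> B"
  shows "\<bar>dipole n \<epsilon> x y\<bar> \<le> B / \<epsilon>"
proof (cases "\<epsilon> < dist x y")
  case True
  then show ?thesis using assms by (intro dipole_le) auto
next
  case False
  have "0 \<le> B" using assms(2) norm_ge_zero order_trans by blast
  then show ?thesis using False assms by (simp add: dipole_def)
qed

context growth_graph
begin

lemma dipole_eq: "complex_of_real (dipole n \<epsilon> x y) = (cz \<epsilon> x y * \<zeta> (n y) + cnj (cz \<epsilon> x y * \<zeta> (n y))) / 2"
proof (cases "\<epsilon> < dist x y")
  case True
  let ?w = "\<zeta> x - \<zeta> y"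
  have "Re (cz \<epsilon> x y * \<zeta> (n y)) = (Re ?w * Re (\<zeta> (n y)) + Im ?w * Im (\<zeta> (n y))) / (cmod ?w)\<^sup>2"
    using True by (simp add: cz_def cmod_power2 Re_divide)
  also have "Re ?w * Re (\<zeta> (n y)) + Im ?w * Im (\<zeta> (n y)) = (x - y) \<bullet> n y"
    using inner_expand[of "x - y" "n y"] by (simp add: \<zeta>_def inner_diff_left)
  finally have "dipole n \<epsilon> x y = Re (cz \<epsilon> x y * \<zeta> (n y))"
    using True by (simp add: dipole_def dist_eq_cmod)
  then show ?thesis by (simp add: complex_add_cnj del: complex_cnj_mult)
qed (simp add: dipole_def cz_def)

lemma norm_\<zeta>: "cmod (\<zeta> v) = norm v"
proof -
  have "\<zeta> 0 = 0" by (simp add: \<zeta>_def complex_eq_iff)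
  then show ?thesis using dist_eq_cmod[of v 0] by simp
qed

text \<open>Taking the real part of a kernel is not complex linear. The integral is half the sum of
  a Cauchy integral of \<phi> and of the conjugate of a Cauchy integral of
  \<open>cnj \<phi>\<close>, the factor \<zeta> (n y) being moved into the density. The weights 1 /
  2 compensate the factors 2 of \<open>sqn_add_le\<close>.\<close>

lemma truncated_dipole_graph:
  assumes e: "0 < \<epsilon>" and P [measurable]: "P \<in> sets borel" and sub: "P \<subseteq> graph" and bdd: "bounded P"
    and n [measurable]: "n \<in> borel_measurable borel" and B: "\<And>y. norm (n y) \<le> B"
    and \<phi> [measurable]: "\<phi> \<in> borel_measurable borel" and fin: "sqn N \<phi> < \<infinity>"
  shows "sqn N (\<lambda>x. indicator P x * (\<integral>y. of_real (dipole n \<epsilon> x y) * (indicator P y * \<phi> y) \<partial>N)) \<le> ennreal (graph_const * B\<^sup>2) * sqn N \<phi>"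
proof -
  have B0: "0 \<le> B" using B[of undefined] norm_ge_zero order_trans by blast
  have gc: "0 \<le> graph_const" by (simp add: graph_const_def)
  let ?T = "\<lambda>\<psi> x. indicator P x * (\<integral>y. cz \<epsilon> x y * (indicator P y * (\<zeta> (n y) * \<psi> y)) \<partial>N)"
  have T: "sqn N (?T \<psi>) \<le> ennreal (graph_const * B\<^sup>2) * sqn N \<phi>"
    if [measurable]: "\<psi> \<in> borel_measurable borel" and s: "sqn N \<psi> = sqn N \<phi>" for \<psi>
  proof -
    have le: "sqn N (\<lambda>y. \<zeta> (n y) * \<psi> y) \<le> ennreal (B\<^sup>2) * sqn N \<phi>"
      unfolding s[symmetric] by (rule sqn_mult_bounded) (use B B0 in \<open>auto simp: norm_\<zeta>\<close>)
    also have "\<dots> < \<infinity>" using fin by (simp add: ennreal_mult_less_top)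
    finally have "sqn N (?T \<psi>) \<le> ennreal graph_const * sqn N (\<lambda>y. \<zeta> (n y) * \<psi> y)"
      by (intro truncated_Cauchy_graph e P sub bdd) auto
    also have "\<dots> \<le> ennreal graph_const * (ennreal (B\<^sup>2) * sqn N \<phi>)" by (intro mult_left_mono le) simp
    also have "\<dots> = ennreal (graph_const * B\<^sup>2) * sqn N \<phi>" using gc by (simp add: ennreal_mult mult.assoc)
    finally show ?thesis .
  qed
  have int\<phi>: "integrable N \<phi>" by (rule integrable_if_sqn[OF finite_measure_axioms _ fin]) measurable
  have bK: "cmod (cz \<epsilon> x y * (indicator P y * \<zeta> (n y))) \<le> 1 / \<epsilon> * B" for x y
    unfolding norm_mult using norm_cz_le[OF e, of x y] B[of y] B0 e
    by (intro mult_mono) (auto simp: norm_\<zeta> indicator_def)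
  have eq: "indicator P x * (\<integral>y. of_real (dipole n \<epsilon> x y) * (indicator P y * \<phi> y) \<partial>N)
     = (1/2) * ?T \<phi> x + (1/2) * cnj (?T (\<lambda>y. cnj (\<phi> y)) x)" for x
  proof -
    have i1: "integrable N (\<lambda>y. cz \<epsilon> x y * (indicator P y * (\<zeta> (n y) * \<phi> y)))"
      using integrable_bounded_mult[OF int\<phi> _ bK[of x]] by (simp add: mult.assoc)
    have i2: "integrable N (\<lambda>y. cz \<epsilon> x y * (indicator P y * (\<zeta> (n y) * cnj (\<phi> y))))"
      using integrable_bounded_mult[OF _ _ bK[of x], of "\<lambda>y. cnj (\<phi> y)"] int\<phi> by (simp add: mult.assoc)
    have "(\<integral>y. of_real (dipole n \<epsilon> x y) * (indicator P y * \<phi> y) \<partial>N)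
       = (\<integral>y. (1/2) * (cz \<epsilon> x y * (indicator P y * (\<zeta> (n y) * \<phi> y))) + (1/2) * cnj (cz \<epsilon> x y * (indicator P y * (\<zeta> (n y) * cnj (\<phi> y)))) \<partial>N)"
      by (intro Bochner_Integration.integral_cong refl) (auto simp: dipole_eq indicator_def field_simps)
    also have "\<dots> = (1/2) * (\<integral>y. cz \<epsilon> x y * (indicator P y * (\<zeta> (n y) * \<phi> y)) \<partial>N) + (1/2) * cnj (\<integral>y. cz \<epsilon> x y * (indicator P y * (\<zeta> (n y) * cnj (\<phi> y))) \<partial>N)"
      using i1 i2
      by (subst Bochner_Integration.integral_add)
        (auto simp del: complex_cnj_mult intro!: integrable_mult_right integrable_cnj)
    finally show ?thesis by (auto simp: indicator_def)
  qed
  have Tm: "?T \<psi> \<in> borel_measurable borel" if [measurable]: "\<psi> \<in> borel_measurable borel" for \<psi>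
    by measurable
  have "sqn N (\<lambda>x. (1/2) * ?T \<phi> x + (1/2) * cnj (?T (\<lambda>y. cnj (\<phi> y)) x))
     \<le> 2 * sqn N (\<lambda>x. (1/2) * ?T \<phi> x) + 2 * sqn N (\<lambda>x. (1/2) * cnj (?T (\<lambda>y. cnj (\<phi> y)) x))"
    by (rule sqn_add_le) (use Tm[of \<phi>] Tm[of "\<lambda>y. cnj (\<phi> y)"] in measurable)
  also have "\<dots> = 2 * (ennreal (1/4) * sqn N (?T \<phi>)) + 2 * (ennreal (1/4) * sqn N (?T (\<lambda>y. cnj (\<phi> y))))"
    using Tm[of \<phi>] Tm[of "\<lambda>y. cnj (\<phi> y)"]
    by (subst (1 2) sqn_cmult) (auto simp: sqn_cnj power2_eq_square simp del: complex_cnj_mult)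
  also have "\<dots> \<le> 2 * (ennreal (1/4) * (ennreal (graph_const * B\<^sup>2) * sqn N \<phi>)) + 2 * (ennreal (1/4) * (ennreal (graph_const * B\<^sup>2) * sqn N \<phi>))"
    by (intro add_mono mult_left_mono T) (auto simp: sqn_cnj)
  also have "\<dots> = ennreal (graph_const * B\<^sup>2) * sqn N \<phi>"
    by (subst ennreal_lincomb) auto
  finally show ?thesis by (simp only: eq)
qed

text \<open>For x within \<rho> of the centre, the points y within 2 \<rho> lie on one graph with x.
  The others are at distance at least \<rho> from x, so their kernel is at most B / \<rho>, and for
  a finite measure Schur's test works with this constant majorant.\<close>

lemma truncated_dipole_local:
  assumes e: "0 < \<epsilon>" and G [measurable]: "G \<in> sets borel" and \<rho>: "0 < \<rho>" and sub: "G \<inter> ball p (2 * \<rho>) \<subseteq> graph"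
    and n [measurable]: "n \<in> borel_measurable borel" and B: "\<And>y. norm (n y) \<le> B"
    and \<phi> [measurable]: "\<phi> \<in> borel_measurable borel" and fin: "sqn N \<phi> < \<infinity>" and supp: "\<And>y. y \<notin> G \<Longrightarrow> \<phi> y = 0"
  shows "sqn N (\<lambda>x. indicator (G \<inter> ball p \<rho>) x * (\<integral>y. of_real (dipole n \<epsilon> x y) * \<phi> y \<partial>N))
    \<le> ennreal (2 * (graph_const * B\<^sup>2) + 2 * (B / \<rho> * measure N UNIV)\<^sup>2) * sqn N \<phi>"
proof -
  have B0: "0 \<le> B" using B[of undefined] norm_ge_zero order_trans by blast
  have gc: "0 \<le> graph_const" by (simp add: graph_const_def)
  define P where "P = G \<inter> ball p (2 * \<rho>)"
  have P [measurable]: "P \<in> sets borel" by (simp add: P_def)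
  have bdd: "bounded P" unfolding P_def by (meson bounded_ball bounded_subset inf_le2)
  let ?I = "\<lambda>x. indicator P x * (\<integral>y. of_real (dipole n \<epsilon> x y) * (indicator P y * \<phi> y) \<partial>N)"
  let ?k = "\<lambda>x y. indicator (G \<inter> ball p \<rho>) x * (indicator (G - ball p (2 * \<rho>)) y * complex_of_real (dipole n \<epsilon> x y))"
  let ?J = "\<lambda>x. \<integral>y. ?k x y * \<phi> y \<partial>N"
  have [measurable]: "ball p \<rho> \<in> sets borel" "ball p (2 * \<rho>) \<in> sets borel" by auto
  have int\<phi>: "integrable N \<phi>" by (rule integrable_if_sqn[OF finite_measure_axioms _ fin]) measurable
  have le: "cmod (indicator (G \<inter> ball p \<rho>) x * (\<integral>y. of_real (dipole n \<epsilon> x y) * \<phi> y \<partial>N)) \<le> cmod (?I x + ?J x)" for x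
  proof (cases "x \<in> G \<inter> ball p \<rho>")
    case True
    then have xP: "x \<in> P" using \<rho> by (auto simp: P_def)
    have i1: "integrable N (\<lambda>y. (complex_of_real (dipole n \<epsilon> x y) * indicator P y) * \<phi> y)"
      by (rule integrable_bounded_mult[OF int\<phi>, where D = "B / \<epsilon>"]) (use dipole_le_inverse[where \<epsilon> = \<epsilon> and n = n and B = B, OF e B] B0 e in \<open>auto simp: norm_mult indicator_def\<close>)
    have i2: "integrable N (\<lambda>y. ?k x y * \<phi> y)"
      by (rule integrable_bounded_mult[OF int\<phi>, where D = "B / \<epsilon>"]) (use dipole_le_inverse[where \<epsilon> = \<epsilon> and n = n and B = B, OF e B] B0 e in \<open>auto simp: norm_mult indicator_def\<close>)
    have "?I x + ?J x = (\<integral>y. (complex_of_real (dipole n \<epsilon> x y) * indicator P y) * \<phi> y + ?k x y * \<phi> y \<partial>N)"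
      using xP by (subst Bochner_Integration.integral_add[OF i1 i2]) (simp add: mult.assoc)
    also have "\<dots> = (\<integral>y. of_real (dipole n \<epsilon> x y) * \<phi> y \<partial>N)"
      using True supp by (intro Bochner_Integration.integral_cong refl) (auto simp: P_def indicator_def)
    finally show ?thesis using True by simp
  qed simp
  have "sqn N (\<lambda>x. indicator (G \<inter> ball p \<rho>) x * (\<integral>y. of_real (dipole n \<epsilon> x y) * \<phi> y \<partial>N)) \<le> sqn N (\<lambda>x. ?I x + ?J x)"
    by (rule sqn_mono[OF le])
  also have "\<dots> \<le> 2 * sqn N ?I + 2 * sqn N ?J"
    by (rule sqn_add_le) measurable
  also have "\<dots> \<le> 2 * (ennreal (graph_const * B\<^sup>2) * sqn N \<phi>) + 2 * (ennreal (B / \<rho> * measure N UNIV) * ennreal (B / \<rho> * measure N UNIV) * sqn N \<phi>)"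
  proof (intro add_mono mult_left_mono)
    show "sqn N ?I \<le> ennreal (graph_const * B\<^sup>2) * sqn N \<phi>"
      using sub by (intro truncated_dipole_graph e P bdd B \<phi> n fin) (simp add: P_def)
    have c: "(\<integral>\<^sup>+ y. ennreal (B / \<rho>) \<partial>N) \<le> ennreal (B / \<rho> * measure N UNIV)"
      using B0 \<rho> by (simp add: emeasure_eq_measure ennreal_mult[symmetric])
    show "sqn N ?J \<le> ennreal (B / \<rho> * measure N UNIV) * ennreal (B / \<rho> * measure N UNIV) * sqn N \<phi>"
    proof (rule kernel_sqn_le[where p = "\<lambda>_ _. B / \<rho>"])
      fix x y
      show "cmod (?k x y) \<le> B / \<rho>"
      proof (cases "x \<in> G \<inter> ball p \<rho> \<and> y \<in> G - ball p (2 * \<rho>)")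
        case True
        then have "dist p x < \<rho>" "2 * \<rho> \<le> dist p y" by auto
        then have "\<rho> \<le> dist x y" using dist_triangle[of p y x] by linarith
        then show ?thesis using True dipole_le[where n = n and B = B and x = x and y = y, OF \<rho> _ B] by simp
      qed (use B0 \<rho> in \<open>auto simp: indicator_def\<close>)
    qed (use c in auto)
  qed auto
  also have "\<dots> = ennreal (2 * (graph_const * B\<^sup>2) + 2 * (B / \<rho> * measure N UNIV)\<^sup>2) * sqn N \<phi>"
  proof -
    let ?b = "B / \<rho> * measure N UNIV"
    have "0 \<le> ?b" using B0 \<rho> by simp
    then have "ennreal ?b * ennreal ?b = ennreal (?b\<^sup>2)" by (simp add: ennreal_mult[symmetric] power2_eq_square)
    then show ?thesis using gc by (simp only: ennreal_lincomb mult_nonneg_nonneg zero_le_power2)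
  qed
  finally show ?thesis .
qed

end

section \<open>Arc length and charts\<close>

lemma sets_hausdorff1 [simp, measurable_cong]: "sets hausdorff1 = sets borel"
  unfolding hausdorff1_def using sets.sigma_sets_eq[of "borel :: (real^2) measure"]
  by (subst sets_measure_of) auto

lemma space_hausdorff1 [simp]: "space hausdorff1 = UNIV"
  using sets_eq_imp_space_eq[OF sets_hausdorff1] by simp

text \<open>Valid whether or not the outer measure is additive on Borel sets:
  otherwise \<^const>\<open>measure_of\<close> yields the zero measure.\<close>

lemma emeasure_hausdorff1_le: "emeasure hausdorff1 X \<le> hausdorff1_outer X"
  unfolding hausdorff1_def by (subst emeasure_measure_of_conv) auto

context lipschitz_frame
begin

text \<open>Vertical strips of width h cut the graph into pieces of diameter at most (1 + K) h. With
  m strips over an interval of length 2 r the diameters add up to at most 2 (1 + K) r whatever m is,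
  and m is taken large enough for the prescribed \<delta>.\<close>

lemma hausdorff1_outer_graph:
  assumes r: "0 < r" and S: "S \<subseteq> graph \<inter> cball x r"
  shows "hausdorff1_outer S \<le> ennreal (2 * (1 + K) * r)"
  unfolding hausdorff1_outer_def
proof (rule SUP_least)
  fix \<delta> :: real assume "\<delta> \<in> {0<..}"
  then have \<delta>: "0 < \<delta>" by simp
  obtain m :: nat where m: "2 * (1 + K) * r / \<delta> < real m" using reals_Archimedean2 by blast
  have "0 \<le> 2 * (1 + K) * r / \<delta>" using r K_nonneg \<delta> by simp
  then have m0: "0 < real m" using m by linarith
  define h where "h = 2 * r / real m"
  have h: "0 < h" using r m0 by (simp add: h_def)
  have hd: "(1 + K) * h \<le> \<delta>"
  proof -
    have "2 * (1 + K) * r < real m * \<delta>" using m \<delta> by (simp add: divide_less_eq)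
    then show ?thesis using m0 by (simp add: h_def divide_le_eq mult_ac)
  qed
  define s where "s = x \<bullet> a - r"
  define U where "U i = (if i < m then {y\<in>graph. s + real i * h \<le> y \<bullet> a \<and> y \<bullet> a \<le> s + real i * h + h} else {})" for i
  have dU: "dist y z \<le> (1 + K) * h" if "y \<in> U i" "z \<in> U i" for y z i
  proof -
    have "y \<in> graph" "z \<in> graph" "\<bar>y \<bullet> a - z \<bullet> a\<bar> \<le> h" using that by (auto simp: U_def split: if_splits)
    then show ?thesis using graph_dist_le[of y z] K_nonneg mult_left_mono[of "\<bar>y \<bullet> a - z \<bullet> a\<bar>" h "1 + K"] by linarith
  qed
  have bU: "bounded (U i)" for i
  proof (cases "U i = {}")
    case False
    then obtain y where "y \<in> U i" by auto
    then show ?thesis using dU[of y i] by (intro bounded_subset[OF bounded_cball[of y "(1 + K) * h"]]) auto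
  qed simp
  have diamU: "diameter (U i) \<le> (if i < m then (1 + K) * h else 0)" for i
  proof (cases "i < m")
    case True
    then show ?thesis using h K_nonneg dU by (simp, intro diameter_le) (auto simp: dist_norm)
  qed (simp add: U_def)
  have cover: "S \<subseteq> (\<Union>i. U i)"
  proof
    fix y assume "y \<in> S"
    then have y: "y \<in> graph" "dist x y \<le> r" using S by auto
    have "\<bar>(y - x) \<bullet> a\<bar> \<le> r"
      using Cauchy_Schwarz_ineq2[of "y - x" a] norm_a y(2) by (simp add: dist_norm norm_minus_commute)
    then have ya: "s \<le> y \<bullet> a" "y \<bullet> a - s \<le> 2 * r" by (auto simp: s_def inner_diff_left)
    let ?i = "cell s h y"
    have c: "s + real ?i * h \<le> y \<bullet> a" "y \<bullet> a < s + real ?i * h + h"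
      using cell_bounds[OF h ya(1)] by auto
    show "y \<in> (\<Union>i. U i)"
    proof (cases "?i < m")
      case True
      then show ?thesis using c y(1) by (intro UN_I[of ?i]) (auto simp: U_def)
    next
      \<comment> \<open>Only the right end of the interval can have index m. The strips are closed,
        so the last one contains it.\<close>
      case False
      then have mi: "real m \<le> real ?i" by simp
      have mh: "real m * h = 2 * r" using m0 by (simp add: h_def)
      have "real m * h \<le> real ?i * h" using mi h by (intro mult_right_mono) auto
      then have "y \<bullet> a - s = real m * h" using c(1) ya(2) mh by linarith
      moreover have "real (m - 1) * h = real m * h - h" using m0 by (simp add: of_nat_diff left_diff_distrib)
      ultimately have "y \<in> U (m - 1)" using m0 y(1) h by (simp add: U_def)
      then show ?thesis by auto
    qed
  qed
  have "(INF U\<in>{U. S \<subseteq> \<Union> (range U) \<and> (\<forall>i. bounded (U i) \<and> diameter (U i) \<le> \<delta>)}. \<Sum>i. ennreal (diameter (U i)))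
     \<le> (\<Sum>i. ennreal (diameter (U i)))"
  proof (rule INF_lower, safe)
    fix y assume "y \<in> S" then show "y \<in> \<Union> (range U)" using cover by auto
  next
    fix i
    show "bounded (U i)" by (rule bU)
    show "diameter (U i) \<le> \<delta>" using diamU[of i] hd \<delta> by (auto split: if_splits)
  qed
  also have "\<dots> \<le> (\<Sum>i. ennreal (if i < m then (1 + K) * h else 0))"
    by (intro suminf_le ennreal_leI diamU) auto
  also have "\<dots> = (\<Sum>i<m. ennreal ((1 + K) * h))"
    by (subst suminf_finite[of "{..<m}"]) auto
  also have "\<dots> = ennreal (2 * (1 + K) * r)"
  proof -
    have "(\<Sum>i<m. ennreal ((1 + K) * h)) = ennreal (\<Sum>i<m. (1 + K) * h)"
      using h K_nonneg by (intro sum_ennreal) auto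
    also have "(\<Sum>i<m. (1 + K) * h) = 2 * (1 + K) * r" using m0 by (simp add: h_def)
    finally show ?thesis .
  qed
  finally show "(INF U\<in>{U. S \<subseteq> \<Union> (range U) \<and> (\<forall>i. bounded (U i) \<and> diameter (U i) \<le> \<delta>)}. \<Sum>i. ennreal (diameter (U i)))
     \<le> ennreal (2 * (1 + K) * r)" .
qed

end

lemma lipschitz_chart_frame:
  assumes "lipschitz_chart \<Omega> W a b f"
  obtains K where "lipschitz_frame a b f K" "open W" "\<Omega> \<inter> W = {x \<in> W. x \<bullet> b \<le> f (x \<bullet> a)}"
  using assms unfolding lipschitz_chart_def lipschitz_frame_def by blast

text \<open>A point of \<Omega> in W strictly below the graph keeps a neighbourhood below the graph,
  and is interior.\<close>

lemma chart_frontier: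
  assumes ch: "lipschitz_chart \<Omega> W a b f" and "closed \<Omega>" and x: "x \<in> frontier \<Omega>" "x \<in> W"
  shows "x \<bullet> b = f (x \<bullet> a)"
proof (rule ccontr)
  assume ne: "x \<bullet> b \<noteq> f (x \<bullet> a)"
  obtain K where fr: "lipschitz_frame a b f K" and W: "open W" and eq: "\<Omega> \<inter> W = {x \<in> W. x \<bullet> b \<le> f (x \<bullet> a)}"
    by (rule lipschitz_chart_frame[OF ch])
  interpret lipschitz_frame a b f K by fact
  have "x \<in> \<Omega>" using x(1) \<open>closed \<Omega>\<close> by (meson frontier_subset_closed subsetD)
  then have less: "x \<bullet> b < f (x \<bullet> a)" using eq x(2) ne by force
  have fc: "continuous_on UNIV f" by (rule lipschitz_on_continuous_on[OF lip])
  have "open {y. y \<bullet> b < f (y \<bullet> a)}"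
    by (intro open_Collect_less continuous_intros continuous_on_compose2[OF fc]) auto
  then have "open (W \<inter> {y. y \<bullet> b < f (y \<bullet> a)})" using W by auto
  moreover have "W \<inter> {y. y \<bullet> b < f (y \<bullet> a)} \<subseteq> \<Omega>"
  proof
    fix y assume "y \<in> W \<inter> {y. y \<bullet> b < f (y \<bullet> a)}"
    then have "y \<in> {x \<in> W. x \<bullet> b \<le> f (x \<bullet> a)}" by simp
    then show "y \<in> \<Omega>" unfolding eq[symmetric] by simp
  qed
  ultimately have "x \<in> interior \<Omega>" using less x(2) by (auto simp: interior_def)
  then show False using x(1) by (simp add: frontier_def)
qed

text \<open>Existence of the limit is rewritten as a Cauchy condition over the countable set Q and
  over reciprocals of integers, which is a countable combination of measurable sets. The hypothesis
  \<open>dense\<close> carries the condition over from Q to S. It is applied to difference quotients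
  and to truncated integrals.\<close>

lemma limit_exists_measurable:
  fixes F :: "'a \<Rightarrow> real \<Rightarrow> 'b::{complete_space, second_countable_topology}"
  assumes Q: "countable Q" "Q \<subseteq> S" and S: "0 \<notin> S" "0 islimpt S"
    and meas [measurable]: "\<And>q. q \<in> Q \<Longrightarrow> (\<lambda>x. F x q) \<in> borel_measurable M"
    and dense: "\<And>x s d. x \<in> space M \<Longrightarrow> s \<in> S \<Longrightarrow> 0 < d \<Longrightarrow> \<exists>q\<in>Q. \<bar>q - s\<bar> < d \<and> dist (F x q) (F x s) < d"
  shows "{x \<in> space M. \<exists>l. (F x \<longlongrightarrow> l) (at 0 within S)} \<in> sets M"
proof -
  let ?C = "\<lambda>x. \<forall>k::nat. \<exists>m::nat. \<forall>q\<in>Q. \<forall>q'\<in>Q. \<bar>q\<bar> < 1 / Suc m \<longrightarrow> \<bar>q'\<bar> < 1 / Suc m \<longrightarrow> dist (F x q) (F x q') \<le> 1 / Suc k"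
  have eq: "(\<exists>l. (F x \<longlongrightarrow> l) (at 0 within S)) \<longleftrightarrow> ?C x" if x: "x \<in> space M" for x
  proof
    assume "\<exists>l. (F x \<longlongrightarrow> l) (at 0 within S)"
    then obtain l where l: "(F x \<longlongrightarrow> l) (at 0 within S)" by blast
    show "?C x"
    proof
      fix k :: nat
      have "eventually (\<lambda>s. dist (F x s) l < 1 / (2 * Suc k)) (at 0 within S)"
        using l by (rule tendstoD) simp
      then obtain d where d: "0 < d" "\<And>s. s \<in> S \<Longrightarrow> s \<noteq> 0 \<Longrightarrow> dist s 0 < d \<Longrightarrow> dist (F x s) l < 1 / (2 * Suc k)"
        by (auto simp: eventually_at)
      obtain m where m: "1 / Suc m < d" using nat_approx_posE[OF d(1)] by blast
      have "dist (F x q) (F x q') \<le> 1 / Suc k" if "q \<in> Q" "q' \<in> Q" "\<bar>q\<bar> < 1 / Suc m" "\<bar>q'\<bar> < 1 / Suc m" for q q'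
      proof -
        have "dist (F x q) l < 1 / (2 * Suc k)" "dist (F x q') l < 1 / (2 * Suc k)"
          using that Q(2) S(1) m d(2)[of q] d(2)[of q'] by (auto simp: dist_real_def simp del: of_nat_Suc)
        then have "dist (F x q) (F x q') < 1 / (2 * Suc k) + 1 / (2 * Suc k)"
          using dist_triangle2[of "F x q" "F x q'" l] by linarith
        also have "\<dots> = 1 / Suc k" by (simp add: field_simps)
        finally show ?thesis by simp
      qed
      then show "\<exists>m::nat. \<forall>q\<in>Q. \<forall>q'\<in>Q. \<bar>q\<bar> < 1 / Suc m \<longrightarrow> \<bar>q'\<bar> < 1 / Suc m \<longrightarrow> dist (F x q) (F x q') \<le> 1 / Suc k"
        by blast
    qed
  next
    assume C: "?C x"
    have CS: "\<exists>m::nat. \<forall>s\<in>S. \<forall>s'\<in>S. \<bar>s\<bar> < 1 / Suc m \<longrightarrow> \<bar>s'\<bar> < 1 / Suc m \<longrightarrow> dist (F x s) (F x s') \<le> 1 / Suc k" for k :: nat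
    proof -
      obtain m :: nat where m: "\<And>q q'. q \<in> Q \<Longrightarrow> q' \<in> Q \<Longrightarrow> \<bar>q\<bar> < 1 / Suc m \<Longrightarrow> \<bar>q'\<bar> < 1 / Suc m \<Longrightarrow> dist (F x q) (F x q') \<le> 1 / Suc k"
        using C by blast
      have "dist (F x s) (F x s') \<le> 1 / Suc k" if s: "s \<in> S" "s' \<in> S" "\<bar>s\<bar> < 1 / Suc m" "\<bar>s'\<bar> < 1 / Suc m" for s s'
      proof (rule field_le_epsilon)
        fix e :: real assume e: "0 < e"
        have ap: "\<exists>q\<in>Q. \<bar>q\<bar> < 1 / Suc m \<and> dist (F x q) (F x s) < e / 2" if sS: "s \<in> S" "\<bar>s\<bar> < 1 / Suc m" for s
        proof -
          let ?d = "min (e / 2) (1 / Suc m - \<bar>s\<bar>)"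
          obtain q where "q \<in> Q" "\<bar>q - s\<bar> < ?d" "dist (F x q) (F x s) < ?d"
            using dense[OF x sS(1), of ?d] sS(2) e by auto
          then show ?thesis by (intro bexI[of _ q]) auto
        qed
        obtain q q' where q: "q \<in> Q" "\<bar>q\<bar> < 1 / Suc m" "dist (F x q) (F x s) < e / 2"
          "q' \<in> Q" "\<bar>q'\<bar> < 1 / Suc m" "dist (F x q') (F x s') < e / 2"
          using ap[of s] ap[of s'] s by blast
        have "dist (F x s) (F x s') \<le> dist (F x q) (F x s) + dist (F x q) (F x q') + dist (F x q') (F x s')"
          using dist_triangle[of "F x s" "F x s'" "F x q"] dist_triangle[of "F x q" "F x s'" "F x q'"]
          by (simp add: dist_commute)
        then show "dist (F x s) (F x s') \<le> 1 / Suc k + e" using q m[of q q'] by linarith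
      qed
      then show ?thesis by blast
    qed
    obtain u where u: "\<And>n. u n \<in> S - {0}" "u \<longlonglongrightarrow> 0"
      using S(2) unfolding islimpt_sequential by blast
    have "Cauchy (\<lambda>n. F x (u n))"
    proof (rule metric_CauchyI)
      fix e :: real assume e: "0 < e"
      obtain k where k: "1 / Suc k < e" using nat_approx_posE[OF e] by blast
      obtain m :: nat where m: "\<forall>s\<in>S. \<forall>s'\<in>S. \<bar>s\<bar> < 1 / Suc m \<longrightarrow> \<bar>s'\<bar> < 1 / Suc m \<longrightarrow> dist (F x s) (F x s') \<le> 1 / Suc k"
        using CS[of k] by blast
      obtain n0 where "\<And>n. n \<ge> n0 \<Longrightarrow> \<bar>u n\<bar> < 1 / Suc m"
        using metric_LIMSEQ_D[OF u(2), of "1 / Suc m"] by (auto simp: dist_real_def simp del: of_nat_Suc)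
      then show "\<exists>n0. \<forall>i\<ge>n0. \<forall>j\<ge>n0. dist (F x (u i)) (F x (u j)) < e"
      proof (intro exI[of _ n0] allI impI)
        fix i j assume n0: "i \<ge> n0" "j \<ge> n0" and less: "\<And>n. n \<ge> n0 \<Longrightarrow> \<bar>u n\<bar> < 1 / Suc m"
        have "dist (F x (u i)) (F x (u j)) \<le> 1 / Suc k"
          using m less[OF n0(1)] less[OF n0(2)] u(1)[of i] u(1)[of j] by blast
        then show "dist (F x (u i)) (F x (u j)) < e" using k by linarith
      qed
    qed
    then obtain l where l: "(\<lambda>n. F x (u n)) \<longlonglongrightarrow> l" using Cauchy_convergent convergent_def by blast
    have "(F x \<longlongrightarrow> l) (at 0 within S)"
    proof (rule tendstoI)
      fix e :: real assume e: "0 < e"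
      obtain k where k: "1 / Suc k < e / 2" using nat_approx_posE[of "e/2"] e by auto
      obtain m :: nat where m: "\<And>s s'. s\<in>S \<Longrightarrow> s'\<in>S \<Longrightarrow> \<bar>s\<bar> < 1 / Suc m \<Longrightarrow> \<bar>s'\<bar> < 1 / Suc m \<Longrightarrow> dist (F x s) (F x s') \<le> 1 / Suc k"
        using CS[of k] by blast
      have "eventually (\<lambda>n. \<bar>u n\<bar> < 1 / Suc m) sequentially"
        using tendstoD[OF u(2), of "1 / Suc m"] by (simp add: dist_real_def)
      moreover have "eventually (\<lambda>n. dist (F x (u n)) l < e / 2) sequentially"
        using tendstoD[OF l, of "e / 2"] e by simp
      ultimately have "eventually (\<lambda>n. \<bar>u n\<bar> < 1 / Suc m \<and> dist (F x (u n)) l < e / 2) sequentially"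
        by (rule eventually_conj)
      then obtain n where n: "\<bar>u n\<bar> < 1 / Suc m" "dist (F x (u n)) l < e / 2"
        using eventually_happens'[OF sequentially_bot] by blast
      have "dist (F x s) l < e" if "s \<in> S" "\<bar>s\<bar> < 1 / Suc m" for s
        using m[of s "u n"] that n u(1)[of n] k dist_triangle[of "F x s" l "F x (u n)"] by auto
      then show "eventually (\<lambda>s. dist (F x s) l < e) (at 0 within S)"
        unfolding eventually_at by (intro exI[of _ "1 / Suc m"]) (auto simp: dist_real_def)
    qed
    then show "\<exists>l. (F x \<longlongrightarrow> l) (at 0 within S)" ..
  qed
  have "{x \<in> space M. ?C x} \<in> sets M"
    using Q(1) by (intro sets.sets_Collect_countable_All sets.sets_Collect_countable_Ex sets.sets_Collect_countable_Ball) (auto simp del: of_nat_Suc)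
  also have "{x \<in> space M. ?C x} = {x \<in> space M. \<exists>l. (F x \<longlongrightarrow> l) (at 0 within S)}" using eq by auto
  finally show ?thesis .
qed

section \<open>The normal\<close>

text \<open>A description of the normal that does not refer to a chart; it shows that all charts
  produce the same vector, and are differentiable at the same boundary points.\<close>

definition tangent_normal :: "(real^2) set \<Rightarrow> real^2 \<Rightarrow> real^2 \<Rightarrow> bool" where
  "tangent_normal \<Omega> y n \<longleftrightarrow> (\<forall>\<eta>>0. \<exists>r>0. \<forall>x. dist x y < r \<longrightarrow>
     (x \<in> \<Omega> \<longrightarrow> (x - y) \<bullet> n \<le> \<eta> * dist x y) \<and> (x \<notin> \<Omega> \<longrightarrow> - (\<eta> * dist x y) \<le> (x - y) \<bullet> n))"

definition graph_normal :: "real^2 \<Rightarrow> real^2 \<Rightarrow> real \<Rightarrow> real^2" where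
  "graph_normal a b d = (1 / sqrt (1 + d\<^sup>2)) *\<^sub>R (b - d *\<^sub>R a)"

context lipschitz_frame
begin

lemma inner_graph_normal: "v \<bullet> graph_normal a b d = (v \<bullet> b - d * (v \<bullet> a)) / sqrt (1 + d\<^sup>2)"
  by (simp add: graph_normal_def inner_diff_right)

lemma inner_aa: "a \<bullet> a = 1" and inner_bb: "b \<bullet> b = 1"
  using norm_a norm_b by (simp_all add: norm_eq_1)

lemma norm_graph_normal: "norm (graph_normal a b d) = 1"
proof -
  have "(norm (b - d *\<^sub>R a))\<^sup>2 = 1 + d\<^sup>2"
    unfolding power2_norm_eq_inner using orth inner_aa inner_bb
    by (simp add: inner_diff_left inner_diff_right inner_commute power2_eq_square)
  then have "norm (b - d *\<^sub>R a) = sqrt (1 + d\<^sup>2)" by (simp add: real_sqrt_unique)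
  moreover have "0 < 1 + d\<^sup>2" by (simp add: add_pos_nonneg)
  ultimately show ?thesis by (simp add: graph_normal_def)
qed

lemma tangent_normal_graph:
  assumes W: "open W" and eq: "\<Omega> \<inter> W = {x \<in> W. x \<bullet> b \<le> f (x \<bullet> a)}" and y: "y \<in> W" "y \<bullet> b = f (y \<bullet> a)"
    and der: "(f has_real_derivative d) (at (y \<bullet> a))"
  shows "tangent_normal \<Omega> y (graph_normal a b d)"
  unfolding tangent_normal_def
proof (intro allI impI)
  fix \<eta> :: real assume \<eta>: "0 < \<eta>"
  have "(f has_derivative (\<lambda>h. d * h)) (at (y \<bullet> a))" using der by (simp add: has_field_derivative_def)
  then obtain \<delta> where \<delta>: "0 < \<delta>" "\<And>t. norm (t - y \<bullet> a) < \<delta> \<Longrightarrow> norm (f t - f (y \<bullet> a) - d * (t - y \<bullet> a)) \<le> \<eta> * norm (t - y \<bullet> a)"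
    unfolding has_derivative_at_alt using \<eta> by blast
  obtain r where r: "0 < r" "ball y r \<subseteq> W" using W y(1) openE by blast
  have s1: "1 \<le> sqrt (1 + d\<^sup>2)" and s0: "0 < sqrt (1 + d\<^sup>2)" by (simp_all add: add_pos_nonneg)
  show "\<exists>r>0. \<forall>x. dist x y < r \<longrightarrow>
     (x \<in> \<Omega> \<longrightarrow> (x - y) \<bullet> graph_normal a b d \<le> \<eta> * dist x y) \<and> (x \<notin> \<Omega> \<longrightarrow> - (\<eta> * dist x y) \<le> (x - y) \<bullet> graph_normal a b d)"
  proof (intro exI[of _ "min \<delta> r"] conjI allI impI)
    show "0 < min \<delta> r" using \<delta> r by simp
    fix x assume x: "dist x y < min \<delta> r"
    have xW: "x \<in> W" using x r(2) by (auto simp: dist_commute)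
    have ta: "\<bar>x \<bullet> a - y \<bullet> a\<bar> \<le> dist x y"
      using Cauchy_Schwarz_ineq2[of "x - y" a] norm_a by (simp add: inner_diff_left dist_norm)
    then have "norm (f (x \<bullet> a) - f (y \<bullet> a) - d * (x \<bullet> a - y \<bullet> a)) \<le> \<eta> * norm (x \<bullet> a - y \<bullet> a)"
      using x by (intro \<delta>(2)) simp
    also have "\<dots> \<le> \<eta> * dist x y" using ta \<eta> by simp
    finally have D: "\<bar>f (x \<bullet> a) - f (y \<bullet> a) - d * (x \<bullet> a - y \<bullet> a)\<bar> \<le> \<eta> * dist x y" by simp
    have e0: "0 \<le> \<eta> * dist x y" using \<eta> by simp
    let ?t = "(x \<bullet> b - y \<bullet> b) - d * (x \<bullet> a - y \<bullet> a)"
    have val: "(x - y) \<bullet> graph_normal a b d = ?t / sqrt (1 + d\<^sup>2)"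
      by (simp add: inner_graph_normal inner_diff_left)
    have mem: "x \<in> \<Omega> \<longleftrightarrow> x \<bullet> b \<le> f (x \<bullet> a)" using eq xW by blast
    {
      assume "x \<in> \<Omega>"
      then have "?t \<le> \<eta> * dist x y" using D y(2) mem by linarith
      also have "\<dots> \<le> \<eta> * dist x y * sqrt (1 + d\<^sup>2)" using mult_left_mono[OF s1 e0] by simp
      finally show "(x - y) \<bullet> graph_normal a b d \<le> \<eta> * dist x y"
        unfolding val by (rule pos_divide_le_eq[OF s0, THEN iffD2])
    }
    {
      assume "x \<notin> \<Omega>"
      then have "- ?t \<le> \<eta> * dist x y" using D y(2) mem by linarith
      also have "\<dots> \<le> \<eta> * dist x y * sqrt (1 + d\<^sup>2)" using mult_left_mono[OF s1 e0] by simp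
      finally have "(- ?t) / sqrt (1 + d\<^sup>2) \<le> \<eta> * dist x y"
        by (rule pos_divide_le_eq[OF s0, THEN iffD2])
      then show "- (\<eta> * dist x y) \<le> (x - y) \<bullet> graph_normal a b d"
        unfolding val minus_divide_left[symmetric] by linarith
    }
  qed
qed

text \<open>Points of the graph belong to \<Omega> and are limits of points outside, so both
  one-sided conditions hold along the graph and it is tangent to the line orthogonal to n. Since
  distances on the graph are at most 1 + K times horizontal distances, n is not orthogonal to b.
  Points below the graph decide the sign of n \<bullet> b, and the slope is - (n \<bullet> a) / (n
  \<bullet> b).\<close>

lemma graph_derivative_of_tangent_normal:
  assumes W: "open W" and eq: "\<Omega> \<inter> W = {x \<in> W. x \<bullet> b \<le> f (x \<bullet> a)}" and y: "y \<in> W" "y \<bullet> b = f (y \<bullet> a)"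
    and tn: "tangent_normal \<Omega> y n" and n1: "norm n = 1"
  shows "\<exists>d. (f has_real_derivative d) (at (y \<bullet> a)) \<and> n = graph_normal a b d"
proof -
  obtain \<rho> where \<rho>: "0 < \<rho>" "ball y \<rho> \<subseteq> W" using W y(1) openE by blast
  have mem: "x \<in> \<Omega> \<longleftrightarrow> x \<bullet> b \<le> f (x \<bullet> a)" if "x \<in> W" for x using eq that by blast
  let ?t0 = "y \<bullet> a"
  have ab: "b \<bullet> a = 0" using orth by (simp add: inner_commute)
  have key: "\<exists>\<delta>>0. \<forall>t. \<bar>t - ?t0\<bar> < \<delta> \<longrightarrow> \<bar>(t - ?t0) * (n \<bullet> a) + (f t - f ?t0) * (n \<bullet> b)\<bar> \<le> \<eta> * \<bar>t - ?t0\<bar>" if \<eta>: "0 < \<eta>" for \<eta>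
  proof -
    have K1: "0 < 1 + K" using K_nonneg by simp
    define \<eta>' where "\<eta>' = \<eta> / (1 + K)"
    have \<eta>': "0 < \<eta>'" using \<eta> K1 by (simp add: \<eta>'_def)
    obtain r where r: "0 < r" "\<And>x. dist x y < r \<Longrightarrow> x \<in> \<Omega> \<Longrightarrow> (x - y) \<bullet> n \<le> \<eta>' * dist x y"
      "\<And>x. dist x y < r \<Longrightarrow> x \<notin> \<Omega> \<Longrightarrow> - (\<eta>' * dist x y) \<le> (x - y) \<bullet> n"
      using tn \<eta>' unfolding tangent_normal_def by blast
    define R where "R = min r \<rho>"
    have R: "0 < R" using r \<rho> by (simp add: R_def)
    show ?thesis
    proof (intro exI[of _ "R / (1 + K)"] conjI allI impI)
      show "0 < R / (1 + K)" using R K1 by simp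
      fix t assume t: "\<bar>t - ?t0\<bar> < R / (1 + K)"
      define g where "g = t *\<^sub>R a + f t *\<^sub>R b"
      have ga: "g \<bullet> a = t" and gb: "g \<bullet> b = f t"
        using ab orth inner_aa inner_bb by (simp_all add: g_def inner_add_left)
      have yg: "y \<in> graph" "g \<in> graph" using y ga gb by (auto simp: graph_def)
      have dg: "dist g y \<le> (1 + K) * \<bar>t - ?t0\<bar>" using graph_dist_le[OF yg(2,1)] ga by simp
      also have "\<dots> < R" using t K1 by (simp add: less_divide_eq mult.commute)
      finally have dR: "dist g y < R" .
      have gW: "g \<in> W" using dR \<rho>(2) by (auto simp: R_def dist_commute)
      have "g \<in> \<Omega>" using mem[OF gW] ga gb by simp
      then have up: "(g - y) \<bullet> n \<le> \<eta>' * dist g y" using dR by (intro r(2)) (auto simp: R_def)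
      have lo: "0 \<le> (g - y) \<bullet> n + \<eta>' * dist g y"
      proof (rule tendsto_lowerbound[where F = "at_right (0::real)" and f = "\<lambda>s. (g + s *\<^sub>R b - y) \<bullet> n + \<eta>' * dist (g + s *\<^sub>R b) y"])
        have "((\<lambda>s. (g + s *\<^sub>R b - y) \<bullet> n + \<eta>' * dist (g + s *\<^sub>R b) y) \<longlongrightarrow> (g + 0 *\<^sub>R b - y) \<bullet> n + \<eta>' * dist (g + 0 *\<^sub>R b) y) (at_right 0)"
          by (intro tendsto_intros)
        then show "((\<lambda>s. (g + s *\<^sub>R b - y) \<bullet> n + \<eta>' * dist (g + s *\<^sub>R b) y) \<longlongrightarrow> (g - y) \<bullet> n + \<eta>' * dist g y) (at_right 0)" by simp
        show "\<forall>\<^sub>F s in at_right 0. 0 \<le> (g + s *\<^sub>R b - y) \<bullet> n + \<eta>' * dist (g + s *\<^sub>R b) y"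
          unfolding eventually_at_right_field
        proof (intro exI[of _ "R - dist g y"] conjI allI impI)
          show "0 < R - dist g y" using dR by simp
          fix s :: real assume s: "0 < s" "s < R - dist g y"
          let ?x = "g + s *\<^sub>R b"
          have "dist ?x y \<le> dist g y + s"
            using norm_triangle_ineq[of "g - y" "s *\<^sub>R b"] norm_b s by (simp add: dist_norm algebra_simps)
          then have xR: "dist ?x y < R" using s by linarith
          then have xW: "?x \<in> W" using \<rho>(2) by (auto simp: R_def dist_commute)
          have "\<not> ?x \<bullet> b \<le> f (?x \<bullet> a)" using ga gb ab inner_bb s by (simp add: inner_add_left)
          then have "?x \<notin> \<Omega>" using mem[OF xW] by simp
          then have "- (\<eta>' * dist ?x y) \<le> (?x - y) \<bullet> n" using xR by (intro r(3)) (auto simp: R_def)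
          then show "0 \<le> (?x - y) \<bullet> n + \<eta>' * dist ?x y" by linarith
        qed
      qed simp
      have "(g - y) \<bullet> n = (t - ?t0) * (n \<bullet> a) + (f t - f ?t0) * (n \<bullet> b)"
        using inner_expand[of "g - y" n] ga gb y(2) by (simp add: inner_diff_left)
      then have "\<bar>(t - ?t0) * (n \<bullet> a) + (f t - f ?t0) * (n \<bullet> b)\<bar> \<le> \<eta>' * dist g y" using up lo by linarith
      also have "\<dots> \<le> \<eta>' * ((1 + K) * \<bar>t - ?t0\<bar>)" using dg \<eta>' by (intro mult_left_mono) auto
      also have "\<dots> = \<eta> * \<bar>t - ?t0\<bar>" using K1 by (simp add: \<eta>'_def)
      finally show "\<bar>(t - ?t0) * (n \<bullet> a) + (f t - f ?t0) * (n \<bullet> b)\<bar> \<le> \<eta> * \<bar>t - ?t0\<bar>" .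
    qed
  qed
  have n_sq: "(n \<bullet> a)\<^sup>2 + (n \<bullet> b)\<^sup>2 = 1"
    using inner_expand[of n n] n1 by (simp add: norm_eq_1 power2_eq_square)
  have nb0: "n \<bullet> b \<noteq> 0"
  proof
    assume z: "n \<bullet> b = 0"
    have small: "\<bar>n \<bullet> a\<bar> \<le> \<eta>" if \<eta>: "0 < \<eta>" for \<eta>
    proof -
      obtain \<delta> where \<delta>: "0 < \<delta>" "\<And>t. \<bar>t - ?t0\<bar> < \<delta> \<Longrightarrow> \<bar>(t - ?t0) * (n \<bullet> a) + (f t - f ?t0) * (n \<bullet> b)\<bar> \<le> \<eta> * \<bar>t - ?t0\<bar>"
        using key[OF \<eta>] by blast
      have "\<bar>(\<delta> / 2) * (n \<bullet> a)\<bar> \<le> \<eta> * \<bar>\<delta> / 2\<bar>" using \<delta>(2)[of "?t0 + \<delta> / 2"] \<delta>(1) z by simp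
      then show ?thesis using \<delta>(1) by (simp add: abs_mult)
    qed
    have "\<bar>n \<bullet> a\<bar> \<le> 0 + e" if "0 < e" for e using small[OF that] by simp
    then have "\<bar>n \<bullet> a\<bar> \<le> 0" by (rule field_le_epsilon)
    then show False using n_sq z by simp
  qed
  have nb_ge: "0 \<le> n \<bullet> b"
  proof (rule ccontr)
    assume "\<not> 0 \<le> n \<bullet> b"
    then have neg: "n \<bullet> b < 0" by simp
    define \<eta> where "\<eta> = - (n \<bullet> b) / 2"
    have \<eta>: "0 < \<eta>" using neg by (simp add: \<eta>_def)
    obtain r where r: "0 < r" "\<And>x. dist x y < r \<Longrightarrow> x \<in> \<Omega> \<Longrightarrow> (x - y) \<bullet> n \<le> \<eta> * dist x y"
      using tn \<eta> unfolding tangent_normal_def by blast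
    define s where "s = min r \<rho> / 2"
    have s: "0 < s" "s < r" "s < \<rho>" using r \<rho> by (auto simp: s_def)
    let ?x = "y - s *\<^sub>R b"
    have d: "dist ?x y = s" using s norm_b by (simp add: dist_norm)
    have xW: "?x \<in> W" using d s \<rho>(2) by (auto simp: dist_commute)
    have "?x \<bullet> b \<le> f (?x \<bullet> a)" using y ab inner_bb s by (simp add: inner_diff_left)
    then have "?x \<in> \<Omega>" using mem[OF xW] by simp
    then have "(?x - y) \<bullet> n \<le> \<eta> * s" using r(2)[of ?x] d s by simp
    then have "s * (- (n \<bullet> b)) \<le> s * \<eta>" by (simp add: inner_commute mult.commute)
    then have "- (n \<bullet> b) \<le> \<eta>" using s(1) by (rule mult_left_le_imp_le)
    then show False using neg by (simp add: \<eta>_def)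
  qed
  then have nb: "0 < n \<bullet> b" using nb0 by simp
  define d where "d = - (n \<bullet> a) / (n \<bullet> b)"
  have "(f has_derivative (\<lambda>h. d * h)) (at ?t0)"
    unfolding has_derivative_at_alt
  proof (intro conjI allI impI)
    show "bounded_linear (\<lambda>h. d * h)" by (rule bounded_linear_mult_right)
    fix e :: real assume e: "0 < e"
    obtain \<delta> where \<delta>: "0 < \<delta>" "\<And>t. \<bar>t - ?t0\<bar> < \<delta> \<Longrightarrow> \<bar>(t - ?t0) * (n \<bullet> a) + (f t - f ?t0) * (n \<bullet> b)\<bar> \<le> (e * (n \<bullet> b)) * \<bar>t - ?t0\<bar>"
      using key[of "e * (n \<bullet> b)"] e nb by (auto simp: zero_less_mult_iff)
    show "\<exists>\<delta>>0. \<forall>t. norm (t - ?t0) < \<delta> \<longrightarrow> norm (f t - f ?t0 - d * (t - ?t0)) \<le> e * norm (t - ?t0)"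
    proof (intro exI[of _ \<delta>] conjI allI impI \<delta>(1))
      fix t assume t: "norm (t - ?t0) < \<delta>"
      have "f t - f ?t0 - d * (t - ?t0) = ((t - ?t0) * (n \<bullet> a) + (f t - f ?t0) * (n \<bullet> b)) / (n \<bullet> b)"
        using nb by (simp add: d_def field_simps)
      then have "norm (f t - f ?t0 - d * (t - ?t0)) = \<bar>(t - ?t0) * (n \<bullet> a) + (f t - f ?t0) * (n \<bullet> b)\<bar> / (n \<bullet> b)"
        using nb by (simp add: abs_mult)
      also have "\<dots> \<le> ((e * (n \<bullet> b)) * \<bar>t - ?t0\<bar>) / (n \<bullet> b)"
        using \<delta>(2)[of t] t nb by (intro divide_right_mono) auto
      also have "\<dots> = e * norm (t - ?t0)" using nb by simp
      finally show "norm (f t - f ?t0 - d * (t - ?t0)) \<le> e * norm (t - ?t0)" .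
    qed
  qed
  then have der: "(f has_real_derivative d) (at ?t0)" by (simp add: has_field_derivative_def)
  have "1 + d\<^sup>2 = ((n \<bullet> a)\<^sup>2 + (n \<bullet> b)\<^sup>2) / (n \<bullet> b)\<^sup>2"
    using nb by (simp add: d_def power_divide add_divide_distrib)
  then have "sqrt (1 + d\<^sup>2) = 1 / (n \<bullet> b)" using nb n_sq by (simp add: real_sqrt_divide)
  then have "graph_normal a b d = (n \<bullet> b) *\<^sub>R b + (n \<bullet> a) *\<^sub>R a"
    using nb by (simp add: graph_normal_def d_def scaleR_diff_right scaleR_add_right)
  also have "\<dots> = n" using orthonormal_expand[OF norm_a norm_b orth, of n] by (simp add: add.commute)
  finally show ?thesis using der by (intro exI[of _ d]) simp
qed

end

text \<open>The predicate \<open>tangent_normal\<close> refers to \<Omega> alone. A normal from any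
  chart satisfies it, and in the given chart it determines the slope, so the quantifier over all
  charts in \<open>outward_normal\<close> can be replaced by a single chart.\<close>

lemma chart_normal_iff:
  assumes ch: "lipschitz_chart \<Omega> W a b f" and "closed \<Omega>" and y: "y \<in> frontier \<Omega>" "y \<in> W"
  shows "(\<exists>W a b f d. lipschitz_chart \<Omega> W a b f \<and> y \<in> W \<and> (f has_real_derivative d) (at (y \<bullet> a)) \<and>
        n = (1 / sqrt (1 + d\<^sup>2)) *\<^sub>R (b - d *\<^sub>R a))
    \<longleftrightarrow> (\<exists>d. (f has_real_derivative d) (at (y \<bullet> a)) \<and> n = graph_normal a b d)" (is "?L = ?R")
proof
  assume ?R
  then obtain d where "(f has_real_derivative d) (at (y \<bullet> a))" "n = graph_normal a b d" by blast
  then have "lipschitz_chart \<Omega> W a b f \<and> y \<in> W \<and> (f has_real_derivative d) (at (y \<bullet> a)) \<and> n = (1 / sqrt (1 + d\<^sup>2)) *\<^sub>R (b - d *\<^sub>R a)"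
    using ch y(2) by (simp add: graph_normal_def)
  then show ?L by blast
next
  assume ?L
  then obtain W' a' b' f' d' where ch': "lipschitz_chart \<Omega> W' a' b' f'" and y': "y \<in> W'"
    and der: "(f' has_real_derivative d') (at (y \<bullet> a'))" and n: "n = graph_normal a' b' d'"
    unfolding graph_normal_def by blast
  obtain K' where fr': "lipschitz_frame a' b' f' K'" and W': "open W'" "\<Omega> \<inter> W' = {x \<in> W'. x \<bullet> b' \<le> f' (x \<bullet> a')}"
    by (rule lipschitz_chart_frame[OF ch'])
  obtain K where fr: "lipschitz_frame a b f K" and W: "open W" "\<Omega> \<inter> W = {x \<in> W. x \<bullet> b \<le> f (x \<bullet> a)}"
    by (rule lipschitz_chart_frame[OF ch])
  have "tangent_normal \<Omega> y n" unfolding n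
    by (rule lipschitz_frame.tangent_normal_graph[OF fr' W' y' chart_frontier[OF ch' \<open>closed \<Omega>\<close> y(1) y'] der])
  moreover have "norm n = 1" unfolding n by (rule lipschitz_frame.norm_graph_normal[OF fr'])
  ultimately show ?R
    by (rule lipschitz_frame.graph_derivative_of_tangent_normal[OF fr W y(2) chart_frontier[OF ch \<open>closed \<Omega>\<close> y]])
qed

text \<open>Where the chart function is not differentiable the predicate under \<open>THE\<close> is
  constantly false, so the value is one fixed vector at all such points. This keeps the normal
  bounded and measurable on the whole boundary.\<close>

lemma outward_normal_chart:
  assumes ch: "lipschitz_chart \<Omega> W a b f" and "closed \<Omega>" and y: "y \<in> frontier \<Omega>" "y \<in> W"
  shows "outward_normal \<Omega> y = (if f differentiable (at (y \<bullet> a)) then graph_normal a b (deriv f (y \<bullet> a)) else (THE n. False))"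
proof (cases "f differentiable (at (y \<bullet> a))")
  case True
  then have der: "(f has_real_derivative deriv f (y \<bullet> a)) (at (y \<bullet> a))"
    using DERIV_deriv_iff_real_differentiable by blast
  have "outward_normal \<Omega> y = (THE n. \<exists>d. (f has_real_derivative d) (at (y \<bullet> a)) \<and> n = graph_normal a b d)"
    unfolding outward_normal_def chart_normal_iff[OF assms] ..
  also have "\<dots> = graph_normal a b (deriv f (y \<bullet> a))"
    by (rule the_equality) (use der DERIV_unique in blast)+
  finally show ?thesis using True by simp
next
  case False
  then have "(f has_real_derivative d) (at (y \<bullet> a)) = False" for d
    using real_differentiable_def by blast
  then show ?thesis unfolding outward_normal_def chart_normal_iff[OF assms] using False by simp
qed

section \<open>Borel measurability of derivatives\<close>

lemma differentiable_set_borel: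
  fixes f :: "real \<Rightarrow> real"
  assumes cont: "continuous_on UNIV f"
  shows "{t. f differentiable (at t)} \<in> sets borel"
proof -
  have [measurable]: "f \<in> borel_measurable borel" by (rule borel_measurable_continuous_onI[OF cont])
  have cf: "continuous_on A (\<lambda>h. f (t + h))" for A t
    by (intro continuous_on_compose2[OF cont] continuous_intros) auto
  let ?F = "\<lambda>t h. (f (t + h) - f t) / h"
  have "{t \<in> space borel. \<exists>l. (?F t \<longlongrightarrow> l) (at 0 within (UNIV - {0}))} \<in> sets borel"
  proof (rule limit_exists_measurable[where Q = "\<rat> - {0}"])
    show "countable (\<rat> - {0::real})" using countable_rat by blast
    show "0 islimpt (UNIV - {0::real})" by (simp add: islimpt_punctured[symmetric])
    fix t s d :: real assume s: "s \<in> UNIV - {0}" and d: "0 < d"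
    have "continuous_on (- {0}) (?F t)" by (intro continuous_intros cf) auto
    then have "isCont (?F t) s" using s by (simp add: continuous_on_eq_continuous_at open_Compl)
    then obtain \<delta> where \<delta>: "0 < \<delta>" "\<And>q. dist q s < \<delta> \<Longrightarrow> dist (?F t q) (?F t s) < d"
      using d unfolding continuous_at_eps_delta by blast
    \<comment> \<open>The bound |s| keeps the rational q on the same side of 0 as s.\<close>
    let ?m = "min (min d \<delta>) \<bar>s\<bar>"
    have m: "0 < ?m" using d \<delta> s by auto
    obtain q where q: "q \<in> \<rat>" "s < q" "q < s + ?m" using Rats_dense_in_real[of s "s + ?m"] m by auto
    then have "q \<in> \<rat> - {0}" "\<bar>q - s\<bar> < d" "dist q s < \<delta>" by (auto simp: dist_real_def)
    then show "\<exists>q\<in>\<rat> - {0}. \<bar>q - s\<bar> < d \<and> dist (?F t q) (?F t s) < d" using \<delta>(2) by blast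
  qed (auto intro!: borel_measurable_divide borel_measurable_diff measurable_compose[OF _ borel_measurable_continuous_onI[OF cont]])
  also have "{t \<in> space borel. \<exists>l. (?F t \<longlongrightarrow> l) (at 0 within (UNIV - {0}))} = {t. f differentiable (at t)}"
  proof -
    have "at 0 within (UNIV - {0}) = at (0::real)" by (simp add: at_within_def)
    then show ?thesis by (simp add: real_differentiable_def DERIV_def)
  qed
  finally show ?thesis .
qed

lemma deriv_measurable:
  fixes f :: "real \<Rightarrow> real"
  assumes cont: "continuous_on UNIV f"
  shows "(\<lambda>t. if f differentiable (at t) then deriv f t else 0) \<in> borel_measurable borel"
proof -
  have [measurable]: "f \<in> borel_measurable borel" by (rule borel_measurable_continuous_onI[OF cont])
  have [measurable]: "Measurable.pred borel (\<lambda>t. f differentiable (at t))"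
    using differentiable_set_borel[OF cont] by (simp add: pred_def)
  have "(\<lambda>t. if f differentiable (at t) then lim (\<lambda>n. (f (t + 1 / Suc n) - f t) / (1 / Suc n)) else 0) \<in> borel_measurable borel"
    by measurable
  also have "(\<lambda>t. if f differentiable (at t) then lim (\<lambda>n. (f (t + 1 / Suc n) - f t) / (1 / Suc n)) else 0)
     = (\<lambda>t. if f differentiable (at t) then deriv f t else 0)"
  proof (intro ext if_cong refl)
    fix t assume "f differentiable (at t)"
    then have "(f has_real_derivative deriv f t) (at t)" using DERIV_deriv_iff_real_differentiable by blast
    then have "((\<lambda>h. (f (t + h) - f t) / h) \<longlongrightarrow> deriv f t) (at 0)" by (simp add: DERIV_def)
    moreover have "filterlim (\<lambda>n. 1 / real (Suc n)) (at 0) sequentially"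
      unfolding filterlim_at using LIMSEQ_Suc[OF lim_1_over_n] by auto
    ultimately have "(\<lambda>n. (f (t + 1 / Suc n) - f t) / (1 / Suc n)) \<longlonglongrightarrow> deriv f t"
      by (rule filterlim_compose)
    then show "lim (\<lambda>n. (f (t + 1 / Suc n) - f t) / (1 / Suc n)) = deriv f t" by (rule limI)
  qed
  finally show ?thesis .
qed

section \<open>The boundary of a Lipschitz domain\<close>

locale lipschitz_domain =
  fixes \<Omega> :: "(real^2) set"
  assumes compact: "compact \<Omega>" and boundary: "lipschitz_boundary \<Omega>"
begin

abbreviation \<Gamma> :: "(real^2) set" where "\<Gamma> \<equiv> frontier \<Omega>"

text \<open>Arc length of \<Gamma> as a Borel measure on the whole plane.
  \<open>arclength_on\<close> lives on the subspace \<Gamma> and is completed, which does not suit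
  product measurability of kernels.\<close>

definition N :: "(real^2) measure" where "N = density hausdorff1 (indicator \<Gamma>)"

text \<open>The doubled radius provides the collar of \<open>truncated_dipole_local\<close>: points
  near the centre and points outside the chart are at least \<rho> apart.\<close>

definition chart_ball :: "real^2 \<Rightarrow> real \<Rightarrow> bool" where
  "chart_ball p \<rho> \<longleftrightarrow> 0 < \<rho> \<and> (\<exists>W a b f. lipschitz_chart \<Omega> W a b f \<and> ball p (2 * \<rho>) \<subseteq> W)"

lemma closed: "closed \<Omega>" using compact by (rule compact_imp_closed)

lemma compact_\<Gamma>: "compact \<Gamma>" using compact by (rule compact_frontier)

lemma \<Gamma>_borel [measurable, simp]: "\<Gamma> \<in> sets borel" by simp

lemma sets_N [simp, measurable_cong]: "sets N = sets borel" by (simp add: N_def)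

lemma emeasure_N: "A \<in> sets borel \<Longrightarrow> emeasure N A = emeasure hausdorff1 (\<Gamma> \<inter> A)"
  unfolding N_def by (subst emeasure_density) (auto simp: indicator_inter_arith[symmetric])

lemma AE_N: "AE x in N. x \<in> \<Gamma>"
  unfolding N_def by (subst AE_density) (auto simp: indicator_def)

lemma finite_chart_cover:
  obtains I \<rho> where "finite I" "\<And>p. p \<in> I \<Longrightarrow> chart_ball p (\<rho> p)" "\<Gamma> \<subseteq> (\<Union>p\<in>I. ball p (\<rho> p))"
proof -
  have "\<forall>p\<in>\<Gamma>. \<exists>\<rho>. chart_ball p \<rho>"
  proof
    fix p assume "p \<in> \<Gamma>"
    then obtain W a b f where W: "p \<in> W" and ch: "lipschitz_chart \<Omega> W a b f"
      using boundary unfolding lipschitz_boundary_def by blast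
    have "open W" using ch by (simp add: lipschitz_chart_def)
    then obtain e where e: "0 < e" "ball p e \<subseteq> W" using W openE by blast
    then have "chart_ball p (e / 2)" unfolding chart_ball_def using ch by auto
    then show "\<exists>\<rho>. chart_ball p \<rho>" ..
  qed
  then obtain \<rho> where \<rho>: "\<And>p. p \<in> \<Gamma> \<Longrightarrow> chart_ball p (\<rho> p)" by metis
  have "\<Gamma> \<subseteq> (\<Union>p\<in>\<Gamma>. ball p (\<rho> p))" using \<rho> by (force simp: chart_ball_def)
  then obtain I where "I \<subseteq> \<Gamma>" "finite I" "\<Gamma> \<subseteq> (\<Union>p\<in>I. ball p (\<rho> p))"
    using compactE_image[OF compact_\<Gamma>, of \<Gamma> "\<lambda>p. ball p (\<rho> p)"] by auto
  then show ?thesis using that[of I \<rho>] \<rho> by auto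
qed

lemma chart_ball_frame:
  assumes "chart_ball p \<rho>"
  obtains W a b f K where "lipschitz_frame a b f K" "lipschitz_chart \<Omega> W a b f" "0 < \<rho>" "ball p (2 * \<rho>) \<subseteq> W"
    "\<Gamma> \<inter> ball p (2 * \<rho>) \<subseteq> lipschitz_frame.graph a b f"
proof -
  obtain W a b f where ch: "lipschitz_chart \<Omega> W a b f" and sub: "ball p (2 * \<rho>) \<subseteq> W" and \<rho>: "0 < \<rho>"
    using assms by (auto simp: chart_ball_def)
  obtain K where fr: "lipschitz_frame a b f K" by (rule lipschitz_chart_frame[OF ch])
  interpret lipschitz_frame a b f K by fact
  have "\<Gamma> \<inter> ball p (2 * \<rho>) \<subseteq> graph"
    using chart_frontier[OF ch closed] sub by (auto simp: graph_def)
  then show ?thesis using that[OF fr ch \<rho> sub] by simp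
qed

lemma growth_exists: "\<exists>c\<ge>0. \<forall>x r. 0 < r \<longrightarrow> emeasure N (cball x r) \<le> ennreal (c * r)"
proof -
  obtain I \<rho> where I: "finite I" and cb: "\<And>p. p \<in> I \<Longrightarrow> chart_ball p (\<rho> p)" and cov: "\<Gamma> \<subseteq> (\<Union>p\<in>I. ball p (\<rho> p))"
    by (rule finite_chart_cover) blast
  have ex: "\<forall>p\<in>I. \<exists>c. 0 \<le> c \<and> (\<forall>x r. 0 < r \<longrightarrow> emeasure hausdorff1 (\<Gamma> \<inter> ball p (\<rho> p) \<inter> cball x r) \<le> ennreal (c * r))"
  proof
    fix p assume p: "p \<in> I"
    obtain W a b f K where fr: "lipschitz_frame a b f K" and "lipschitz_chart \<Omega> W a b f" and \<rho>: "0 < \<rho> p"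
      and "ball p (2 * \<rho> p) \<subseteq> W" and g: "\<Gamma> \<inter> ball p (2 * \<rho> p) \<subseteq> lipschitz_frame.graph a b f"
      by (rule chart_ball_frame[OF cb[OF p]])
    interpret lipschitz_frame a b f K by fact
    have "emeasure hausdorff1 (\<Gamma> \<inter> ball p (\<rho> p) \<inter> cball x r) \<le> ennreal (2 * (1 + K) * r)" if r: "0 < r" for x r
    proof (rule order_trans[OF emeasure_hausdorff1_le hausdorff1_outer_graph[OF r]])
      have "ball p (\<rho> p) \<subseteq> ball p (2 * \<rho> p)" using \<rho> by (intro subset_ball) auto
      then show "\<Gamma> \<inter> ball p (\<rho> p) \<inter> cball x r \<subseteq> graph \<inter> cball x r" using g by auto
    qed
    then show "\<exists>c. 0 \<le> c \<and> (\<forall>x r. 0 < r \<longrightarrow> emeasure hausdorff1 (\<Gamma> \<inter> ball p (\<rho> p) \<inter> cball x r) \<le> ennreal (c * r))"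
      using K_nonneg by (intro exI[of _ "2 * (1 + K)"]) auto
  qed
  obtain c where cc: "\<forall>p\<in>I. 0 \<le> c p \<and> (\<forall>x r. 0 < r \<longrightarrow> emeasure hausdorff1 (\<Gamma> \<inter> ball p (\<rho> p) \<inter> cball x r) \<le> ennreal (c p * r))"
    using bchoice[OF ex] by (rule exE) (rule that)
  have c: "0 \<le> c p" "0 < r \<Longrightarrow> emeasure hausdorff1 (\<Gamma> \<inter> ball p (\<rho> p) \<inter> cball x r) \<le> ennreal (c p * r)"
    if "p \<in> I" for p x r
    using bspec[OF cc that] by simp_all
  have "emeasure N (cball x r) \<le> ennreal ((\<Sum>p\<in>I. c p) * r)" if r: "0 < r" for x r
  proof -
    have "emeasure N (cball x r) = emeasure hausdorff1 (\<Gamma> \<inter> cball x r)" by (rule emeasure_N) simp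
    also have "\<dots> \<le> emeasure hausdorff1 (\<Union>p\<in>I. \<Gamma> \<inter> ball p (\<rho> p) \<inter> cball x r)"
    proof (rule emeasure_mono)
      show "(\<Union>p\<in>I. \<Gamma> \<inter> ball p (\<rho> p) \<inter> cball x r) \<in> sets hausdorff1"
        using I by (intro sets.finite_UN) auto
    qed (use cov in auto)
    also have "\<dots> \<le> (\<Sum>p\<in>I. emeasure hausdorff1 (\<Gamma> \<inter> ball p (\<rho> p) \<inter> cball x r))"
      by (intro emeasure_subadditive_finite I) auto
    also have "\<dots> \<le> (\<Sum>p\<in>I. ennreal (c p * r))" by (intro sum_mono c r)
    also have "\<dots> = ennreal ((\<Sum>p\<in>I. c p) * r)"
      using c r by (subst sum_ennreal) (auto simp: sum_distrib_right)
    finally show ?thesis .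
  qed
  then show ?thesis using c(1) by (intro exI[of _ "\<Sum>p\<in>I. c p"]) (auto intro: sum_nonneg)
qed

definition c :: real where "c = (SOME c. c \<ge> 0 \<and> (\<forall>x r. 0 < r \<longrightarrow> emeasure N (cball x r) \<le> ennreal (c * r)))"

lemma c: "0 \<le> c" "0 < r \<Longrightarrow> emeasure N (cball x r) \<le> ennreal (c * r)"
  using someI_ex[OF growth_exists] unfolding c_def[symmetric] by auto

sublocale growth_measure N c
proof (rule growth_measure.intro)
  obtain R where R: "0 < R" "\<And>x. x \<in> \<Gamma> \<Longrightarrow> norm x \<le> R"
    using compact_imp_bounded[OF compact_\<Gamma>] unfolding bounded_pos by blast
  show "finite_measure N"
  proof (rule finite_measureI)
    have "emeasure N (space N) = emeasure N UNIV" by (simp add: N_def)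
    also have "\<dots> = emeasure hausdorff1 (\<Gamma> \<inter> UNIV)" by (rule emeasure_N) simp
    also have "\<Gamma> \<inter> UNIV = \<Gamma> \<inter> cball 0 R" using R(2) by auto
    also have "emeasure hausdorff1 \<dots> = emeasure N (cball 0 R)" by (rule emeasure_N[symmetric]) simp
    also have "\<dots> \<le> ennreal (c * R)" by (rule c(2)[OF R(1)])
    finally show "emeasure N (space N) \<noteq> \<infinity>" by (auto simp: top_unique)
  qed
  show "growth_measure_axioms N c"
    by (rule growth_measure_axioms.intro) (use c in auto)
qed

section \<open>The normal as a bounded Borel field\<close>

definition nrm :: "real^2 \<Rightarrow> real^2" where "nrm y = indicator \<Gamma> y *\<^sub>R outward_normal \<Omega> y"

text \<open>The second argument of \<open>max\<close> is the norm of the default value taken at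
  points of non-differentiability.\<close>

definition nrm_bound :: real where "nrm_bound = max 1 (norm (THE n :: real^2. False))"

lemma norm_nrm: "norm (nrm y) \<le> nrm_bound"
proof (cases "y \<in> \<Gamma>")
  case True
  then obtain W a b f where W: "y \<in> W" and ch: "lipschitz_chart \<Omega> W a b f"
    using boundary unfolding lipschitz_boundary_def by blast
  obtain K where fr: "lipschitz_frame a b f K" by (rule lipschitz_chart_frame[OF ch])
  show ?thesis unfolding nrm_def outward_normal_chart[OF ch closed True W]
    using True lipschitz_frame.norm_graph_normal[OF fr] by (auto simp: nrm_bound_def)
qed (simp add: nrm_def nrm_bound_def)

lemma nrm_measurable [measurable]: "nrm \<in> borel_measurable borel"
proof -
  obtain I \<rho> where I: "finite I" and cb: "\<And>p. p \<in> I \<Longrightarrow> chart_ball p (\<rho> p)" and cov: "\<Gamma> \<subseteq> (\<Union>p\<in>I. ball p (\<rho> p))"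
    by (rule finite_chart_cover) blast
  let ?C = "insert (- \<Gamma>) ((\<lambda>p. \<Gamma> \<inter> ball p (\<rho> p)) ` I)"
  show ?thesis
  proof (rule measurable_piecewise_restrict[of ?C])
    show "countable ?C" using I by (simp add: countable_finite)
    show "A \<inter> space borel \<in> sets borel" if "A \<in> ?C" for A using that by auto
    show "space borel \<subseteq> \<Union>?C" using cov by auto
    fix A assume "A \<in> ?C"
    then consider "A = - \<Gamma>" | p where "p \<in> I" "A = \<Gamma> \<inter> ball p (\<rho> p)" by blast
    then show "nrm \<in> borel_measurable (restrict_space borel A)"
    proof cases
      case 1
      have "nrm \<in> borel_measurable (restrict_space borel A) \<longleftrightarrow> (\<lambda>_. 0 :: real^2) \<in> borel_measurable (restrict_space borel A)"
        using 1 by (intro measurable_cong) (auto simp: nrm_def space_restrict_space)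
      then show ?thesis by simp
    next
      case 2
      obtain W a b f K where fr: "lipschitz_frame a b f K" and ch: "lipschitz_chart \<Omega> W a b f" and \<rho>: "0 < \<rho> p" and sub: "ball p (2 * \<rho> p) \<subseteq> W"
        and "\<Gamma> \<inter> ball p (2 * \<rho> p) \<subseteq> lipschitz_frame.graph a b f"
        by (rule chart_ball_frame[OF cb[OF 2(1)]])
      interpret lipschitz_frame a b f K by fact
      have fc: "continuous_on UNIV f" by (rule lipschitz_on_continuous_on[OF lip])
      have [measurable]: "Measurable.pred borel (\<lambda>t. f differentiable (at t))"
        using differentiable_set_borel[OF fc] by (simp add: pred_def)
      note [measurable] = deriv_measurable[OF fc]
      let ?D = "\<lambda>t. if f differentiable (at t) then deriv f t else 0"
      let ?h = "\<lambda>y. if f differentiable (at (y \<bullet> a)) then graph_normal a b (?D (y \<bullet> a)) else (THE n. False)"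
      have [measurable]: "graph_normal a b \<in> borel_measurable borel"
        unfolding graph_normal_def by measurable
      have "?h \<in> borel_measurable borel" by measurable
      then have h: "?h \<in> borel_measurable (restrict_space borel A)" by (rule measurable_restrict_space1)
      have "nrm y = ?h y" if "y \<in> A" for y
      proof -
        have y: "y \<in> \<Gamma>" "y \<in> W" using that 2(2) \<rho> sub by (auto intro!: subsetD[OF sub])
        show ?thesis unfolding nrm_def outward_normal_chart[OF ch closed y] using y by simp
      qed
      then have "nrm \<in> borel_measurable (restrict_space borel A) \<longleftrightarrow> ?h \<in> borel_measurable (restrict_space borel A)"
        by (intro measurable_cong) (auto simp: space_restrict_space)
      then show ?thesis using h by simp
    qed
  qed
qed

lemma sqn_N_indicator: "sqn N h = sqn N (\<lambda>x. indicator \<Gamma> x * h x)"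
  unfolding sqn_def by (intro nn_integral_cong_AE) (use AE_N in \<open>auto elim!: eventually_mono\<close>)

text \<open>A finite sum over charts. The constant is chosen before \<epsilon>, as the passage to
  the principal value demands.\<close>

lemma truncated_dipole_exists:
  "\<exists>C\<ge>0. \<forall>\<epsilon> \<phi>. 0 < \<epsilon> \<longrightarrow> \<phi> \<in> borel_measurable borel \<longrightarrow> sqn N \<phi> < \<infinity> \<longrightarrow> (\<forall>y. y \<notin> \<Gamma> \<longrightarrow> \<phi> y = 0) \<longrightarrow>
     sqn N (\<lambda>x. \<integral>y. of_real (dipole nrm \<epsilon> x y) * \<phi> y \<partial>N) \<le> ennreal C * sqn N \<phi>"
proof -
  obtain I \<rho> where I: "finite I" and cb: "\<And>p. p \<in> I \<Longrightarrow> chart_ball p (\<rho> p)" and cov: "\<Gamma> \<subseteq> (\<Union>p\<in>I. ball p (\<rho> p))"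
    by (rule finite_chart_cover) blast
  let ?T = "\<lambda>\<epsilon> \<phi> x. \<integral>y. of_real (dipole nrm \<epsilon> x y) * \<phi> y \<partial>N"
  let ?Q = "\<lambda>p C. 0 \<le> C \<and> (\<forall>\<epsilon> \<phi>. 0 < \<epsilon> \<longrightarrow> \<phi> \<in> borel_measurable borel \<longrightarrow> sqn N \<phi> < \<infinity> \<longrightarrow> (\<forall>y. y \<notin> \<Gamma> \<longrightarrow> \<phi> y = 0) \<longrightarrow>
     sqn N (\<lambda>x. indicator (\<Gamma> \<inter> ball p (\<rho> p)) x * ?T \<epsilon> \<phi> x) \<le> ennreal C * sqn N \<phi>)"
  have ex: "\<forall>p\<in>I. \<exists>C. ?Q p C"
  proof
    fix p assume p: "p \<in> I"
    obtain W a b f K where fr: "lipschitz_frame a b f K" and "lipschitz_chart \<Omega> W a b f" and \<rho>: "0 < \<rho> p"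
      and "ball p (2 * \<rho> p) \<subseteq> W" and g: "\<Gamma> \<inter> ball p (2 * \<rho> p) \<subseteq> lipschitz_frame.graph a b f"
      by (rule chart_ball_frame[OF cb[OF p]])
    interpret fr: lipschitz_frame a b f K by fact
    interpret growth_graph N c a b f K ..
    have gc: "0 \<le> graph_const" by (simp add: graph_const_def)
    show "\<exists>C. ?Q p C"
    proof (intro exI conjI allI impI)
      show "0 \<le> 2 * (graph_const * nrm_bound\<^sup>2) + 2 * (nrm_bound / \<rho> p * measure N UNIV)\<^sup>2"
        using gc by simp
      fix \<epsilon> :: real and \<phi> :: "real^2 \<Rightarrow> complex"
      assume "0 < \<epsilon>" "\<phi> \<in> borel_measurable borel" "sqn N \<phi> < \<infinity>" "\<forall>y. y \<notin> \<Gamma> \<longrightarrow> \<phi> y = 0"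
      then show "sqn N (\<lambda>x. indicator (\<Gamma> \<inter> ball p (\<rho> p)) x * ?T \<epsilon> \<phi> x)
          \<le> ennreal (2 * (graph_const * nrm_bound\<^sup>2) + 2 * (nrm_bound / \<rho> p * measure N UNIV)\<^sup>2) * sqn N \<phi>"
        by (intro truncated_dipole_local \<rho> g nrm_measurable norm_nrm) auto
    qed
  qed
  obtain C where CC: "\<forall>p\<in>I. ?Q p (C p)"
    using bchoice[OF ex] by (rule exE) (rule that)
  have C: "0 \<le> C p"
    "0 < \<epsilon> \<Longrightarrow> \<phi> \<in> borel_measurable borel \<Longrightarrow> sqn N \<phi> < \<infinity> \<Longrightarrow> (\<And>y. y \<notin> \<Gamma> \<Longrightarrow> \<phi> y = 0) \<Longrightarrow>
     sqn N (\<lambda>x. indicator (\<Gamma> \<inter> ball p (\<rho> p)) x * ?T \<epsilon> \<phi> x) \<le> ennreal (C p) * sqn N \<phi>" if "p \<in> I" for p \<epsilon> \<phi>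
    using bspec[OF CC that] by simp_all
  have "sqn N (?T \<epsilon> \<phi>) \<le> ennreal (\<Sum>p\<in>I. C p) * sqn N \<phi>"
    if e: "0 < \<epsilon>" and [measurable]: "\<phi> \<in> borel_measurable borel" and fin: "sqn N \<phi> < \<infinity>" and supp: "\<And>y. y \<notin> \<Gamma> \<Longrightarrow> \<phi> y = 0" for \<epsilon> \<phi>
  proof -
    have [measurable]: "\<Gamma> \<inter> ball p (\<rho> p) \<in> sets borel" for p by simp
    have Tm [measurable]: "?T \<epsilon> \<phi> \<in> borel_measurable borel" by measurable
    have "sqn N (?T \<epsilon> \<phi>) = sqn N (\<lambda>x. indicator \<Gamma> x * ?T \<epsilon> \<phi> x)" by (rule sqn_N_indicator)
    also have "\<dots> \<le> (\<integral>\<^sup>+ x. (\<Sum>p\<in>I. ennreal ((cmod (indicator (\<Gamma> \<inter> ball p (\<rho> p)) x * ?T \<epsilon> \<phi> x))\<^sup>2)) \<partial>N)"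
      unfolding sqn_def
    proof (rule nn_integral_mono)
      fix x
      let ?g = "\<lambda>p. ennreal ((cmod (indicator (\<Gamma> \<inter> ball p (\<rho> p)) x * ?T \<epsilon> \<phi> x))\<^sup>2)"
      show "ennreal ((cmod (indicator \<Gamma> x * ?T \<epsilon> \<phi> x))\<^sup>2) \<le> (\<Sum>p\<in>I. ?g p)"
      proof (cases "x \<in> \<Gamma>")
        case True
        then obtain p where p: "p \<in> I" "x \<in> ball p (\<rho> p)" using cov by blast
        then have "ennreal ((cmod (indicator \<Gamma> x * ?T \<epsilon> \<phi> x))\<^sup>2) = ?g p" using True by simp
        also have "\<dots> \<le> (\<Sum>p\<in>I. ?g p)" using p I by (intro member_le_sum) auto
        finally show ?thesis .
      qed simp
    qed
    also have "\<dots> = (\<Sum>p\<in>I. sqn N (\<lambda>x. indicator (\<Gamma> \<inter> ball p (\<rho> p)) x * ?T \<epsilon> \<phi> x))"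
      unfolding sqn_def by (rule nn_integral_sum) measurable
    also have "\<dots> \<le> (\<Sum>p\<in>I. ennreal (C p) * sqn N \<phi>)"
      by (intro sum_mono C(2) e fin supp) auto
    also have "\<dots> = ennreal (\<Sum>p\<in>I. C p) * sqn N \<phi>"
      using C(1) by (simp add: sum_distrib_right[symmetric] sum_ennreal)
    finally show ?thesis .
  qed
  then show ?thesis using C(1) by (intro exI[of _ "\<Sum>p\<in>I. C p"]) (auto intro: sum_nonneg)
qed

end

section \<open>The Hankel function\<close>

definition J_coeff :: "nat \<Rightarrow> real" where "J_coeff m = (-1) ^ m / (fact m)\<^sup>2"

definition S_coeff :: "nat \<Rightarrow> real" where "S_coeff m = (-1) ^ m * harm m / (fact m)\<^sup>2"

text \<open>The two power series of \<^const>\<open>bessel_J0\<close> and \<^const>\<open>bessel_Y0\<close> in the variable \<open>z\<^sup>2 / 4\<close>.\<close>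

definition J_series :: "real \<Rightarrow> real" where "J_series w = (\<Sum>m. J_coeff m * w ^ m)"

definition S_series :: "real \<Rightarrow> real" where "S_series w = (\<Sum>m. S_coeff m * w ^ m)"

definition J_series' :: "real \<Rightarrow> real" where "J_series' w = (\<Sum>m. diffs J_coeff m * w ^ m)"

definition S_series' :: "real \<Rightarrow> real" where "S_series' w = (\<Sum>m. diffs S_coeff m * w ^ m)"

lemma summable_if_le_inverse_fact:
  fixes cf :: "nat \<Rightarrow> real"
  assumes "\<And>m. \<bar>cf m\<bar> \<le> 1 / fact m"
  shows "summable (\<lambda>m. cf m * w ^ m)"
proof (rule summable_comparison_test')
  show "summable (\<lambda>m. (1 / fact m) * \<bar>w\<bar> ^ m)"
    using summable_exp[of "\<bar>w\<bar>"] by (simp add: field_simps)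
  show "norm (cf m * w ^ m) \<le> (1 / fact m) * \<bar>w\<bar> ^ m" if "0 \<le> m" for m
    using mult_right_mono[OF assms[of m], of "\<bar>w\<bar> ^ m"] by (simp add: abs_mult power_abs)
qed

lemma harm_le: "harm m \<le> real m"
proof (induction m)
  case (Suc m)
  have "inverse (real (Suc m)) \<le> 1" by (simp add: inverse_le_1_iff)
  then show ?case using Suc by (simp add: harm_Suc)
qed (simp add: harm_def)

lemma summable_J: "summable (\<lambda>m. J_coeff m * w ^ m)"
proof (rule summable_if_le_inverse_fact)
  fix m
  have "1 / (fact m)\<^sup>2 \<le> 1 / (fact m :: real)"
    by (intro frac_le) (auto simp: power2_eq_square)
  then show "\<bar>J_coeff m\<bar> \<le> 1 / fact m" by (simp add: J_coeff_def abs_mult power_abs)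
qed

lemma summable_S: "summable (\<lambda>m. S_coeff m * w ^ m)"
proof (rule summable_if_le_inverse_fact)
  fix m
  have "real m \<le> real (fact m)" by (simp only: of_nat_le_iff fact_ge_self)
  then have "harm m \<le> (fact m :: real)" using harm_le[of m] by simp
  then have "harm m / (fact m)\<^sup>2 \<le> fact m / (fact m :: real)\<^sup>2" by (intro divide_right_mono) auto
  also have "\<dots> = 1 / fact m" by (simp add: power2_eq_square)
  finally show "\<bar>S_coeff m\<bar> \<le> 1 / fact m" by (simp add: S_coeff_def abs_mult power_abs harm_nonneg)
qed

lemma DERIV_J: "(J_series has_real_derivative J_series' w) (at w)"
  unfolding J_series_def[abs_def] J_series'_def
  by (rule termdiffs_strong_converges_everywhere) (rule summable_J)

lemma DERIV_S: "(S_series has_real_derivative S_series' w) (at w)"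
  unfolding S_series_def[abs_def] S_series'_def
  by (rule termdiffs_strong_converges_everywhere) (rule summable_S)

lemma continuous_series:
  "continuous_on UNIV J_series" "continuous_on UNIV S_series"
  "continuous_on UNIV J_series'" "continuous_on UNIV S_series'"
proof -
  show "continuous_on UNIV J_series" by (intro continuous_at_imp_continuous_on ballI DERIV_isCont[OF DERIV_J])
  show "continuous_on UNIV S_series" by (intro continuous_at_imp_continuous_on ballI DERIV_isCont[OF DERIV_S])
  have "summable (\<lambda>m. diffs J_coeff m * w ^ m)" "summable (\<lambda>m. diffs S_coeff m * w ^ m)" for w
    using termdiff_converges_all[OF summable_J] termdiff_converges_all[OF summable_S] by auto
  then show "continuous_on UNIV J_series'" "continuous_on UNIV S_series'"
    unfolding J_series'_def[abs_def] S_series'_def[abs_def]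
    by (auto intro!: continuous_at_imp_continuous_on isCont_powser_converges_everywhere)
qed

lemma series_measurable [measurable]:
  "J_series \<in> borel_measurable borel" "S_series \<in> borel_measurable borel"
  "J_series' \<in> borel_measurable borel" "S_series' \<in> borel_measurable borel"
  by (auto intro: borel_measurable_continuous_onI continuous_series)

lemma series_bounded:
  obtains B where "0 \<le> B" "\<And>w. 0 \<le> w \<Longrightarrow> w \<le> X \<Longrightarrow> \<bar>J_series w\<bar> \<le> B" "\<And>w. 0 \<le> w \<Longrightarrow> w \<le> X \<Longrightarrow> \<bar>S_series w\<bar> \<le> B"
    "\<And>w. 0 \<le> w \<Longrightarrow> w \<le> X \<Longrightarrow> \<bar>J_series' w\<bar> \<le> B" "\<And>w. 0 \<le> w \<Longrightarrow> w \<le> X \<Longrightarrow> \<bar>S_series' w\<bar> \<le> B"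
proof -
  have *: "\<exists>B. \<forall>w\<in>{0..X}. \<bar>g w\<bar> \<le> B" if "continuous_on UNIV g" for g :: "real \<Rightarrow> real"
  proof -
    have "compact (g ` {0..X})" by (intro compact_continuous_image continuous_on_subset[OF that]) auto
    from compact_imp_bounded[OF this] show ?thesis by (auto simp: bounded_iff)
  qed
  obtain B1 where B1: "\<forall>w\<in>{0..X}. \<bar>J_series w\<bar> \<le> B1" using *[OF continuous_series(1)] ..
  obtain B2 where B2: "\<forall>w\<in>{0..X}. \<bar>S_series w\<bar> \<le> B2" using *[OF continuous_series(2)] ..
  obtain B3 where B3: "\<forall>w\<in>{0..X}. \<bar>J_series' w\<bar> \<le> B3" using *[OF continuous_series(3)] ..
  obtain B4 where B4: "\<forall>w\<in>{0..X}. \<bar>S_series' w\<bar> \<le> B4" using *[OF continuous_series(4)] ..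
  let ?B = "\<bar>B1\<bar> + \<bar>B2\<bar> + \<bar>B3\<bar> + \<bar>B4\<bar>"
  show ?thesis
  proof (rule that[of ?B])
    fix w assume "0 \<le> w" "w \<le> X"
    then have w: "w \<in> {0..X}" by simp
    show "\<bar>J_series w\<bar> \<le> ?B" using bspec[OF B1 w] by linarith
    show "\<bar>S_series w\<bar> \<le> ?B" using bspec[OF B2 w] by linarith
    show "\<bar>J_series' w\<bar> \<le> ?B" using bspec[OF B3 w] by linarith
    show "\<bar>S_series' w\<bar> \<le> ?B" using bspec[OF B4 w] by linarith
  qed simp
qed

lemma bessel_J0_series: "bessel_J0 z = J_series (z\<^sup>2 / 4)"
proof -
  have "(z / 2) ^ (2 * m) = (z\<^sup>2 / 4) ^ m" for m by (simp add: power_mult power_divide)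
  then show ?thesis by (simp add: bessel_J0_def J_series_def J_coeff_def)
qed

lemma bessel_Y0_series: "bessel_Y0 z = 2 / pi * ((ln (z / 2) + euler_mascheroni) * J_series (z\<^sup>2 / 4) - S_series (z\<^sup>2 / 4))"
proof -
  have "(z / 2) ^ (2 * m) = (z\<^sup>2 / 4) ^ m" for m by (simp add: power_mult power_divide)
  then show ?thesis by (simp add: bessel_Y0_def bessel_J0_series S_series_def S_coeff_def)
qed

text \<open>The derivative of \<open>hankel1_0\<close> without its singular part 2 i / (\<pi> z).
  The singularity arises from differentiating the logarithm and is isolated by writing J as 1 + (J -
  1).\<close>

definition hankel_rem :: "real \<Rightarrow> complex" where
  "hankel_rem z = Complex (J_series' (z\<^sup>2 / 4) * (z / 2))
     (2 / pi * ((J_series (z\<^sup>2 / 4) - 1) / z + (ln (z / 2) + euler_mascheroni) * (J_series' (z\<^sup>2 / 4) * (z / 2)) - S_series' (z\<^sup>2 / 4) * (z / 2)))"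

lemma hankel_measurable [measurable]: "hankel1_0 \<in> borel_measurable borel" "hankel_rem \<in> borel_measurable borel"
  unfolding hankel1_0_def[abs_def] hankel_rem_def[abs_def] Complex_eq bessel_J0_series bessel_Y0_series by measurable

lemma hankel_has_derivative:
  assumes z: "0 < z"
  shows "(hankel1_0 has_vector_derivative (\<i> * of_real (2 / (pi * z)) + hankel_rem z)) (at z)"
proof -
  have q: "((\<lambda>z::real. z\<^sup>2 / 4) has_real_derivative z / 2) (at z)"
    by (auto intro!: derivative_eq_intros)
  have J: "((\<lambda>z. J_series (z\<^sup>2 / 4)) has_real_derivative J_series' (z\<^sup>2 / 4) * (z / 2)) (at z)"
    by (rule DERIV_chain2[OF DERIV_J q])
  have S: "((\<lambda>z. S_series (z\<^sup>2 / 4)) has_real_derivative S_series' (z\<^sup>2 / 4) * (z / 2)) (at z)"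
    by (rule DERIV_chain2[OF DERIV_S q])
  have l: "((\<lambda>z. ln (z / 2) + euler_mascheroni) has_real_derivative 1 / z) (at z)"
    using z by (auto intro!: derivative_eq_intros)
  have "((\<lambda>z. 2 / pi * ((ln (z / 2) + euler_mascheroni) * J_series (z\<^sup>2 / 4) - S_series (z\<^sup>2 / 4))) has_real_derivative
     2 / pi * ((1 / z * J_series (z\<^sup>2 / 4) + J_series' (z\<^sup>2 / 4) * (z / 2) * (ln (z / 2) + euler_mascheroni)) - S_series' (z\<^sup>2 / 4) * (z / 2))) (at z)"
    by (intro DERIV_cmult DERIV_diff DERIV_mult l J S)
  also have "2 / pi * ((1 / z * J_series (z\<^sup>2 / 4) + J_series' (z\<^sup>2 / 4) * (z / 2) * (ln (z / 2) + euler_mascheroni)) - S_series' (z\<^sup>2 / 4) * (z / 2))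
     = Im (\<i> * of_real (2 / (pi * z)) + hankel_rem z)"
    using z by (simp add: hankel_rem_def field_simps)
  finally have Y: "((\<lambda>z. Im (hankel1_0 z)) has_real_derivative Im (\<i> * of_real (2 / (pi * z)) + hankel_rem z)) (at z)"
    by (simp add: hankel1_0_def bessel_Y0_series)
  have X: "((\<lambda>z. Re (hankel1_0 z)) has_real_derivative Re (\<i> * of_real (2 / (pi * z)) + hankel_rem z)) (at z)"
    using J by (simp add: hankel1_0_def bessel_J0_series hankel_rem_def)
  show ?thesis unfolding has_vector_derivative_complex_iff using X Y by simp
qed

lemma cmod_Complex_le: "cmod (Complex u v) \<le> \<bar>u\<bar> + \<bar>v\<bar>"
  using cmod_le[of "Complex u v"] by simp

text \<open>Two terms need care near 0. In (J - 1) / z the numerator is of order z^2 by the mean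
  value inequality, as the series is 1 at 0 and its argument is z^2 / 4. The logarithm occurs only
  with a factor z.\<close>

lemma hankel_rem_bounded: "\<exists>C\<ge>0. \<forall>z. 0 < z \<longrightarrow> z \<le> Z \<longrightarrow> cmod (hankel_rem z) \<le> C"
proof -
  obtain B where B: "0 \<le> B" "\<And>w. 0 \<le> w \<Longrightarrow> w \<le> Z\<^sup>2 / 4 \<Longrightarrow> \<bar>J_series' w\<bar> \<le> B" "\<And>w. 0 \<le> w \<Longrightarrow> w \<le> Z\<^sup>2 / 4 \<Longrightarrow> \<bar>S_series' w\<bar> \<le> B"
    by (rule series_bounded[of "Z\<^sup>2 / 4"]) blast
  let ?e = "\<bar>euler_mascheroni :: real\<bar>"
  let ?C = "B * Z + 2 / pi * (B * Z + (B * (2 + Z\<^sup>2) + ?e * (B * Z)) + B * Z)"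
  have "cmod (hankel_rem z) \<le> ?C" if z: "0 < z" "z \<le> Z" for z
  proof -
    let ?w = "z\<^sup>2 / 4"
    have w: "0 \<le> ?w" "?w \<le> Z\<^sup>2 / 4" using z by (auto intro: power_mono)
    have zh: "\<bar>z / 2\<bar> \<le> Z" using z by simp
    have J': "\<bar>J_series' ?w * (z / 2)\<bar> \<le> B * Z" unfolding abs_mult using B(1) B(2)[OF w] zh by (intro mult_mono) auto
    have S': "\<bar>S_series' ?w * (z / 2)\<bar> \<le> B * Z" unfolding abs_mult using B(1) B(3)[OF w] zh by (intro mult_mono) auto
    have J0: "J_series 0 = 1" unfolding J_series_def powser_zero by (simp add: J_coeff_def)
    have "norm (J_series ?w - J_series 0) \<le> B * norm (?w - 0)"
    proof (rule field_differentiable_bound[of "{0..Z\<^sup>2 / 4}"])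
      show "(J_series has_field_derivative J_series' x) (at x within {0..Z\<^sup>2 / 4})" for x
        by (rule has_field_derivative_at_within[OF DERIV_J])
      show "norm (J_series' x) \<le> B" if "x \<in> {0..Z\<^sup>2 / 4}" for x using B(2)[of x] that by simp
    qed (use w in auto)
    then have "\<bar>J_series ?w - 1\<bar> \<le> B * ?w" using J0 by simp
    then have "\<bar>J_series ?w - 1\<bar> / \<bar>z\<bar> \<le> (B * ?w) / \<bar>z\<bar>" by (rule divide_right_mono) simp
    then have "\<bar>(J_series ?w - 1) / z\<bar> \<le> (B * ?w) / z" using z by (simp only: abs_divide abs_of_pos)
    also have "\<dots> = B * (z / 4)" using z by (simp add: power2_eq_square)
    also have "\<dots> \<le> B * Z" using z B(1) by (intro mult_left_mono) auto
    finally have J1: "\<bar>(J_series ?w - 1) / z\<bar> \<le> B * Z" .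
    have lz: "\<bar>ln (z / 2)\<bar> * (z / 2) \<le> 2 + Z\<^sup>2"
    proof (cases "z \<le> 2")
      case True
      then have "ln (z / 2) \<le> 0" using z by simp
      moreover have "ln (2 / z) \<le> 2 / z" using z ln_bound[of "2 / z"] by simp
      moreover have "ln (2 / z) = - ln (z / 2)" using z by (simp add: ln_div)
      ultimately have "\<bar>ln (z / 2)\<bar> \<le> 2 / z" by linarith
      then have "\<bar>ln (z / 2)\<bar> * (z / 2) \<le> 2 / z * (z / 2)" using z by (intro mult_right_mono) auto
      also have "\<dots> = 1" using z by simp
      finally show ?thesis using zero_le_power2[of Z] by linarith
    next
      case False
      have "0 \<le> ln (z / 2)" "ln (z / 2) \<le> z / 2" using False z ln_bound[of "z / 2"] by auto
      then have "\<bar>ln (z / 2)\<bar> * (z / 2) \<le> z / 2 * (z / 2)" using z by (intro mult_right_mono) auto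
      also have "\<dots> \<le> Z * Z" using z by (intro mult_mono) auto
      finally show ?thesis by (simp add: power2_eq_square)
    qed
    have l: "\<bar>(ln (z / 2) + euler_mascheroni) * (J_series' ?w * (z / 2))\<bar> \<le> B * (2 + Z\<^sup>2) + ?e * (B * Z)"
    proof -
      have "\<bar>ln (z / 2) * (J_series' ?w * (z / 2))\<bar> = \<bar>J_series' ?w\<bar> * (\<bar>ln (z / 2)\<bar> * (z / 2))"
        using z by (simp add: abs_mult)
      also have "\<dots> \<le> B * (2 + Z\<^sup>2)" using B(1) B(2)[OF w] lz z by (intro mult_mono) auto
      finally have 1: "\<bar>ln (z / 2) * (J_series' ?w * (z / 2))\<bar> \<le> B * (2 + Z\<^sup>2)" .
      have 2: "\<bar>euler_mascheroni * (J_series' ?w * (z / 2))\<bar> \<le> ?e * (B * Z)"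
        unfolding abs_mult[of euler_mascheroni] using J' by (intro mult_left_mono) auto
      have "(ln (z / 2) + euler_mascheroni) * (J_series' ?w * (z / 2)) = ln (z / 2) * (J_series' ?w * (z / 2)) + euler_mascheroni * (J_series' ?w * (z / 2))"
        by (simp only: distrib_right)
      then show ?thesis using 1 2 by linarith
    qed
    have "\<bar>(J_series ?w - 1) / z + (ln (z / 2) + euler_mascheroni) * (J_series' ?w * (z / 2)) - S_series' ?w * (z / 2)\<bar>
       \<le> B * Z + (B * (2 + Z\<^sup>2) + ?e * (B * Z)) + B * Z"
      using J1 l S' by linarith
    then have "\<bar>2 / pi * ((J_series ?w - 1) / z + (ln (z / 2) + euler_mascheroni) * (J_series' ?w * (z / 2)) - S_series' ?w * (z / 2))\<bar>
       \<le> 2 / pi * (B * Z + (B * (2 + Z\<^sup>2) + ?e * (B * Z)) + B * Z)"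
      by (subst abs_mult) (auto intro!: mult_left_mono simp del: times_divide_eq_left)
    then show ?thesis unfolding hankel_rem_def using J' by (intro order_trans[OF cmod_Complex_le] add_mono)
  qed
  then show ?thesis
  proof (intro exI[of _ "\<bar>?C\<bar>"] conjI allI impI)
    fix z assume *: "\<And>z. 0 < z \<Longrightarrow> z \<le> Z \<Longrightarrow> cmod (hankel_rem z) \<le> ?C" and z: "0 < z" "z \<le> Z"
    show "cmod (hankel_rem z) \<le> \<bar>?C\<bar>" by (rule order_trans[OF *[OF z] abs_ge_self])
  qed simp
qed

text \<open>The value z = 0 is included, where \<open>ln 0 = 0\<close> and the same estimate goes
  through; the kernel of the single layer can thus be bounded pointwise also on the
  diagonal.\<close>

lemma hankel_bounded: "\<exists>C\<ge>0. \<forall>z. 0 \<le> z \<longrightarrow> z \<le> Z \<longrightarrow> cmod (hankel1_0 z) \<le> C * (1 + \<bar>ln (z / 2)\<bar>)"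
proof -
  obtain B where B: "0 \<le> B" "\<And>w. 0 \<le> w \<Longrightarrow> w \<le> Z\<^sup>2 / 4 \<Longrightarrow> \<bar>J_series w\<bar> \<le> B" "\<And>w. 0 \<le> w \<Longrightarrow> w \<le> Z\<^sup>2 / 4 \<Longrightarrow> \<bar>S_series w\<bar> \<le> B"
    by (rule series_bounded[of "Z\<^sup>2 / 4"]) blast
  let ?e = "\<bar>euler_mascheroni :: real\<bar>"
  have pi1: "2 / pi \<le> 1" using pi_gt3 by simp
  have "cmod (hankel1_0 z) \<le> (B * (2 + ?e)) * (1 + \<bar>ln (z / 2)\<bar>)" if z: "0 \<le> z" "z \<le> Z" for z
  proof -
    let ?w = "z\<^sup>2 / 4" and ?l = "\<bar>ln (z / 2)\<bar>"
    have w: "0 \<le> ?w" "?w \<le> Z\<^sup>2 / 4" using z by (auto intro: power_mono)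
    have "\<bar>(ln (z / 2) + euler_mascheroni) * J_series ?w\<bar> \<le> (?l + ?e) * B"
      unfolding abs_mult using B(1) B(2)[OF w] by (intro mult_mono) auto
    then have "\<bar>(ln (z / 2) + euler_mascheroni) * J_series ?w - S_series ?w\<bar> \<le> (?l + ?e) * B + B"
      using B(3)[OF w] by linarith
    then have "2 / pi * \<bar>(ln (z / 2) + euler_mascheroni) * J_series ?w - S_series ?w\<bar> \<le> 1 * ((?l + ?e) * B + B)"
      using pi1 B(1) by (intro mult_mono) auto
    then have Y: "\<bar>bessel_Y0 z\<bar> \<le> (?l + ?e) * B + B"
      unfolding bessel_Y0_series abs_mult[of "2 / pi"] by simp
    have "cmod (hankel1_0 z) \<le> B + ((?l + ?e) * B + B)"
      unfolding hankel1_0_def using Y B(2)[OF w] by (intro order_trans[OF cmod_Complex_le] add_mono) (auto simp: bessel_J0_series)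
    also have "\<dots> = B * (2 + ?e) + B * ?l" by (simp add: algebra_simps)
    also have "\<dots> \<le> B * (2 + ?e) + B * (2 + ?e) * ?l"
    proof -
      have "B * 1 \<le> B * (2 + ?e)" using B(1) by (intro mult_left_mono) auto
      then have "B * ?l \<le> B * (2 + ?e) * ?l" by (intro mult_right_mono) auto
      then show ?thesis by simp
    qed
    finally show ?thesis by (simp add: distrib_left)
  qed
  then show ?thesis using B(1) by (intro exI[of _ "B * (2 + ?e)"]) auto
qed

section \<open>Normal derivative of the fundamental solution\<close>

lemma dist_has_derivative:
  fixes x y n :: "'a::euclidean_space"
  assumes "x \<noteq> y"
  shows "((\<lambda>t. dist x (y + t *\<^sub>R n)) has_real_derivative ((y - x) \<bullet> n) / dist x y) (at 0)"
proof -
  have e: "dist x (y + t *\<^sub>R n) = sqrt ((dist x y)\<^sup>2 + 2 * t * ((y - x) \<bullet> n) + t\<^sup>2 * (n \<bullet> n))" for t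
  proof -
    have "(dist x (y + t *\<^sub>R n))\<^sup>2 = (dist x y)\<^sup>2 + 2 * t * ((y - x) \<bullet> n) + t\<^sup>2 * (n \<bullet> n)"
      unfolding dist_norm power2_norm_eq_inner
      by (simp add: inner_diff_left inner_diff_right inner_add_left inner_add_right inner_commute power2_eq_square algebra_simps)
    moreover have "dist x (y + t *\<^sub>R n) = sqrt ((dist x (y + t *\<^sub>R n))\<^sup>2)" by simp
    ultimately show ?thesis by (simp only:)
  qed
  have p: "0 < (dist x y)\<^sup>2" using assms by simp
  have "((\<lambda>t. sqrt ((dist x y)\<^sup>2 + 2 * t * ((y - x) \<bullet> n) + t\<^sup>2 * (n \<bullet> n))) has_real_derivative
     inverse (sqrt ((dist x y)\<^sup>2 + 2 * 0 * ((y - x) \<bullet> n) + 0\<^sup>2 * (n \<bullet> n))) / 2 * (2 * ((y - x) \<bullet> n))) (at 0)"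
    by (rule DERIV_chain2[OF DERIV_real_sqrt]) (use p in \<open>auto intro!: derivative_eq_intros\<close>)
  moreover have "inverse (sqrt ((dist x y)\<^sup>2 + 2 * 0 * ((y - x) \<bullet> n) + 0\<^sup>2 * (n \<bullet> n))) / 2 * (2 * ((y - x) \<bullet> n))
     = ((y - x) \<bullet> n) / dist x y"
  proof -
    have "sqrt ((dist x y)\<^sup>2 + 2 * 0 * ((y - x) \<bullet> n) + 0\<^sup>2 * (n \<bullet> n)) = dist x y" by simp
    moreover have "inverse u / 2 * (2 * v) = v / u" for u v :: real by (simp add: inverse_eq_divide)
    ultimately show ?thesis by (simp only:)
  qed
  moreover have "(\<lambda>t. dist x (y + t *\<^sub>R n)) = (\<lambda>t. sqrt ((dist x y)\<^sup>2 + 2 * t * ((y - x) \<bullet> n) + t\<^sup>2 * (n \<bullet> n)))"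
    by (rule ext, rule e)
  ultimately show ?thesis by simp
qed

text \<open>The wave number cancels from the singular part, which is the Laplace dipole for every k.
  It remains only in a term that is bounded as long as k and k times the distance are, and this
  gives the double layer a bound uniform in k \<le> 1.\<close>

lemma fund_sol_normal_derivative:
  fixes \<Omega> :: "(real^2) set"
  assumes k: "0 < k" and xy: "x \<noteq> y"
  defines "n \<equiv> outward_normal \<Omega> y"
  shows "fund_sol_normal_deriv \<Omega> k x y = of_real (((x - y) \<bullet> n) / (2 * pi * (dist x y)\<^sup>2))
     + \<i> / 4 * of_real (k * (((y - x) \<bullet> n) / dist x y)) * hankel_rem (k * dist x y)"
proof -
  let ?r = "dist x y" and ?p = "((y - x) \<bullet> n) / dist x y"
  let ?H = "\<i> * of_real (2 / (pi * (k * ?r))) + hankel_rem (k * ?r)"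
  have r: "0 < ?r" using xy by simp
  have d: "((\<lambda>t. k * dist x (y + t *\<^sub>R n)) has_real_derivative k * ?p) (at 0)"
    by (intro DERIV_cmult dist_has_derivative xy)
  have "(hankel1_0 has_vector_derivative ?H) (at (k * dist x (y + 0 *\<^sub>R n)))"
    using hankel_has_derivative[of "k * ?r"] k r by simp
  then have "((hankel1_0 \<circ> (\<lambda>t. k * dist x (y + t *\<^sub>R n))) has_vector_derivative (k * ?p) *\<^sub>R ?H) (at 0)"
    by (intro vector_diff_chain_at) (use d in \<open>simp add: has_real_derivative_iff_has_vector_derivative\<close>)
  then have "((\<lambda>t. \<i> / 4 * hankel1_0 (k * dist x (y + t *\<^sub>R n))) has_vector_derivative \<i> / 4 * ((k * ?p) *\<^sub>R ?H)) (at 0)"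
    by (intro has_vector_derivative_mult_right) (simp add: o_def)
  then have "fund_sol_normal_deriv \<Omega> k x y = \<i> / 4 * ((k * ?p) *\<^sub>R ?H)"
    unfolding fund_sol_normal_deriv_def fund_sol_def n_def by (rule vector_derivative_at)
  also have "\<dots> = \<i> / 4 * (of_real (k * ?p) * (\<i> * of_real (2 / (pi * (k * ?r))))) + \<i> / 4 * of_real (k * ?p) * hankel_rem (k * ?r)"
    by (simp only: scaleR_conv_of_real distrib_left mult.assoc)
  also have "\<i> / 4 * (of_real (k * ?p) * (\<i> * of_real (2 / (pi * (k * ?r))))) = of_real (((x - y) \<bullet> n) / (2 * pi * ?r\<^sup>2))"
  proof -
    have A: "(k * ?p) * (2 / (pi * (k * ?r))) * (-1/4) = ((x - y) \<bullet> n) / (2 * pi * ?r\<^sup>2)"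
    proof -
      have "(y - x) \<bullet> n = - ((x - y) \<bullet> n)" by (simp add: inner_diff_left)
      moreover have "(k * (- q / s)) * (2 / (pi * (k * s))) * (-1/4) = q / (2 * pi * s\<^sup>2)" for q s :: real
        using k by (simp add: power2_eq_square)
      ultimately show ?thesis by (simp only:)
    qed
    have B: "\<i> / 4 * (of_real u * (\<i> * of_real v)) = of_real (u * v * (-1/4))" for u v
      by (simp add: complex_eq_iff)
    show ?thesis using B[of "k * ?p" "2 / (pi * (k * ?r))"] unfolding A .
  qed
  finally show ?thesis .
qed

section \<open>Layer potentials\<close>

text \<open>Minkowski's inequality in squared form, from Young's inequality with the weights B / A
  and A / B. Unlike \<open>sqn_add_le\<close> it loses no factor, so the identity operator
  contributes exactly 1 to the final bound.\<close>

lemma sqn_add_le_square: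
  assumes [measurable]: "\<phi> \<in> borel_measurable M" "\<psi> \<in> borel_measurable M"
    and A: "0 < A" "sqn M \<phi> \<le> ennreal (A\<^sup>2)" and B: "0 < B" "sqn M \<psi> \<le> ennreal (B\<^sup>2)"
  shows "sqn M (\<lambda>x. \<phi> x + \<psi> x) \<le> ennreal ((A + B)\<^sup>2)"
proof -
  have pt: "(cmod (u + v))\<^sup>2 \<le> (1 + B / A) * (cmod u)\<^sup>2 + (1 + A / B) * (cmod v)\<^sup>2" for u v
  proof -
    have "(cmod (u + v))\<^sup>2 \<le> (cmod u + cmod v)\<^sup>2" by (intro power_mono norm_triangle_ineq) simp
    also have "\<dots> = (cmod u)\<^sup>2 + 2 * (cmod u * cmod v) + (cmod v)\<^sup>2" by (simp add: power2_sum)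
    also have "2 * (cmod u * cmod v) \<le> B / A * (cmod u)\<^sup>2 + A / B * (cmod v)\<^sup>2"
    proof -
      have "0 \<le> (B * cmod u - A * cmod v)\<^sup>2 / (A * B)" using A B by simp
      also have "\<dots> = B / A * (cmod u)\<^sup>2 + A / B * (cmod v)\<^sup>2 - 2 * (cmod u * cmod v)"
        using A B by (simp add: power2_diff field_simps power2_eq_square)
      finally show ?thesis by simp
    qed
    finally show ?thesis by (simp add: algebra_simps)
  qed
  have p: "0 \<le> 1 + B / A" "0 \<le> 1 + A / B" using A B by auto
  have "sqn M (\<lambda>x. \<phi> x + \<psi> x) \<le> (\<integral>\<^sup>+ x. ennreal (1 + B / A) * ennreal ((cmod (\<phi> x))\<^sup>2) + ennreal (1 + A / B) * ennreal ((cmod (\<psi> x))\<^sup>2) \<partial>M)"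
    unfolding sqn_def using pt p by (intro nn_integral_mono) (simp add: ennreal_mult[symmetric] ennreal_plus[symmetric] del: ennreal_plus)
  also have "\<dots> = ennreal (1 + B / A) * sqn M \<phi> + ennreal (1 + A / B) * sqn M \<psi>"
    unfolding sqn_def by (subst nn_integral_add) (auto simp: nn_integral_cmult)
  also have "\<dots> \<le> ennreal (1 + B / A) * ennreal (A\<^sup>2) + ennreal (1 + A / B) * ennreal (B\<^sup>2)"
    by (intro add_mono mult_left_mono A B) auto
  also have "\<dots> = ennreal ((1 + B / A) * A\<^sup>2 + (1 + A / B) * B\<^sup>2)"
    using p by (simp add: ennreal_mult[symmetric] ennreal_plus[symmetric] del: ennreal_plus)
  also have "(1 + B / A) * A\<^sup>2 + (1 + A / B) * B\<^sup>2 = (A + B)\<^sup>2"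
    using A(1) B(1) by (simp add: power2_eq_square field_simps)
  finally show ?thesis .
qed

lemma sqn_L2:
  assumes "\<phi> \<in> L2_space M" "L2_norm M \<phi> \<le> 1"
  shows "\<phi> \<in> borel_measurable M" "sqn M \<phi> \<le> 1"
proof -
  show "\<phi> \<in> borel_measurable M" using assms by (simp add: L2_space_def)
  have i: "integrable M (\<lambda>x. (cmod (\<phi> x))\<^sup>2)" using assms by (simp add: L2_space_def)
  have "sqn M \<phi> = ennreal (\<integral>x. (cmod (\<phi> x))\<^sup>2 \<partial>M)"
    unfolding sqn_def by (rule nn_integral_eq_integral[OF i]) simp
  also have "\<dots> \<le> ennreal 1" using assms(2) by (intro ennreal_leI) (simp add: L2_norm_def)
  finally show "sqn M \<phi> \<le> 1" by simp
qed

lemma L2_if_sqn: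
  assumes [measurable]: "\<phi> \<in> borel_measurable M" and le: "sqn M \<phi> \<le> ennreal (A\<^sup>2)" and A: "0 \<le> A"
  shows "\<phi> \<in> L2_space M" "L2_norm M \<phi> \<le> A"
proof -
  have "sqn M \<phi> < \<infinity>" using le by (auto intro: le_less_trans)
  then have i: "integrable M (\<lambda>x. (cmod (\<phi> x))\<^sup>2)"
    by (intro integrableI_bounded) (auto simp: sqn_def)
  then show "\<phi> \<in> L2_space M" by (simp add: L2_space_def)
  have "ennreal (\<integral>x. (cmod (\<phi> x))\<^sup>2 \<partial>M) = sqn M \<phi>"
    unfolding sqn_def by (rule nn_integral_eq_integral[OF i, symmetric]) simp
  then have "ennreal (\<integral>x. (cmod (\<phi> x))\<^sup>2 \<partial>M) \<le> ennreal (A\<^sup>2)" using le by simp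
  then have "(\<integral>x. (cmod (\<phi> x))\<^sup>2 \<partial>M) \<le> A\<^sup>2" by (subst (asm) ennreal_le_iff) auto
  then show "L2_norm M \<phi> \<le> A" unfolding L2_norm_def by (rule real_le_lsqrt[OF A])
qed

lemma L2_op_norm_le:
  assumes A: "0 \<le> A"
    and T: "\<And>\<phi>. \<phi> \<in> borel_measurable M \<Longrightarrow> sqn M \<phi> \<le> 1 \<Longrightarrow> T \<phi> \<in> borel_measurable M \<and> sqn M (T \<phi>) \<le> ennreal (A\<^sup>2)"
  shows "L2_op_norm M T \<le> ennreal A"
  unfolding L2_op_norm_def
proof (rule SUP_least)
  fix \<phi> assume "\<phi> \<in> {\<phi> \<in> L2_space M. L2_norm M \<phi> \<le> 1}"
  then have "T \<phi> \<in> borel_measurable M" "sqn M (T \<phi>) \<le> ennreal (A\<^sup>2)" using T[of \<phi>] sqn_L2[of \<phi> M] by auto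
  then have "T \<phi> \<in> L2_space M" "L2_norm M (T \<phi>) \<le> A" using L2_if_sqn A by blast+
  then show "(if T \<phi> \<in> L2_space M then ennreal (L2_norm M (T \<phi>)) else \<infinity>) \<le> ennreal A"
    by (simp add: ennreal_leI)
qed

section \<open>Transfer between completed arc length and the Borel measure\<close>

context lipschitz_domain
begin

abbreviation ds :: "(real^2) measure" where "ds \<equiv> arclength_on \<Gamma>"

lemma space_ds [simp]: "space ds = \<Gamma>"
  by (simp add: arclength_on_def space_restrict_space)

lemma ds_measurable: "h \<in> borel_measurable borel \<Longrightarrow> h \<in> borel_measurable ds"
  unfolding arclength_on_def
  by (intro measurable_completion measurable_restrict_space1) (simp add: measurable_cong_sets[OF sets_hausdorff1 refl])

lemma N_eq: "N = density hausdorff1 (\<lambda>x. ennreal (indicator \<Gamma> x))"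
  unfolding N_def by (rule arg_cong[where f = "density hausdorff1"]) (auto simp: indicator_def)

lemma h_meas: "h \<in> borel_measurable borel \<Longrightarrow> h \<in> borel_measurable hausdorff1"
  by (simp add: measurable_cong_sets[OF sets_hausdorff1 refl])

lemma nn_integral_ds:
  assumes "h \<in> borel_measurable borel"
  shows "(\<integral>\<^sup>+ x. h x \<partial>ds) = (\<integral>\<^sup>+ x. h x \<partial>N)"
proof -
  have "(\<integral>\<^sup>+ x. h x \<partial>ds) = (\<integral>\<^sup>+ x. h x * indicator \<Gamma> x \<partial>hausdorff1)"
    unfolding arclength_on_def nn_integral_completion by (rule nn_integral_restrict_space) simp
  also have "\<dots> = (\<integral>\<^sup>+ x. h x \<partial>N)"
    unfolding N_def using h_meas[OF assms] by (subst nn_integral_density) (auto simp: mult.commute)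
  finally show ?thesis .
qed

lemma integral_ds:
  fixes h :: "real^2 \<Rightarrow> complex"
  assumes "h \<in> borel_measurable borel"
  shows "(\<integral>x. h x \<partial>ds) = (\<integral>x. h x \<partial>N)"
proof -
  have hm: "h \<in> borel_measurable hausdorff1" by (rule h_meas[OF assms])
  have "(\<integral>x. h x \<partial>ds) = (\<integral>x. h x \<partial>restrict_space hausdorff1 \<Gamma>)"
    unfolding arclength_on_def by (rule integral_completion[OF measurable_restrict_space1[OF hm]])
  also have "\<dots> = (\<integral>x. indicator \<Gamma> x *\<^sub>R h x \<partial>hausdorff1)" by (rule integral_restrict_space) simp
  also have "\<dots> = (\<integral>x. h x \<partial>N)"
    unfolding N_eq by (rule integral_density[symmetric, OF hm]) auto
  finally show ?thesis .
qed

text \<open>Densities are measurable only for the completion, whereas kernels times densities are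
  handled with Borel functions on the plane. Cutting off outside \<Gamma> lets the integrals run
  over the whole plane.\<close>

lemma ds_borel_representative:
  fixes \<phi> :: "real^2 \<Rightarrow> complex"
  assumes \<phi>: "\<phi> \<in> borel_measurable ds"
  obtains \<phi>' where "\<phi>' \<in> borel_measurable borel" "\<And>y. y \<notin> \<Gamma> \<Longrightarrow> \<phi>' y = 0" "AE x in ds. \<phi> x = \<phi>' x"
proof -
  let ?R = "restrict_space hausdorff1 \<Gamma>"
  have "(\<lambda>x. Re (\<phi> x)) \<in> borel_measurable (completion ?R)" "(\<lambda>x. Im (\<phi> x)) \<in> borel_measurable (completion ?R)"
    using \<phi> unfolding arclength_on_def by measurable
  then obtain u v where uv: "u \<in> borel_measurable ?R" "v \<in> borel_measurable ?R" "AE x in ?R. Re (\<phi> x) = u x" "AE x in ?R. Im (\<phi> x) = v x"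
    using completion_ex_borel_measurable_real by blast
  let ?p = "\<lambda>x. indicator \<Gamma> x *\<^sub>R Complex (u x) (v x)"
  have "(\<lambda>x. Complex (u x) (v x)) \<in> borel_measurable ?R" unfolding Complex_eq using uv by measurable
  then have "?p \<in> borel_measurable hausdorff1" by (subst (asm) borel_measurable_restrict_space_iff) auto
  then have "?p \<in> borel_measurable borel" by (simp add: measurable_cong_sets[OF sets_hausdorff1 refl])
  moreover have "AE x in ds. \<phi> x = ?p x"
  proof -
    have "AE x in ?R. \<phi> x = ?p x"
      using uv(3,4) AE_space by eventually_elim (auto simp: space_restrict_space complex_eq_iff)
    then show ?thesis unfolding arclength_on_def by (simp only: AE_completion_iff)
  qed
  ultimately show ?thesis using that[of ?p] by simp
qed

lemma integral_ds_cong: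
  fixes \<phi> \<phi>' h h' :: "real^2 \<Rightarrow> complex"
  assumes \<phi>: "\<phi> \<in> borel_measurable ds" and \<phi>': "\<phi>' \<in> borel_measurable borel" and ae: "AE x in ds. \<phi> x = \<phi>' x"
    and h: "h \<in> borel_measurable ds" and h': "h' \<in> borel_measurable borel" and hh: "\<And>y. y \<in> \<Gamma> \<Longrightarrow> h y = h' y"
  shows "(\<integral>y. h y * \<phi> y \<partial>ds) = (\<integral>y. h' y * \<phi>' y \<partial>N)"
proof -
  have [measurable]: "\<phi>' \<in> borel_measurable ds" "h' \<in> borel_measurable ds" by (rule ds_measurable, fact)+
  note [measurable] = \<phi> h
  have "(\<integral>y. h y * \<phi> y \<partial>ds) = (\<integral>y. h' y * \<phi>' y \<partial>ds)"
  proof (rule integral_cong_AE)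
    show "AE y in ds. h y * \<phi> y = h' y * \<phi>' y" using ae AE_space by eventually_elim (auto simp: hh)
  qed measurable
  also have "\<dots> = (\<integral>y. h' y * \<phi>' y \<partial>N)" by (rule integral_ds) (use \<phi>' h' in measurable)
  finally show ?thesis .
qed

lemma sqn_ds:
  fixes \<phi> \<phi>' :: "real^2 \<Rightarrow> complex"
  assumes "\<phi>' \<in> borel_measurable borel" "AE x in ds. \<phi> x = \<phi>' x"
  shows "sqn ds \<phi> = sqn N \<phi>'"
proof -
  have [measurable]: "\<phi>' \<in> borel_measurable borel" by fact
  have "sqn ds \<phi> = sqn ds \<phi>'"
    unfolding sqn_def by (rule nn_integral_cong_AE) (use assms(2) in \<open>auto elim!: eventually_mono\<close>)
  also have "\<dots> = sqn N \<phi>'" unfolding sqn_def by (rule nn_integral_ds) measurable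
  finally show ?thesis .
qed

section \<open>The single layer\<close>

definition diam :: real where "diam = max 1 (diameter \<Gamma>)"

lemma dist_le_diam: "x \<in> \<Gamma> \<Longrightarrow> y \<in> \<Gamma> \<Longrightarrow> dist x y \<le> diam"
  using diameter_bounded_bound[OF compact_imp_bounded[OF compact_\<Gamma>], of x y] by (simp add: diam_def)

lemma diam_ge_1: "1 \<le> diam" by (simp add: diam_def)

text \<open>For dist x y \<le> 1 the quantity - ln (dist x y) is at most the number of balls of
  radius 2^(-k) around x that contain y, because ln 2 < 1. Linear growth bounds their total mass by
  c (1 + 1/2 + 1/4 + ...) = 2 c. Farther away the logarithm is at most ln diam.\<close>

lemma log_integral_le:
  "(\<integral>\<^sup>+ y. ennreal (indicator \<Gamma> x * indicator \<Gamma> y * (1 + \<bar>ln (dist x y)\<bar>)) \<partial>N) \<le> ennreal ((1 + ln diam) * measure N UNIV + 2 * c)"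
proof -
  let ?U = "{y. dist x y \<le> 1}"
  have U [measurable]: "?U \<in> sets borel" by measurable
  have lnd: "0 \<le> ln diam" using diam_ge_1 by simp
  have "ennreal (indicator \<Gamma> x * indicator \<Gamma> y * (1 + \<bar>ln (dist x y)\<bar>)) \<le> ennreal (1 + ln diam) + ennreal (- ln (dist x y)) * indicator ?U y" for y
  proof (cases "x \<in> \<Gamma> \<and> y \<in> \<Gamma>")
    case True
    show ?thesis
    proof (cases "dist x y \<le> 1")
      case le: True
      have "ln (dist x y) \<le> 0"
      proof (cases "x = y")
        case False
        then show ?thesis using le by (subst ln_le_zero_iff) auto
      qed simp
      then have "1 + \<bar>ln (dist x y)\<bar> \<le> (1 + ln diam) + (- ln (dist x y))" using lnd by linarith
      then have "ennreal (1 + \<bar>ln (dist x y)\<bar>) \<le> ennreal ((1 + ln diam) + (- ln (dist x y)))" by (rule ennreal_leI)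
      also have "\<dots> = ennreal (1 + ln diam) + ennreal (- ln (dist x y))"
        using lnd \<open>ln (dist x y) \<le> 0\<close> by (intro ennreal_plus) auto
      finally show ?thesis using True le by simp
    next
      case gt: False
      then have d1: "1 < dist x y" by simp
      have "dist x y \<le> diam" using True by (intro dist_le_diam) auto
      then have "ln (dist x y) \<le> ln diam" using d1 by (subst ln_le_cancel_iff) auto
      moreover have "0 \<le> ln (dist x y)" using d1 by simp
      ultimately have "1 + \<bar>ln (dist x y)\<bar> \<le> 1 + ln diam" by simp
      then have "ennreal (1 + \<bar>ln (dist x y)\<bar>) \<le> ennreal (1 + ln diam)" by (rule ennreal_leI)
      then show ?thesis using True gt by (simp add: indicator_def)
    qed
  qed (auto simp: indicator_def)
  then have "(\<integral>\<^sup>+ y. ennreal (indicator \<Gamma> x * indicator \<Gamma> y * (1 + \<bar>ln (dist x y)\<bar>)) \<partial>N)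
     \<le> (\<integral>\<^sup>+ y. ennreal (1 + ln diam) + ennreal (- ln (dist x y)) * indicator ?U y \<partial>N)"
    by (intro nn_integral_mono)
  also have "\<dots> = ennreal (1 + ln diam) * emeasure N UNIV + (\<integral>\<^sup>+ y. ennreal (- ln (dist x y)) * indicator ?U y \<partial>N)"
    by (subst nn_integral_add) auto
  also have "(\<integral>\<^sup>+ y. ennreal (- ln (dist x y)) * indicator ?U y \<partial>N) \<le> ennreal (c * 2)"
  proof (rule layer_bound)
    fix y assume y: "y \<in> ?U"
    show "ennreal (- ln (dist x y)) \<le> (\<Sum>k. ennreal 1 * indicator (cball x ((1/2) ^ k)) y)"
    proof (cases "dist x y = 0")
      case False
      then have d: "0 < dist x y" by simp
      obtain j0 :: nat where "(1/2::real) ^ j0 < dist x y" using real_arch_pow_inv[OF d, of "1/2"] by auto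
      then have ex: "\<exists>j. (1/2::real) ^ Suc j < dist x y"
      proof (intro exI[of _ j0])
        assume "(1/2::real) ^ j0 < dist x y"
        moreover have "(1/2::real) ^ Suc j0 \<le> (1/2) ^ j0" by (rule power_decreasing) auto
        ultimately show "(1/2::real) ^ Suc j0 < dist x y" by linarith
      qed
      define j where "j = (LEAST j. (1/2::real) ^ Suc j < dist x y)"
      have j: "(1/2::real) ^ Suc j < dist x y" unfolding j_def by (rule LeastI_ex[OF ex])
      have mem: "y \<in> cball x ((1/2) ^ k)" if "k \<le> j" for k
      proof (cases k)
        case 0 then show ?thesis using y by simp
      next
        case (Suc i)
        then have "\<not> (1/2::real) ^ Suc i < dist x y" using that not_less_Least[of i "\<lambda>j. (1/2::real) ^ Suc j < dist x y"] by (simp add: j_def)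
        then show ?thesis using Suc by simp
      qed
      have "ln ((1/2::real) ^ Suc j) \<le> ln (dist x y)" using j d by (subst ln_le_cancel_iff) auto
      then have "- ln (dist x y) \<le> real (Suc j) * ln 2" by (simp add: ln_realpow ln_div algebra_simps)
      also have "\<dots> \<le> real (Suc j) * 1" using ln_2_less_1 by (intro mult_left_mono) auto
      finally have "ennreal (- ln (dist x y)) \<le> ennreal (real (Suc j))" by (intro ennreal_leI) simp
      also have "\<dots> = (\<Sum>k\<le>j. ennreal 1 * indicator (cball x ((1/2) ^ k)) y)"
      proof -
        have "(\<Sum>k\<le>j. ennreal 1 * indicator (cball x ((1/2) ^ k)) y) = (\<Sum>k\<le>j. 1)"
          by (intro sum.cong refl) (use mem in \<open>simp del: mem_cball\<close>)
        also have "\<dots> = ennreal (real (Suc j))" by (simp add: ennreal_of_nat_eq_real_of_nat del: of_nat_Suc)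
        finally show ?thesis by simp
      qed
      also have "\<dots> \<le> (\<Sum>k. ennreal 1 * indicator (cball x ((1/2) ^ k)) y)"
        by (rule sum_le_suminf) auto
      finally show ?thesis .
    qed simp
  next
    have "(\<lambda>k. (1/2::real) ^ k) sums (1 / (1 - 1/2))" by (rule geometric_sums) simp
    moreover have "1 / (1 - 1/2) = (2::real)" by simp
    ultimately show "(\<lambda>k. 1 * (1/2::real) ^ k) sums 2" by (simp only: mult_1_left)
  qed auto
  also have "ennreal (1 + ln diam) * emeasure N UNIV + ennreal (c * 2) = ennreal ((1 + ln diam) * measure N UNIV + 2 * c)"
    using lnd c_nonneg by (simp add: emeasure_eq_measure ennreal_mult[symmetric] ennreal_plus[symmetric] mult.commute del: ennreal_plus)
  finally show ?thesis by (simp add: add_mono)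
qed

lemma single_layer_bound:
  obtains C where "0 < C" "\<And>k \<phi>. 0 < k \<Longrightarrow> k \<le> 1 \<Longrightarrow> \<phi> \<in> borel_measurable ds \<Longrightarrow> sqn ds \<phi> \<le> 1 \<Longrightarrow>
      single_layer \<Omega> k \<phi> \<in> borel_measurable ds \<and> sqn ds (single_layer \<Omega> k \<phi>) \<le> ennreal ((C * (1 - ln k))\<^sup>2)"
proof -
  obtain Ch where Ch: "0 \<le> Ch" "\<And>z. 0 \<le> z \<Longrightarrow> z \<le> diam \<Longrightarrow> cmod (hankel1_0 z) \<le> Ch * (1 + \<bar>ln (z / 2)\<bar>)"
    using hankel_bounded[of diam] by blast
  define Y where "Y = (1 + ln diam) * measure N UNIV + 2 * c"
  have Y: "0 \<le> Y" using diam_ge_1 c_nonneg by (simp add: Y_def)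
  define C where "C = Ch * Y + 1"
  show ?thesis
  proof (rule that[of C])
    show "0 < C" using Ch Y by (simp add: C_def add_nonneg_pos)
    fix k :: real and \<phi> assume k: "0 < k" "k \<le> 1" and \<phi>: "\<phi> \<in> borel_measurable ds" and n1: "sqn ds \<phi> \<le> 1"
    obtain \<phi>' where \<phi>'[measurable]: "\<phi>' \<in> borel_measurable borel" and supp: "\<And>y. y \<notin> \<Gamma> \<Longrightarrow> \<phi>' y = 0" and ae: "AE x in ds. \<phi> x = \<phi>' x"
      by (rule ds_borel_representative[OF \<phi>]) blast
    have lnk: "0 \<le> - ln k" using k by simp
    have fs [measurable]: "(\<lambda>(x, y). fund_sol k x y) \<in> borel_measurable (borel \<Otimes>\<^sub>M borel)"
      unfolding fund_sol_def by measurable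
    have fsx: "fund_sol k x \<in> borel_measurable borel" for x
      unfolding fund_sol_def by measurable
    define h where "h x = (\<integral>y. fund_sol k x y * \<phi>' y \<partial>N)" for x
    have hm [measurable]: "h \<in> borel_measurable borel" unfolding h_def by measurable
    have eq: "single_layer \<Omega> k \<phi> x = 2 * h x" for x
      unfolding single_layer_def h_def
      using integral_ds_cong[OF \<phi> \<phi>' ae ds_measurable[OF fsx] fsx] by simp
    have eq': "single_layer \<Omega> k \<phi> = (\<lambda>x. 2 * h x)" using eq by (rule ext)
    let ?p = "\<lambda>x y. Ch / 2 * (1 - ln k) * (indicator \<Gamma> x * indicator \<Gamma> y * (1 + \<bar>ln (dist x y)\<bar>))"
    let ?k = "\<lambda>x y. indicator \<Gamma> x * (indicator \<Gamma> y * fund_sol k x y)"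
    let ?X = "Ch / 2 * (1 - ln k) * Y"
    have le: "cmod (?k x y) \<le> ?p x y" for x y
    proof (cases "x \<in> \<Gamma> \<and> y \<in> \<Gamma>")
      case True
      let ?d = "dist x y"
      have d: "0 \<le> k * ?d" "k * ?d \<le> diam"
        using k dist_le_diam[of x y] True mult_right_mono[OF k(2), of ?d] by auto
      \<comment> \<open>The product form separates k from the distance. The left side is at most 2 -
        ln k + |ln d|, and each of these terms appears on the right after expansion, with
        nonnegative extra terms because k \<le> 1.\<close>
      have "1 + \<bar>ln (k * ?d / 2)\<bar> \<le> 2 * (1 - ln k) * (1 + \<bar>ln ?d\<bar>)"
      proof -
        have p: "0 \<le> (- ln k) * \<bar>ln ?d\<bar>" using lnk by (intro mult_nonneg_nonneg) auto
        have "\<bar>ln (k * ?d / 2)\<bar> \<le> - ln k + \<bar>ln ?d\<bar> + 1"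
        proof (cases "?d = 0")
          case True then show ?thesis using lnk by simp
        next
          case False
          then have "ln (k * ?d / 2) = ln k + ln ?d - ln 2" using k by (simp add: ln_mult ln_div)
          then show ?thesis using ln_2_less_1 lnk ln_gt_zero[of "2::real"] by linarith
        qed
        moreover have "2 * (1 - ln k) * (1 + \<bar>ln ?d\<bar>) = 2 + 2 * (- ln k) + 2 * \<bar>ln ?d\<bar> + 2 * ((- ln k) * \<bar>ln ?d\<bar>)"
          by (simp add: algebra_simps)
        ultimately show ?thesis using p lnk abs_ge_zero[of "ln ?d"] by linarith
      qed
      then have "Ch * (1 + \<bar>ln (k * ?d / 2)\<bar>) \<le> Ch * (2 * (1 - ln k) * (1 + \<bar>ln ?d\<bar>))" using Ch(1) by (intro mult_left_mono)
      then have "cmod (hankel1_0 (k * ?d)) \<le> Ch * (2 * (1 - ln k) * (1 + \<bar>ln ?d\<bar>))" using Ch(2)[OF d] by linarith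
      then have "cmod (fund_sol k x y) \<le> (1/4) * (Ch * (2 * (1 - ln k) * (1 + \<bar>ln ?d\<bar>)))"
        by (simp add: fund_sol_def norm_mult)
      then show ?thesis using True by (simp add: algebra_simps)
    qed (auto simp: indicator_def)
    have row: "(\<integral>\<^sup>+ y. ennreal (?p x y) \<partial>N) \<le> ennreal ?X" for x
    proof -
      have "(\<integral>\<^sup>+ y. ennreal (?p x y) \<partial>N) = ennreal (Ch / 2 * (1 - ln k)) * (\<integral>\<^sup>+ y. ennreal (indicator \<Gamma> x * indicator \<Gamma> y * (1 + \<bar>ln (dist x y)\<bar>)) \<partial>N)"
      proof -
        have "0 \<le> Ch / 2 * (1 - ln k)" using Ch(1) lnk by (intro mult_nonneg_nonneg) auto
        then have "ennreal (?p x y) = ennreal (Ch / 2 * (1 - ln k)) * ennreal (indicator \<Gamma> x * indicator \<Gamma> y * (1 + \<bar>ln (dist x y)\<bar>))" for y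
          by (intro ennreal_mult) auto
        then show ?thesis by (simp only:) (rule nn_integral_cmult, measurable)
      qed
      also have "\<dots> \<le> ennreal (Ch / 2 * (1 - ln k)) * ennreal Y"
        unfolding Y_def by (intro mult_left_mono log_integral_le) simp
      also have "\<dots> = ennreal ?X" using Ch(1) lnk Y by (intro ennreal_mult[symmetric]) auto
      finally show ?thesis .
    qed
    have "sqn N h = sqn N (\<lambda>x. indicator \<Gamma> x * h x)" by (rule sqn_N_indicator)
    also have "(\<lambda>x. indicator \<Gamma> x * h x) = (\<lambda>x. \<integral>y. ?k x y * \<phi>' y \<partial>N)"
    proof
      fix x
      have "(\<integral>y. ?k x y * \<phi>' y \<partial>N) = (\<integral>y. indicator \<Gamma> x * (fund_sol k x y * \<phi>' y) \<partial>N)"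
        using supp by (intro Bochner_Integration.integral_cong refl) (auto simp: indicator_def)
      then show "indicator \<Gamma> x * h x = (\<integral>y. ?k x y * \<phi>' y \<partial>N)" by (simp add: h_def)
    qed
    also have "sqn N (\<lambda>x. \<integral>y. ?k x y * \<phi>' y \<partial>N) \<le> ennreal ?X * ennreal ?X * sqn N \<phi>'"
    proof (rule kernel_sqn_le[OF _ _ le row])
      show "(\<integral>\<^sup>+ x. ennreal (?p x y) \<partial>N) \<le> ennreal ?X" for y
        using row[of y] by (simp add: dist_commute mult_ac)
    qed measurable
    also have "\<dots> \<le> ennreal ?X * ennreal ?X * 1"
      using n1 sqn_ds[OF \<phi>' ae] by (intro mult_left_mono) auto
    also have "\<dots> = ennreal (?X\<^sup>2)" using Ch(1) lnk Y by (simp add: ennreal_mult[symmetric] power2_eq_square)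
    finally have hle: "sqn N h \<le> ennreal (?X\<^sup>2)" .
    have "sqn ds (single_layer \<Omega> k \<phi>) = sqn N (\<lambda>x. 2 * h x)" unfolding eq' by (rule sqn_ds) auto
    also have "\<dots> = ennreal 4 * sqn N h" by (subst sqn_cmult) auto
    also have "\<dots> \<le> ennreal 4 * ennreal (?X\<^sup>2)" by (intro mult_left_mono hle) simp
    also have "\<dots> = ennreal (4 * ?X\<^sup>2)" by (rule ennreal_mult[symmetric]) auto
    also have "4 * ?X\<^sup>2 = (2 * ?X)\<^sup>2" unfolding power_mult_distrib[of 2] by simp
    also have "(2 * ?X)\<^sup>2 \<le> (C * (1 - ln k))\<^sup>2"
    proof (rule power_mono)
      have "2 * ?X = (Ch * Y) * (1 - ln k)" by simp
      also have "\<dots> \<le> C * (1 - ln k)" using lnk by (intro mult_right_mono) (auto simp: C_def)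
      finally show "2 * ?X \<le> C * (1 - ln k)" .
    qed (use Ch(1) lnk Y in auto)
    finally have "sqn ds (single_layer \<Omega> k \<phi>) \<le> ennreal ((C * (1 - ln k))\<^sup>2)" by (simp add: ennreal_leI)
    then show "single_layer \<Omega> k \<phi> \<in> borel_measurable ds \<and> sqn ds (single_layer \<Omega> k \<phi>) \<le> ennreal ((C * (1 - ln k))\<^sup>2)"
      unfolding eq' by (auto intro!: ds_measurable)
  qed
qed

end

text \<open>Right continuity in \<epsilon> lets rational truncations decide convergence, so the set
  of convergence is measurable. There the limit is also the one along 1 / (n + 1), to which Fatou's
  lemma applies. The second term of the bound is the constant default of \<open>Lim\<close> on the
  remaining set.\<close>

lemma limit_at_0_sqn:
  fixes G :: "real \<Rightarrow> 'a \<Rightarrow> complex"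
  assumes G [measurable]: "\<And>\<epsilon>. G \<epsilon> \<in> borel_measurable M"
    and rc: "\<And>x s. x \<in> space M \<Longrightarrow> 0 < s \<Longrightarrow> ((\<lambda>q. G q x) \<longlongrightarrow> G s x) (at_right s)"
    and bd: "\<And>\<epsilon>. 0 < \<epsilon> \<Longrightarrow> sqn M (G \<epsilon>) \<le> X"
  defines "L \<equiv> \<lambda>x. Lim (at_right 0) (\<lambda>\<epsilon>. G \<epsilon> x)"
  shows "L \<in> borel_measurable M"
    "sqn M L \<le> 2 * X + 2 * (ennreal ((cmod (THE l. False))\<^sup>2) * emeasure M (space M))"
proof -
  define cv where "cv x \<longleftrightarrow> (\<exists>l. ((\<lambda>\<epsilon>. G \<epsilon> x) \<longlongrightarrow> l) (at_right 0))" for x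
  have "{x \<in> space M. \<exists>l. ((\<lambda>\<epsilon>. G \<epsilon> x) \<longlongrightarrow> l) (at 0 within {0<..})} \<in> sets M"
  proof (rule limit_exists_measurable[where Q = "\<rat> \<inter> {0<..}"])
    show "countable (\<rat> \<inter> {0::real<..})" using countable_rat by blast
    have "(0::real) islimpt {0<..<1}" by (rule islimpt_greaterThanLessThan1) simp
    then show "0 islimpt {0::real<..}" by (rule islimpt_subset) auto
    fix x s d assume x: "x \<in> space M" and s: "(s::real) \<in> {0<..}" and d: "(0::real) < d"
    have "eventually (\<lambda>q. dist (G q x) (G s x) < d) (at_right s)"
      using tendstoD[OF rc[OF x] d, of s] s by simp
    then obtain b where b: "s < b" "\<And>q. s < q \<Longrightarrow> q < b \<Longrightarrow> dist (G q x) (G s x) < d"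
      unfolding eventually_at_right_field by blast
    obtain q where q: "q \<in> \<rat>" "s < q" "q < min b (s + d)" using Rats_dense_in_real[of s "min b (s + d)"] b d by auto
    then show "\<exists>q\<in>\<rat> \<inter> {0<..}. \<bar>q - s\<bar> < d \<and> dist (G q x) (G s x) < d"
      using s b(2)[of q] by (intro bexI[of _ q]) auto
  qed (auto simp: G)
  then have cv_meas [measurable]: "Measurable.pred M cv" unfolding cv_def[abs_def] by (simp add: pred_def)
  let ?c = "THE l::complex. False"
  let ?l = "\<lambda>x. lim (\<lambda>n. G (1 / Suc n) x)"
  have seq: "filterlim (\<lambda>n. 1 / real (Suc n)) (at_right 0) sequentially"
    unfolding filterlim_at using LIMSEQ_Suc[OF lim_1_over_n] by (auto simp: eventually_sequentially)
  have conv: "L x = l \<and> (\<lambda>n. G (1 / Suc n) x) \<longlonglongrightarrow> l" if l: "((\<lambda>\<epsilon>. G \<epsilon> x) \<longlongrightarrow> l) (at_right 0)" for x l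
    using tendsto_Lim[OF _ l] filterlim_compose[OF l seq] by (simp add: L_def trivial_limit_at_right_real)
  have Lval: "L x = (if cv x then ?l x else ?c)" for x
  proof (cases "cv x")
    case True
    then obtain l where "((\<lambda>\<epsilon>. G \<epsilon> x) \<longlongrightarrow> l) (at_right 0)" by (auto simp: cv_def)
    from conv[OF this] have "L x = l" "(\<lambda>n. G (1 / Suc n) x) \<longlonglongrightarrow> l" by simp_all
    then show ?thesis using limI[of "\<lambda>n. G (1 / Suc n) x" l] True by (simp del: of_nat_Suc)
  next
    case False
    then have "(\<lambda>l. ((\<lambda>\<epsilon>. G \<epsilon> x) \<longlongrightarrow> l) (at_right 0)) = (\<lambda>l. False)" by (auto simp: cv_def)
    then show ?thesis using False by (simp add: L_def Topological_Spaces.Lim_def)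
  qed
  show Lm: "L \<in> borel_measurable M" unfolding Lval[abs_def] by measurable
  let ?u = "\<lambda>x. if cv x then ?l x else 0" and ?v = "\<lambda>x. if cv x then 0 else ?c"
  have "L = (\<lambda>x. ?u x + ?v x)" using Lval by auto
  then have "sqn M L \<le> 2 * sqn M ?u + 2 * sqn M ?v" by (simp only:) (rule sqn_add_le, measurable)
  also have "sqn M ?u \<le> X"
  proof -
    have "sqn M ?u \<le> (\<integral>\<^sup>+ x. liminf (\<lambda>n. ennreal ((cmod (G (1 / Suc n) x))\<^sup>2)) \<partial>M)"
      unfolding sqn_def
    proof (rule nn_integral_mono)
      fix x
      show "ennreal ((cmod (?u x))\<^sup>2) \<le> liminf (\<lambda>n. ennreal ((cmod (G (1 / Suc n) x))\<^sup>2))"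
      proof (cases "cv x")
        case True
        then obtain l where l: "((\<lambda>\<epsilon>. G \<epsilon> x) \<longlongrightarrow> l) (at_right 0)" by (auto simp: cv_def)
        then have t: "(\<lambda>n. G (1 / Suc n) x) \<longlonglongrightarrow> l" using conv by blast
        have "(\<lambda>n. ennreal ((cmod (G (1 / Suc n) x))\<^sup>2)) \<longlonglongrightarrow> ennreal ((cmod l)\<^sup>2)"
          by (intro tendsto_ennrealI tendsto_power tendsto_norm t)
        then have "liminf (\<lambda>n. ennreal ((cmod (G (1 / Suc n) x))\<^sup>2)) = ennreal ((cmod l)\<^sup>2)"
          by (rule lim_imp_Liminf[OF sequentially_bot])
        then show ?thesis using limI[OF t] True by simp
      qed simp
    qed
    also have "\<dots> \<le> liminf (\<lambda>n. (\<integral>\<^sup>+ x. ennreal ((cmod (G (1 / Suc n) x))\<^sup>2) \<partial>M))"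
      by (rule nn_integral_liminf) measurable
    also have "\<dots> \<le> liminf (\<lambda>n. X)"
      using bd unfolding sqn_def by (intro Liminf_mono always_eventually allI) auto
    finally show ?thesis by (simp add: Liminf_const)
  qed
  also have "sqn M ?v \<le> ennreal ((cmod ?c)\<^sup>2) * emeasure M (space M)"
  proof -
    have "sqn M ?v \<le> (\<integral>\<^sup>+ x. ennreal ((cmod ?c)\<^sup>2) \<partial>M)"
      unfolding sqn_def by (intro nn_integral_mono) auto
    then show ?thesis by simp
  qed
  finally show "sqn M L \<le> 2 * X + 2 * (ennreal ((cmod ?c)\<^sup>2) * emeasure M (space M))"
    by (simp add: add_mono mult_left_mono)
qed

section \<open>The double layer\<close>

context lipschitz_domain
begin

definition dl_rem :: "real \<Rightarrow> real^2 \<Rightarrow> real^2 \<Rightarrow> complex" where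
  "dl_rem k x y = \<i> / 4 * of_real (k * (((y - x) \<bullet> nrm y) / dist x y)) * hankel_rem (k * dist x y)"

text \<open>A jointly measurable kernel on the plane that agrees on \<Gamma> with the truncated
  normal derivative, see \<open>dl_kernel_eq\<close>; joint measurability is not evident from the
  \<open>vector_derivative\<close> in \<open>fund_sol_normal_deriv\<close>.\<close>

definition dl_kernel :: "real \<Rightarrow> real \<Rightarrow> real^2 \<Rightarrow> real^2 \<Rightarrow> complex" where
  "dl_kernel k \<epsilon> x y = indicator \<Gamma> x * indicator \<Gamma> y *
     (of_real (1 / (2 * pi)) * of_real (dipole nrm \<epsilon> x y) + (if \<epsilon> < dist x y then dl_rem k x y else 0))"

lemma dl_rem_measurable [measurable]: "(\<lambda>(x, y). dl_rem k x y) \<in> borel_measurable (borel \<Otimes>\<^sub>M borel)"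
  unfolding dl_rem_def by measurable

lemma dl_kernel_measurable [measurable]: "(\<lambda>(x, y). dl_kernel k \<epsilon> x y) \<in> borel_measurable (borel \<Otimes>\<^sub>M borel)"
  unfolding dl_kernel_def by measurable

lemma dl_kernel_eq:
  assumes "0 < k" "0 < \<epsilon>" "x \<in> \<Gamma>" "y \<in> \<Gamma>"
  shows "indicator {y. \<epsilon> < dist x y} y *\<^sub>R fund_sol_normal_deriv \<Omega> k x y = dl_kernel k \<epsilon> x y"
proof (cases "\<epsilon> < dist x y")
  case True
  then have "x \<noteq> y" using assms by auto
  then show ?thesis using fund_sol_normal_derivative[OF assms(1), of x y \<Omega>] True assms
    by (simp add: dl_kernel_def dl_rem_def dipole_def nrm_def)
qed (simp add: dl_kernel_def dipole_def)

definition rem_bound :: real where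
  "rem_bound = (SOME C. C \<ge> 0 \<and> (\<forall>z. 0 < z \<longrightarrow> z \<le> diam \<longrightarrow> cmod (hankel_rem z) \<le> C))"

lemma rem_bound: "0 \<le> rem_bound" "0 < z \<Longrightarrow> z \<le> diam \<Longrightarrow> cmod (hankel_rem z) \<le> rem_bound"
  using someI_ex[OF hankel_rem_bounded[of diam]] unfolding rem_bound_def[symmetric] by auto

lemma nrm_bound_nonneg: "0 \<le> nrm_bound" by (simp add: nrm_bound_def)

lemma dl_rem_le:
  assumes k: "0 < k" "k \<le> 1" and xy: "x \<in> \<Gamma>" "y \<in> \<Gamma>"
  shows "cmod (dl_rem k x y) \<le> nrm_bound * rem_bound"
proof (cases "x = y")
  case True
  then show ?thesis using rem_bound(1) nrm_bound_nonneg by (simp add: dl_rem_def)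
next
  case False
  then have d: "0 < dist x y" by simp
  have kd: "0 < k * dist x y" using k d by simp
  have kd2: "k * dist x y \<le> diam"
    using mult_right_mono[OF k(2), of "dist x y"] dist_le_diam[OF xy] by simp
  have "\<bar>(y - x) \<bullet> nrm y\<bar> \<le> dist x y * nrm_bound"
    using Cauchy_Schwarz_ineq2[of "y - x" "nrm y"] mult_left_mono[OF norm_nrm[of y], of "norm (y - x)"]
    by (simp add: dist_norm norm_minus_commute)
  then have "\<bar>((y - x) \<bullet> nrm y) / dist x y\<bar> \<le> nrm_bound" using d by (simp add: divide_le_eq mult.commute)
  then have "k * \<bar>((y - x) \<bullet> nrm y) / dist x y\<bar> \<le> 1 * nrm_bound" using k nrm_bound_nonneg by (intro mult_mono) auto
  then have a: "cmod (of_real (k * (((y - x) \<bullet> nrm y) / dist x y))) \<le> nrm_bound"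
    using k by (simp only: norm_of_real abs_mult abs_of_pos)
  have "cmod (dl_rem k x y) = (1/4) * (cmod (of_real (k * (((y - x) \<bullet> nrm y) / dist x y))) * cmod (hankel_rem (k * dist x y)))"
    unfolding dl_rem_def norm_mult by simp
  also have "\<dots> \<le> 1 * (nrm_bound * rem_bound)"
    using a rem_bound kd kd2 nrm_bound_nonneg by (intro mult_mono mult_nonneg_nonneg) auto
  finally show ?thesis by simp
qed

text \<open>The growth as \<epsilon> tends to 0 does no harm: the bound only provides integrability
  for a fixed \<epsilon>.\<close>

lemma dl_kernel_le:
  assumes k: "0 < k" "k \<le> 1" and e: "0 < \<epsilon>"
  shows "cmod (dl_kernel k \<epsilon> x y) \<le> nrm_bound / \<epsilon> + nrm_bound * rem_bound"
proof (cases "x \<in> \<Gamma> \<and> y \<in> \<Gamma>")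
  case True
  have "cmod (of_real (1 / (2 * pi)) * of_real (dipole nrm \<epsilon> x y)) \<le> 1 * (nrm_bound / \<epsilon>)"
    unfolding norm_mult norm_of_real
    using dipole_le_inverse[where n = nrm and B = nrm_bound and \<epsilon> = \<epsilon>, OF e norm_nrm, of x y] pi_gt3 nrm_bound_nonneg e
    by (intro mult_mono) auto
  then have "cmod (of_real (1 / (2 * pi)) * of_real (dipole nrm \<epsilon> x y)) \<le> nrm_bound / \<epsilon>" by simp
  moreover have "cmod (if \<epsilon> < dist x y then dl_rem k x y else 0) \<le> nrm_bound * rem_bound"
    using dl_rem_le[OF k] True rem_bound(1) nrm_bound_nonneg by auto
  moreover have "dl_kernel k \<epsilon> x y = of_real (1 / (2 * pi)) * of_real (dipole nrm \<epsilon> x y) + (if \<epsilon> < dist x y then dl_rem k x y else 0)"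
    using True by (simp add: dl_kernel_def)
  ultimately show ?thesis by (simp only:) (rule order_trans[OF norm_triangle_ineq add_mono])
qed (use e rem_bound(1) nrm_bound_nonneg in \<open>auto simp: dl_kernel_def indicator_def\<close>)

lemma dl_kernel_sqn:
  obtains C where "0 \<le> C" "\<And>k \<epsilon> \<phi>. 0 < k \<Longrightarrow> k \<le> 1 \<Longrightarrow> 0 < \<epsilon> \<Longrightarrow> \<phi> \<in> borel_measurable borel \<Longrightarrow> sqn N \<phi> \<le> 1 \<Longrightarrow> (\<And>y. y \<notin> \<Gamma> \<Longrightarrow> \<phi> y = 0) \<Longrightarrow>
    sqn N (\<lambda>x. \<integral>y. dl_kernel k \<epsilon> x y * \<phi> y \<partial>N) \<le> ennreal C"
proof -
  obtain C1 where C1: "0 \<le> C1" "\<forall>\<epsilon> \<phi>. 0 < \<epsilon> \<longrightarrow> \<phi> \<in> borel_measurable borel \<longrightarrow> sqn N \<phi> < \<infinity> \<longrightarrow> (\<forall>y. y \<notin> \<Gamma> \<longrightarrow> \<phi> y = 0) \<longrightarrow>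
     sqn N (\<lambda>x. \<integral>y. of_real (dipole nrm \<epsilon> x y) * \<phi> y \<partial>N) \<le> ennreal C1 * sqn N \<phi>"
    using truncated_dipole_exists by (elim exE conjE) (rule that)
  let ?D = "nrm_bound * rem_bound"
  let ?E = "?D * measure N UNIV"
  have D: "0 \<le> ?D" using rem_bound(1) nrm_bound_nonneg by simp
  show ?thesis
  proof (rule that[of "2 * C1 + 2 * ?E\<^sup>2"])
    show "0 \<le> 2 * C1 + 2 * ?E\<^sup>2" using C1(1) by simp
    fix k \<epsilon> :: real and \<phi> :: "real^2 \<Rightarrow> complex"
    assume k: "0 < k" "k \<le> 1" and e: "0 < \<epsilon>" and [measurable]: "\<phi> \<in> borel_measurable borel" and n1: "sqn N \<phi> \<le> 1" and supp: "\<And>y. y \<notin> \<Gamma> \<Longrightarrow> \<phi> y = 0"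
    have fin: "sqn N \<phi> < \<infinity>" using n1 by (auto intro: le_less_trans)
    then have int\<phi>: "integrable N \<phi>" by (intro integrable_if_sqn finite_measure_axioms) measurable
    let ?u = "\<lambda>x. \<integral>y. of_real (dipole nrm \<epsilon> x y) * \<phi> y \<partial>N"
    let ?k = "\<lambda>x y. indicator \<Gamma> x * indicator \<Gamma> y * (if \<epsilon> < dist x y then dl_rem k x y else 0)"
    let ?v = "\<lambda>x. \<integral>y. ?k x y * \<phi> y \<partial>N"
    have u: "sqn N ?u \<le> ennreal C1 * sqn N \<phi>"
      using C1(2)[rule_format, OF e _ fin] supp by auto
    have kle: "cmod (?k x y) \<le> ?D" for x y
      using dl_rem_le[OF k, of x y] D by (auto simp: indicator_def)
    have c: "(\<integral>\<^sup>+ y. ennreal ?D \<partial>N) \<le> ennreal ?E"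
      using D by (simp add: emeasure_eq_measure ennreal_mult[symmetric])
    have v: "sqn N ?v \<le> ennreal ?E * ennreal ?E * sqn N \<phi>"
      by (rule kernel_sqn_le[OF _ _ kle c c]) measurable
    let ?w = "\<lambda>x. indicator \<Gamma> x * of_real (1 / (2 * pi)) * ?u x"
    have split: "(\<integral>y. dl_kernel k \<epsilon> x y * \<phi> y \<partial>N) = ?w x + ?v x" for x
    proof -
      have i1: "integrable N (\<lambda>y. of_real (dipole nrm \<epsilon> x y) * \<phi> y)"
        by (rule integrable_bounded_mult[OF int\<phi>, where D = "nrm_bound / \<epsilon>"])
          (use dipole_le_inverse[where n = nrm and B = nrm_bound and \<epsilon> = \<epsilon>, OF e norm_nrm] in auto)
      have i2: "integrable N (\<lambda>y. ?k x y * \<phi> y)"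
        by (rule integrable_bounded_mult[OF int\<phi> _ kle]) measurable
      have "(\<integral>y. dl_kernel k \<epsilon> x y * \<phi> y \<partial>N) = (\<integral>y. indicator \<Gamma> x * of_real (1 / (2 * pi)) * (of_real (dipole nrm \<epsilon> x y) * \<phi> y) + ?k x y * \<phi> y \<partial>N)"
        using supp by (intro Bochner_Integration.integral_cong refl) (auto simp: dl_kernel_def indicator_def algebra_simps)
      also have "\<dots> = ?w x + ?v x"
        by (subst Bochner_Integration.integral_add[OF integrable_mult_right[OF i1] i2]) simp
      finally show ?thesis .
    qed
    have w: "sqn N ?w \<le> ennreal C1 * sqn N \<phi>"
    proof (rule order_trans[OF sqn_mono u])
      fix x
      have "cmod (indicator \<Gamma> x * of_real (1 / (2 * pi))) \<le> 1" using pi_gt3 by (auto simp: indicator_def norm_divide)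
      then have "cmod (indicator \<Gamma> x * of_real (1 / (2 * pi))) * cmod (?u x) \<le> 1 * cmod (?u x)" by (intro mult_right_mono) auto
      then show "cmod (?w x) \<le> cmod (?u x)" unfolding norm_mult[of "indicator \<Gamma> x * of_real (1 / (2 * pi))"] by simp
    qed
    have "sqn N (\<lambda>x. \<integral>y. dl_kernel k \<epsilon> x y * \<phi> y \<partial>N) \<le> 2 * sqn N ?w + 2 * sqn N ?v"
      unfolding split by (rule sqn_add_le) measurable
    also have "\<dots> \<le> 2 * (ennreal C1 * 1) + 2 * (ennreal ?E * ennreal ?E * 1)"
      by (intro add_mono mult_left_mono order_trans[OF w] order_trans[OF v] n1) auto
    also have "ennreal ?E * ennreal ?E = ennreal (?E\<^sup>2)" using D by (simp add: ennreal_mult[symmetric] power2_eq_square)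
    also have "2 * (ennreal C1 * 1) + 2 * (ennreal (?E\<^sup>2) * 1) = ennreal (2 * C1 + 2 * ?E\<^sup>2)"
      using C1(1) by (subst ennreal_lincomb) auto
    finally show "sqn N (\<lambda>x. \<integral>y. dl_kernel k \<epsilon> x y * \<phi> y \<partial>N) \<le> ennreal (2 * C1 + 2 * ?E\<^sup>2)" .
  qed
qed

text \<open>The inequality in the truncation is strict, so the region \<epsilon> < dist x y
  increases to s < dist x y as \<epsilon> decreases to s. Pointwise the kernel is eventually
  constant, and its modulus is dominated by the one at s.\<close>

lemma dl_right_continuous:
  fixes \<phi> :: "real^2 \<Rightarrow> complex"
  assumes k: "0 < k" "k \<le> 1" and s: "0 < s" and [measurable]: "\<phi> \<in> borel_measurable borel" and fin: "sqn N \<phi> < \<infinity>"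
  shows "((\<lambda>q. \<integral>y. dl_kernel k q x y * \<phi> y \<partial>N) \<longlongrightarrow> (\<integral>y. dl_kernel k s x y * \<phi> y \<partial>N)) (at_right s)"
proof (rule tendsto_at_right_sequentially)
  show "s < s + 1" by simp
  fix S :: "nat \<Rightarrow> real" assume S: "\<And>n. s < S n" "S \<longlonglongrightarrow> s"
  show "(\<lambda>n. \<integral>y. dl_kernel k (S n) x y * \<phi> y \<partial>N) \<longlonglongrightarrow> (\<integral>y. dl_kernel k s x y * \<phi> y \<partial>N)"
  proof (rule integral_dominated_convergence[where w = "\<lambda>y. cmod (dl_kernel k s x y * \<phi> y)"])
    show "integrable N (\<lambda>y. cmod (dl_kernel k s x y * \<phi> y))"
      by (intro integrable_norm integrable_bounded_mult[OF _ _ dl_kernel_le[OF k s]] integrable_if_sqn finite_measure_axioms fin) measurable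
    show "AE y in N. (\<lambda>n. dl_kernel k (S n) x y * \<phi> y) \<longlonglongrightarrow> dl_kernel k s x y * \<phi> y"
    proof (rule AE_I2)
      fix y
      show "(\<lambda>n. dl_kernel k (S n) x y * \<phi> y) \<longlonglongrightarrow> dl_kernel k s x y * \<phi> y"
      proof (cases "s < dist x y")
        case True
        have "eventually (\<lambda>n. S n < dist x y) sequentially" using order_tendstoD(2)[OF S(2) True] .
        then have "eventually (\<lambda>n. dl_kernel k (S n) x y * \<phi> y = dl_kernel k s x y * \<phi> y) sequentially"
          by eventually_elim (use True in \<open>simp add: dl_kernel_def dipole_def\<close>)
        then show ?thesis by (rule tendsto_eventually)
      next
        case False
        then have "\<not> S n < dist x y" for n using S(1)[of n] by simp
        then show ?thesis using False by (simp add: dl_kernel_def dipole_def)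
      qed
    qed
    show "AE y in N. norm (dl_kernel k (S n) x y * \<phi> y) \<le> cmod (dl_kernel k s x y * \<phi> y)" for n
    proof (rule AE_I2)
      fix y
      show "norm (dl_kernel k (S n) x y * \<phi> y) \<le> cmod (dl_kernel k s x y * \<phi> y)"
        using S(1)[of n] by (cases "S n < dist x y") (auto simp: dl_kernel_def dipole_def)
    qed
  qed measurable
qed

lemma double_layer_bound:
  obtains C where "0 < C" "\<And>k \<phi>. 0 < k \<Longrightarrow> k \<le> 1 \<Longrightarrow> \<phi> \<in> borel_measurable ds \<Longrightarrow> sqn ds \<phi> \<le> 1 \<Longrightarrow>
      double_layer \<Omega> k \<phi> \<in> borel_measurable ds \<and> sqn ds (double_layer \<Omega> k \<phi>) \<le> ennreal (C\<^sup>2)"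
proof -
  obtain C1 where C1: "0 \<le> C1" "\<And>k \<epsilon> \<phi>. 0 < k \<Longrightarrow> k \<le> 1 \<Longrightarrow> 0 < \<epsilon> \<Longrightarrow> \<phi> \<in> borel_measurable borel \<Longrightarrow> sqn N \<phi> \<le> 1 \<Longrightarrow> (\<And>y. y \<notin> \<Gamma> \<Longrightarrow> \<phi> y = 0) \<Longrightarrow>
    sqn N (\<lambda>x. \<integral>y. dl_kernel k \<epsilon> x y * \<phi> y \<partial>N) \<le> ennreal C1"
    by (rule dl_kernel_sqn) blast
  let ?c0 = "(cmod (THE l::complex. False))\<^sup>2 * measure N UNIV"
  \<comment> \<open>The factor 4 is the square of the 2 in \<open>double_layer\<close>, and adding 1
    makes C positive.\<close>
  define C where "C = sqrt (4 * (2 * C1 + 2 * ?c0)) + 1"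
  have pos: "0 \<le> 2 * C1 + 2 * ?c0" using C1(1) by simp
  have C: "0 < C" "4 * (2 * C1 + 2 * ?c0) \<le> C\<^sup>2"
  proof -
    show "0 < C" using pos by (simp add: C_def add_nonneg_pos)
    have "(sqrt (4 * (2 * C1 + 2 * ?c0)))\<^sup>2 \<le> C\<^sup>2" unfolding C_def using pos by (intro power_mono) auto
    then show "4 * (2 * C1 + 2 * ?c0) \<le> C\<^sup>2" using pos by simp
  qed
  show ?thesis
  proof (rule that[of C])
    fix k :: real and \<phi> assume k: "0 < k" "k \<le> 1" and \<phi>: "\<phi> \<in> borel_measurable ds" and n1: "sqn ds \<phi> \<le> 1"
    obtain \<phi>' where \<phi>'[measurable]: "\<phi>' \<in> borel_measurable borel" and supp: "\<And>y. y \<notin> \<Gamma> \<Longrightarrow> \<phi>' y = 0" and ae: "AE x in ds. \<phi> x = \<phi>' x"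
      by (rule ds_borel_representative[OF \<phi>]) blast
    have n1': "sqn N \<phi>' \<le> 1" using n1 sqn_ds[OF \<phi>' ae] by simp
    then have fin: "sqn N \<phi>' < \<infinity>" by (auto intro: le_less_trans)
    define G where "G \<epsilon> x = (\<integral>y. dl_kernel k \<epsilon> x y * \<phi>' y \<partial>N)" for \<epsilon> x
    define L where "L x = Lim (at_right 0) (\<lambda>\<epsilon>. G \<epsilon> x)" for x
    have Gm: "G \<epsilon> \<in> borel_measurable N" for \<epsilon> unfolding G_def by measurable
    have rc: "((\<lambda>q. G q x) \<longlongrightarrow> G s x) (at_right s)" if "0 < s" for x s
      unfolding G_def by (rule dl_right_continuous[OF k that \<phi>' fin])
    have bd: "sqn N (G \<epsilon>) \<le> ennreal C1" if "0 < \<epsilon>" for \<epsilon>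
      unfolding G_def by (rule C1(2)[OF k that \<phi>' n1' supp])
    have Lm: "L \<in> borel_measurable N" and Lb: "sqn N L \<le> 2 * ennreal C1 + 2 * (ennreal ((cmod (THE l. False))\<^sup>2) * emeasure N (space N))"
      using limit_at_0_sqn[of G N "ennreal C1", OF Gm rc bd] unfolding L_def[abs_def] by auto
    have Lm' [measurable]: "L \<in> borel_measurable borel" using Lm by simp
    have val: "double_layer \<Omega> k \<phi> x = 2 * L x" if x: "x \<in> \<Gamma>" for x
    proof -
      have eq: "(LINT y:{y. \<epsilon> < dist x y}|ds. fund_sol_normal_deriv \<Omega> k x y * \<phi> y) = G \<epsilon> x" if e: "0 < \<epsilon>" for \<epsilon>
      proof -
        let ?h = "\<lambda>y. indicator {y. \<epsilon> < dist x y} y *\<^sub>R fund_sol_normal_deriv \<Omega> k x y"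
        have h: "?h y = dl_kernel k \<epsilon> x y" if "y \<in> \<Gamma>" for y by (rule dl_kernel_eq[OF k(1) e x that])
        have Km: "dl_kernel k \<epsilon> x \<in> borel_measurable borel" by measurable
        have "?h \<in> borel_measurable ds \<longleftrightarrow> dl_kernel k \<epsilon> x \<in> borel_measurable ds"
          by (rule measurable_cong) (simp add: h)
        then have hm: "?h \<in> borel_measurable ds" using ds_measurable[OF Km] by simp
        have "(LINT y:{y. \<epsilon> < dist x y}|ds. fund_sol_normal_deriv \<Omega> k x y * \<phi> y) = (\<integral>y. ?h y * \<phi> y \<partial>ds)"
          by (simp add: set_lebesgue_integral_def)
        also have "\<dots> = G \<epsilon> x" unfolding G_def by (rule integral_ds_cong[OF \<phi> \<phi>' ae hm Km h])
        finally show ?thesis .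
      qed
      have "eventually (\<lambda>\<epsilon>. (LINT y:{y. \<epsilon> < dist x y}|ds. fund_sol_normal_deriv \<Omega> k x y * \<phi> y) = G \<epsilon> x) (at_right 0)"
        using eq by (auto simp: eventually_at_right_field intro!: exI[of _ 1])
      \<comment> \<open>\<open>Lim\<close> is a definite description over limits, so the agreement
        of the two families near 0 is carried over as an equivalence for every l. This also covers
        points without a principal value.\<close>
      then have "((\<lambda>\<epsilon>. LINT y:{y. \<epsilon> < dist x y}|ds. fund_sol_normal_deriv \<Omega> k x y * \<phi> y) \<longlongrightarrow> l) (at_right 0) \<longleftrightarrow> ((\<lambda>\<epsilon>. G \<epsilon> x) \<longlongrightarrow> l) (at_right 0)" for l
        by (rule tendsto_cong)
      then show ?thesis by (simp add: double_layer_def L_def Topological_Spaces.Lim_def)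
    qed
    have "double_layer \<Omega> k \<phi> \<in> borel_measurable ds \<longleftrightarrow> (\<lambda>x. 2 * L x) \<in> borel_measurable ds"
      by (rule measurable_cong) (simp add: val)
    then have m: "double_layer \<Omega> k \<phi> \<in> borel_measurable ds" by (simp add: ds_measurable)
    have "sqn ds (double_layer \<Omega> k \<phi>) = sqn N (\<lambda>x. 2 * L x)"
      by (rule sqn_ds) (auto intro!: AE_I2 simp: val)
    also have "\<dots> = ennreal 4 * sqn N L" by (subst sqn_cmult) auto
    also have "\<dots> \<le> ennreal 4 * (2 * ennreal C1 + 2 * (ennreal ((cmod (THE l. False))\<^sup>2) * emeasure N (space N)))"
      by (intro mult_left_mono Lb) simp
    also have "2 * ennreal C1 + 2 * (ennreal ((cmod (THE l. False))\<^sup>2) * emeasure N (space N)) = ennreal (2 * C1 + 2 * ?c0)"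
      using C1(1) by (simp add: emeasure_eq_measure ennreal_mult ennreal_plus)
    also have "ennreal 4 * ennreal (2 * C1 + 2 * ?c0) = ennreal (4 * (2 * C1 + 2 * ?c0))"
      using pos by (intro ennreal_mult[symmetric]) auto
    also have "\<dots> \<le> ennreal (C\<^sup>2)" by (intro ennreal_leI C)
    finally show "double_layer \<Omega> k \<phi> \<in> borel_measurable ds \<and> sqn ds (double_layer \<Omega> k \<phi>) \<le> ennreal (C\<^sup>2)"
      using m by simp
  qed (rule C)
qed

end

theorem mainTheorem5:
  fixes \<Omega> :: "(real^2) set"
  assumes "compact \<Omega>" and "lipschitz_boundary \<Omega>" and "connected (- \<Omega>)"
  shows "\<exists>C0 C2 C3 :: real. C0 > 0 \<and> C2 > 0 \<and> C3 > 0 \<and>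
    (\<forall>k. 0 < k \<and> k \<le> 1 \<longrightarrow>
       L2_op_norm (arclength_on (frontier \<Omega>)) (single_layer \<Omega> k) \<le> ennreal (C0 * (1 - ln k))) \<and>
    (\<forall>k \<eta>. 0 < k \<and> k \<le> 1 \<and> \<eta> \<noteq> 0 \<longrightarrow>
       L2_op_norm (arclength_on (frontier \<Omega>)) (combined_layer \<Omega> k \<eta>)
         \<le> ennreal (1 + C3 + C2 * sqrt k + C0 * \<bar>\<eta>\<bar> * (1 - ln k)))"
proof -
  interpret lipschitz_domain \<Omega> by unfold_locales (rule assms)+
  obtain C0 where C0: "0 < C0" and S: "\<And>k \<phi>. 0 < k \<Longrightarrow> k \<le> 1 \<Longrightarrow> \<phi> \<in> borel_measurable ds \<Longrightarrow> sqn ds \<phi> \<le> 1 \<Longrightarrow>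
      single_layer \<Omega> k \<phi> \<in> borel_measurable ds \<and> sqn ds (single_layer \<Omega> k \<phi>) \<le> ennreal ((C0 * (1 - ln k))\<^sup>2)"
    by (rule single_layer_bound) blast
  obtain C3 where C3: "0 < C3" and D: "\<And>k \<phi>. 0 < k \<Longrightarrow> k \<le> 1 \<Longrightarrow> \<phi> \<in> borel_measurable ds \<Longrightarrow> sqn ds \<phi> \<le> 1 \<Longrightarrow>
      double_layer \<Omega> k \<phi> \<in> borel_measurable ds \<and> sqn ds (double_layer \<Omega> k \<phi>) \<le> ennreal (C3\<^sup>2)"
    by (rule double_layer_bound) blast
  have single: "L2_op_norm ds (single_layer \<Omega> k) \<le> ennreal (C0 * (1 - ln k))" if k: "0 < k" "k \<le> 1" for k
  proof (rule L2_op_norm_le)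
    have "ln k \<le> 0" using k by simp
    then show "0 \<le> C0 * (1 - ln k)" using C0 by simp
  qed (rule S[OF k])
  have combined: "L2_op_norm ds (combined_layer \<Omega> k \<eta>) \<le> ennreal (1 + C3 + 1 * sqrt k + C0 * \<bar>\<eta>\<bar> * (1 - ln k))"
    if k: "0 < k" "k \<le> 1" and \<eta>: "\<eta> \<noteq> 0" for k \<eta>
  proof -
    have lnk: "ln k \<le> 0" using k by simp
    let ?B = "C0 * \<bar>\<eta>\<bar> * (1 - ln k)"
    \<comment> \<open>\<open>sqn_add_le_square\<close> divides by both bounds; positivity of this
      one comes from \<eta> \<noteq> 0.\<close>
    have B: "0 < ?B" using C0 \<eta> lnk by simp
    have "L2_op_norm ds (combined_layer \<Omega> k \<eta>) \<le> ennreal (1 + C3 + ?B)"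
    proof (rule L2_op_norm_le)
      show "0 \<le> 1 + C3 + ?B" using C3 B by simp
      fix \<phi> assume [measurable]: "\<phi> \<in> borel_measurable ds" and n1: "sqn ds \<phi> \<le> 1"
      have [measurable]: "double_layer \<Omega> k \<phi> \<in> borel_measurable ds" "single_layer \<Omega> k \<phi> \<in> borel_measurable ds"
        using S[OF k, of \<phi>] D[OF k, of \<phi>] n1 by auto
      let ?s = "\<lambda>x. (- \<i> * of_real \<eta>) * single_layer \<Omega> k \<phi> x"
      have s: "sqn ds ?s \<le> ennreal (?B\<^sup>2)"
      proof -
        have "sqn ds ?s = ennreal (\<eta>\<^sup>2) * sqn ds (single_layer \<Omega> k \<phi>)"
          by (subst sqn_cmult) (auto simp: norm_mult)
        also have "\<dots> \<le> ennreal (\<eta>\<^sup>2) * ennreal ((C0 * (1 - ln k))\<^sup>2)"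
          using S[OF k, of \<phi>] n1 by (intro mult_left_mono) auto
        also have "\<dots> = ennreal (\<eta>\<^sup>2 * (C0 * (1 - ln k))\<^sup>2)" by (rule ennreal_mult[symmetric]) auto
        also have "\<eta>\<^sup>2 * (C0 * (1 - ln k))\<^sup>2 = ?B\<^sup>2" by (simp add: power_mult_distrib)
        finally show ?thesis .
      qed
      have d: "sqn ds (\<lambda>x. \<phi> x + double_layer \<Omega> k \<phi> x) \<le> ennreal ((1 + C3)\<^sup>2)"
        using D[OF k, of \<phi>] n1 C3 by (intro sqn_add_le_square) auto
      have "sqn ds (\<lambda>x. (\<phi> x + double_layer \<Omega> k \<phi> x) + ?s x) \<le> ennreal ((1 + C3 + ?B)\<^sup>2)"
        by (rule sqn_add_le_square[OF _ _ _ d B s]) (use C3 in auto)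
      moreover have "combined_layer \<Omega> k \<eta> \<phi> = (\<lambda>x. (\<phi> x + double_layer \<Omega> k \<phi> x) + ?s x)"
        by (rule ext) (simp add: combined_layer_def)
      ultimately show "combined_layer \<Omega> k \<eta> \<phi> \<in> borel_measurable ds \<and> sqn ds (combined_layer \<Omega> k \<eta> \<phi>) \<le> ennreal ((1 + C3 + ?B)\<^sup>2)"
        by simp
    qed
    \<comment> \<open>The double layer is bounded uniformly in k \<le> 1, entirely within C3. The
      term with C2 is added afterwards, with 1 as its coefficient.\<close>
    also have "\<dots> \<le> ennreal (1 + C3 + 1 * sqrt k + ?B)" using k by (intro ennreal_leI) auto
    finally show ?thesis .
  qed
  show ?thesis
    by (rule exI[of _ C0], rule exI[of _ 1], rule exI[of _ C3]) (use C0 C3 single combined in simp)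
qed

end
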